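(* Let $G\subseteq G_f$ be a subgroup. The $\cup$-product of $\mathcal{A}'_{f,G}$ is compatible with the bigrading $(q_l,q_r)$: if $\phi,\psi$ are homogeneous polynomials and $u,v\in G$ are such that $\lfloor\phi\rfloor\xi_u\cup\lfloor\psi\rfloor\xi_v\neq0$, then this product is homogeneous with respect to the bigrading, and \[ q_\bullet\big(\lfloor\phi\rfloor\xi_u\cup\lfloor\psi\rfloor\xi_v\big)=q_\bullet(\lfloor\phi\rfloor\xi_u)+q_\bullet(\lfloor\psi\rfloor\xi_v)\qquad\text{for }q_\bullet=q_l\text{ and }q_\bullet=q_r. \]
   Context: Setting. $N,n$ are positive integers such that $0$ is the only critical point of $f=x_1^n+\dots+x_N^n\in\mathbb{C}[\mathbf{x}]=\mathbb{C}[x_1,\dots,x_N]$ (i.e. $n\ge2$); $\zeta_m=\exp(2\pi\sqrt{-1}/m)$. $G_f^d$ is the group of diagonal matrices $g=\mathrm{diag}(g_1,\dots,g_N)$ with $f(g\mathbf{x})=f(\mathbf{x})$ (so $g_i^n=1$), and $G_f=S_N\ltimes G_f^d$ with product $(\sigma',h)(\sigma,g)=(\sigma'\sigma,\sigma^{-1}(h)g)$, $(\sigma^{-1}(h))_k=h_{\sigma(k)}$, acting on $\mathbb{C}[\mathbf{x}]$ by algebra automorphisms with $(\sigma,g)(x_k)=g_kx_{\sigma(k)}$; $\phi(u(\mathbf{x}))$ denotes the image of $\phi$ under $u$. $(i_1,\dots,i_k)$ is the cyclic permutation $i_a\mapsto i_{a+1}$, $i_k\mapsto i_1$, always written with $i_1$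 the smallest index. $(\sigma,g)$ is a cycle of length $k$ if $\sigma=(i_1,\dots,i_k)$ and $g_j=1$ for $j\notin\{i_1,\dots,i_k\}$; it is special if $\det g=1$, non-special otherwise. For a special cycle put $\widetilde g_{i_1}=1$, $\widetilde g_{i_a}=g_{i_1}\cdots g_{i_{a-1}}$. Sectors. $\mathrm{Fix}(u)\subseteq\mathbb{C}^N$ is the common zero locus of the functions $u(x_i)-x_i$; $N_u=\dim\mathrm{Fix}(u)$, $d_u=N-N_u$, $I_u^c=\{i: u(x_i)\ne x_i\}$, $f^u=f|_{\mathrm{Fix}(u)}$, $\mathrm{Jac}(f^u)$ is the Jacobian algebra of $f^u$ ($=\mathbb{C}$ if $f^u\equiv0$), and $\lfloor\phi\rfloor$ is the class of $\phi|_{\mathrm{Fix}(u)}$. $\mathcal{A}'_{f,G}=\bigoplus_{u\in G}\mathcal{A}'_u$, $\mathcal{A}'_u=\mathrm{Jac}(f^u)\xi_u$ with $\xi_u$ a formal letter. Product. $\lfloor\phi\rfloor\xi_u\cup\lfloor\psi\rfloor\xi_v=\lfloor\phi(\mathbf{x})\,\psi(u(\mathbf{x}))\,\sigma_{u,v}\rfloor\xi_{uv}$, where $\sigma_{u,v}$ is as follows (Shklyarov; this makes $\mathcal{A}'_{f,G}$ an associative algebra isomorphic to the Hochschild cohomology $\mathsf{HH}^*(\mathbb{C}[\mathbf{x}],f;\mathbb{C}[\mathbf{x}]\rtimes G)$). Let $\theta_i$ (degree $-1$) and $\partial_{\theta_i}$ (degree $1$) generate the Clifford algebra: $\theta$'s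 anticommute, $\partial_\theta$'s anticommute, $\partial_{\theta_i}\theta_j=-\theta_j\partial_{\theta_i}+\delta_{ij}$; $\theta_i$ acts on $\mathbb{C}[\partial_\theta]$ by contraction. Elements $\partial_{\widetilde\theta_u}$: for a special cycle, $\sum_{m=1}^k(-1)^{m-1}\widetilde g_{i_m}\partial_{\theta_{i_1}}\cdots\widehat{\partial_{\theta_{i_m}}}\cdots\partial_{\theta_{i_k}}$; for a non-special cycle, $\partial_{\theta_{i_1}}\cdots\partial_{\theta_{i_k}}$; for a diagonal element, the product of $\partial_{\theta_i}$, $i\in I_u^c$, in increasing order; in general, the product of these over the factors in the decomposition of $u$ into factors with disjoint $I^c$ (its diagonal part and its cycles), ordered by increasing smallest index. In eigencoordinates $\widetilde x_i$ of $u$ with eigenvalues $\lambda_i$ and corresponding $\widetilde\theta_i$, $\mathrm{H}_{f,u}=\sum_{j<i,\ \lambda_i,\lambda_j\ne1}\frac{1}{1-\lambda_j}\nabla_j^{\mathbf{x}\to(\mathbf{x},\mathbf{x}^u)}\nabla_i^{\mathbf{x}\to(\mathbf{x},u(\mathbf{x}))}(f)\,\widetilde\theta_j\widetilde\theta_i$, where $\mathbf{x}^u$ is the restriction of $\mathbf{x}$ to $\mathrm{Fix}(u)$, and $\nabla_i^{\mathbf{x}\to(\mathbf{x},\mathbf{y})}(p)=\frac{p(y_1,\dots,y_{i-1},x_i,\dots)-p(y_1,\dots,y_i,x_{i+1},\dots)}{x_i-y_i}$, with the indicated substitution for $\mathbf{y}$. Put $\widetilde\xi_u=\exp(\mathrm{H}_{f,u})\cdot\partial_{\widetilde\theta_u}$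 and $\mathrm{H}_f(\mathbf{x},u(\mathbf{x}),\mathbf{x})=\sum_{i=1}^N\sum_{a+b=n-2}(a+1)x_i^a\,u(x_i)^b\,\theta_i\otimes\theta_i$. With $\Upsilon(p_1\otimes p_2\otimes q_1\otimes q_2)=(-1)^{|q_1||p_2|}p_1(q_1)\cdot p_2(q_2)$, $\sigma_{u,v}$ is the coefficient of $\widetilde\xi_{uv}$ in $\Upsilon\big(\exp(\mathrm{H}_f(\mathbf{x},u(\mathbf{x}),\mathbf{x}))\cdot\widetilde\xi_u\otimes\widetilde\xi_v\big)$, taken in $\mathrm{Jac}(f^{uv})$. Bigrading. For $u\in G$ with eigenvalues $\exp(2\pi\sqrt{-1}a_k)$, $a_k\in\mathbb{Q}\cap[0,1)$, $k=1,\dots,N$, of the linear map $\mathbf{x}\mapsto u\mathbf{x}$, put $\mathrm{age}(u)=\sum_ka_k$. For a homogeneous polynomial $\phi$ the element $\lfloor\phi\rfloor\xi_u$ has left and right charges $q_l=\frac{\deg\phi-d_u}{n}+\mathrm{age}(u)$ and $q_r=\frac{\deg\phi-d_u}{n}+\mathrm{age}(u^{-1})$. *)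

theory Defs
  imports
    "HOL-Analysis.Analysis"
    "HOL-Library.Poly_Mapping"
    "HOL-Combinatorics.Cycles"
    "HOL-Algebra.QuotRing"
    "Jordan_Normal_Form.Char_Poly"
    "Jordan_Normal_Form.VS_Connect"
begin

text \<open>The variables \<open>x\<^sub>1, \<dots>, x\<^sub>N\<close> are numbered \<open>0, \<dots>, N - 1\<close> throughout.\<close>

subsection \<open>Polynomials\<close>

type_synonym mpoly = "(nat \<Rightarrow>\<^sub>0 nat) \<Rightarrow>\<^sub>0 complex"

definition Cst :: "complex \<Rightarrow> mpoly" where
  "Cst c = Poly_Mapping.single 0 c"

definition X :: "nat \<Rightarrow> mpoly" where
  "X i = Poly_Mapping.single (Poly_Mapping.single i 1) 1"

definition polys :: "nat \<Rightarrow> mpoly set" where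
  "polys N = {p. \<forall>m\<in>Poly_Mapping.keys p. Poly_Mapping.keys m \<subseteq> {..<N}}"

definition homogeneous :: "nat \<Rightarrow> mpoly \<Rightarrow> bool" where
  "homogeneous d p \<longleftrightarrow>
     (\<forall>m\<in>Poly_Mapping.keys p. (\<Sum>i\<in>Poly_Mapping.keys m. Poly_Mapping.lookup m i) = d)"

definition insertion ::
    "(complex \<Rightarrow> 'a) \<Rightarrow> (nat \<Rightarrow> 'a) \<Rightarrow> mpoly \<Rightarrow> 'a :: comm_semiring_1" where
  "insertion c s p =
     (\<Sum>m\<in>Poly_Mapping.keys p. c (Poly_Mapping.lookup p m) *
        (\<Prod>i\<in>Poly_Mapping.keys m. s i ^ Poly_Mapping.lookup m i))"

abbreviation subst :: "(nat \<Rightarrow> mpoly) \<Rightarrow> mpoly \<Rightarrow> mpoly" where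
  "subst \<equiv> insertion Cst"

definition evalp :: "mpoly \<Rightarrow> complex vec \<Rightarrow> complex" where
  "evalp p x = insertion (\<lambda>c. c) (\<lambda>i. x $ i) p"

definition fermat :: "nat \<Rightarrow> nat \<Rightarrow> mpoly" where
  "fermat N n = (\<Sum>i<N. X i ^ n)"


subsection \<open>The symmetry group\<close>

text \<open>A pair \<open>(\<sigma>, g)\<close> is normalised by \<open>\<sigma> k = k\<close> and \<open>g k = 1\<close> for \<open>k \<ge> N\<close>.\<close>

type_synonym elt = "(nat \<Rightarrow> nat) \<times> (nat \<Rightarrow> complex)"

definition Gfd :: "nat \<Rightarrow> nat \<Rightarrow> (nat \<Rightarrow> complex) set" where
  "Gfd N n = {g. (\<forall>k\<ge>N. g k = 1) \<and> subst (\<lambda>k. Cst (g k) * X k) (fermat N n) = fermat N n}"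

definition Gf :: "nat \<Rightarrow> nat \<Rightarrow> elt monoid" where
  "Gf N n = \<lparr>carrier = {(\<sigma>, g). \<sigma> permutes {..<N} \<and> g \<in> Gfd N n},
             monoid.mult = (\<lambda>(\<tau>, h) (\<sigma>, g). (\<tau> \<circ> \<sigma>, \<lambda>k. h (\<sigma> k) * g k)),
             one = (id, \<lambda>_. 1)\<rparr>"

definition act :: "elt \<Rightarrow> mpoly \<Rightarrow> mpoly" where
  "act u = subst (\<lambda>k. Cst (snd u k) * X (fst u k))"


subsection \<open>Sectors\<close>

definition Fix :: "nat \<Rightarrow> elt \<Rightarrow> complex vec set" where
  "Fix N u = {x \<in> carrier_vec N. \<forall>i<N. evalp (act u (X i) - X i) x = 0}"

definition Fix_dim :: "nat \<Rightarrow> elt \<Rightarrow> nat" where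
  "Fix_dim N u =
     vectorspace.dim class_ring (module_vec TYPE(complex) N \<lparr>carrier := Fix N u\<rparr>)"

definition Fix_codim :: "nat \<Rightarrow> elt \<Rightarrow> nat" where
  "Fix_codim N u = N - Fix_dim N u"

definition poly_functions :: "nat \<Rightarrow> complex vec set \<Rightarrow> (complex vec \<Rightarrow> complex) ring" where
  "poly_functions N S =
     \<lparr>carrier = (\<lambda>p. restrict (evalp p) S) ` polys N,
      monoid.mult = (\<lambda>F G. \<lambda>x\<in>S. F x * G x), one = (\<lambda>x\<in>S. 1),
      zero = (\<lambda>x\<in>S. 0), add = (\<lambda>F G. \<lambda>x\<in>S. F x + G x)\<rparr>"

definition deriv_along ::
    "complex vec set \<Rightarrow> complex vec \<Rightarrow> (complex vec \<Rightarrow> complex) \<Rightarrow> complex vec \<Rightarrow> complex" where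
  "deriv_along S w F = (\<lambda>x\<in>S. deriv (\<lambda>t. F (x + t \<cdot>\<^sub>v w)) 0)"

text \<open>
  For a linear subspace \<open>S\<close> and a polynomial function \<open>F\<close> on it, the Jacobian ideal is generated
  by the derivatives of \<open>F\<close> along all \<open>w \<in> S\<close>; by linearity in \<open>w\<close> these are the combinations
  of the partial derivatives of \<open>F\<close> in any linear coordinates of \<open>S\<close>. The restriction of
  \<open>fermat N n\<close> to \<open>Fix N u\<close> vanishes identically only if \<open>Fix N u = {0}\<close>; the quotient is then
  the field of constants, in accordance with the usual convention.
\<close>

definition jac_ideal ::
    "nat \<Rightarrow> complex vec set \<Rightarrow> (complex vec \<Rightarrow> complex) \<Rightarrow> (complex vec \<Rightarrow> complex) set" where
  "jac_ideal N S F = genideal (poly_functions N S) ((\<lambda>w. deriv_along S w F) ` S)"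

definition f_sector :: "nat \<Rightarrow> nat \<Rightarrow> elt \<Rightarrow> complex vec \<Rightarrow> complex" where
  "f_sector N n u = restrict (evalp (fermat N n)) (Fix N u)"

definition Jac :: "nat \<Rightarrow> nat \<Rightarrow> elt \<Rightarrow> (complex vec \<Rightarrow> complex) set ring" where
  "Jac N n u =
     poly_functions N (Fix N u) Quot jac_ideal N (Fix N u) (f_sector N n u)"

definition jclass :: "nat \<Rightarrow> nat \<Rightarrow> elt \<Rightarrow> mpoly \<Rightarrow> (complex vec \<Rightarrow> complex) set" where
  "jclass N n u \<phi> =
     jac_ideal N (Fix N u) (f_sector N n u) +>\<^bsub>poly_functions N (Fix N u)\<^esub>
       restrict (evalp \<phi>) (Fix N u)"

text \<open>
  Elements of \<open>\<A>'\<close> are families indexed by \<open>w \<in> G\<close>; the group \<open>G\<close> is finite, so there is no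
  support condition. \<open>sector_elt N n G u \<phi>\<close> is the class of \<open>\<phi>\<close> times the letter \<open>\<xi>\<^sub>u\<close>.
\<close>

definition A_space ::
    "nat \<Rightarrow> nat \<Rightarrow> elt set \<Rightarrow> (elt \<Rightarrow> (complex vec \<Rightarrow> complex) set) set" where
  "A_space N n G = (\<Pi>\<^sub>E w\<in>G. carrier (Jac N n w))"

definition A_zero :: "nat \<Rightarrow> nat \<Rightarrow> elt set \<Rightarrow> elt \<Rightarrow> (complex vec \<Rightarrow> complex) set" where
  "A_zero N n G = (\<lambda>w\<in>G. \<zero>\<^bsub>Jac N n w\<^esub>)"

definition sector_elt ::
    "nat \<Rightarrow> nat \<Rightarrow> elt set \<Rightarrow> elt \<Rightarrow> mpoly \<Rightarrow> elt \<Rightarrow> (complex vec \<Rightarrow> complex) set" where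
  "sector_elt N n G u \<phi> = (\<lambda>w\<in>G. if w = u then jclass N n u \<phi> else \<zero>\<^bsub>Jac N n w\<^esub>)"


subsection \<open>Exterior algebra and contraction\<close>

text \<open>
  An element of \<open>\<complex>[x][\<theta>]\<close> or of \<open>\<complex>[x][\<partial>\<^sub>\<theta>]\<close> is given by its coefficients: the value at
  \<open>S = {s\<^sub>1 < \<dots> < s\<^sub>r}\<close> is the coefficient of the monomial with factors \<open>s\<^sub>1, \<dots>, s\<^sub>r\<close> in this
  order. \<open>ext2\<close> does the same for \<open>\<complex>[x][\<theta>] \<otimes> \<complex>[x][\<theta>]\<close> over \<open>\<complex>[x]\<close>.
\<close>

type_synonym ext = "nat set \<Rightarrow> mpoly"
type_synonym ext2 = "nat set \<Rightarrow> nat set \<Rightarrow> mpoly"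

definition shuffle_sign :: "nat set \<Rightarrow> nat set \<Rightarrow> mpoly" where
  "shuffle_sign A B = (-1) ^ card {(a, b) \<in> A \<times> B. b < a}"

definition ext_one :: ext where
  "ext_one S = (if S = {} then 1 else 0)"

definition ext_gen :: "nat \<Rightarrow> ext" where
  "ext_gen i S = (if S = {i} then 1 else 0)"

definition wedge :: "ext \<Rightarrow> ext \<Rightarrow> ext" where
  "wedge p q S = (\<Sum>A\<in>Pow S. shuffle_sign A (S - A) * p A * q (S - A))"

definition wedge_list :: "ext list \<Rightarrow> ext" where
  "wedge_list ps = foldr wedge ps ext_one"

definition ext2_one :: ext2 where
  "ext2_one A B = (if A = {} \<and> B = {} then 1 else 0)"

text \<open>Koszul sign rule \<open>(p\<^sub>1 \<otimes> p\<^sub>2)(q\<^sub>1 \<otimes> q\<^sub>2) = (-1)\<^bsup>|p\<^sub>2||q\<^sub>1|\<^esup> p\<^sub>1q\<^sub>1 \<otimes> p\<^sub>2q\<^sub>2\<close>.\<close>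

definition ext2_mult :: "ext2 \<Rightarrow> ext2 \<Rightarrow> ext2" where
  "ext2_mult P Q A B =
     (\<Sum>A'\<in>Pow A. \<Sum>B'\<in>Pow B.
        (-1) ^ (card B' * card (A - A')) * shuffle_sign A' (A - A') * shuffle_sign B' (B - B') *
        P A' B' * Q (A - A') (B - B'))"

text \<open>
  The exponentials are only applied to elements without constant term in \<open>N\<close> odd generators
  (on each side), whose powers beyond the \<open>N\<close>-th vanish.
\<close>

definition ext_exp :: "nat \<Rightarrow> ext \<Rightarrow> ext" where
  "ext_exp N p S = (\<Sum>k\<le>N. Cst (1 / fact k) * (wedge p ^^ k) ext_one S)"

definition ext2_exp :: "nat \<Rightarrow> ext2 \<Rightarrow> ext2" where
  "ext2_exp N P A B = (\<Sum>k\<le>N. Cst (1 / fact k) * (ext2_mult P ^^ k) ext2_one A B)"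

text \<open>
  The action of \<open>\<theta>\<^sub>i\<close> on \<open>\<complex>[\<partial>\<^sub>\<theta>]\<close> is the antiderivation with \<open>\<theta>\<^sub>i(\<partial>\<^sub>\<theta>\<^sub>j) = \<delta>\<^sub>i\<^sub>j\<close>, as forced by
  \<open>\<theta>\<^sub>j\<partial>\<^sub>\<theta>\<^sub>i = -\<partial>\<^sub>\<theta>\<^sub>i\<theta>\<^sub>j + \<delta>\<^sub>i\<^sub>j\<close> and \<open>\<theta>\<^sub>i(1) = 0\<close>.
\<close>

definition contract :: "nat \<Rightarrow> ext \<Rightarrow> ext" where
  "contract i q S = (if i \<in> S then 0 else (-1) ^ card {s \<in> S. s < i} * q (insert i S))"

definition contract_set :: "nat set \<Rightarrow> ext \<Rightarrow> ext" where
  "contract_set A q = foldr contract (sorted_list_of_set A) q"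

definition theta_act :: "nat \<Rightarrow> ext \<Rightarrow> ext \<Rightarrow> ext" where
  "theta_act N p q S = (\<Sum>A\<in>Pow {..<N}. p A * contract_set A q S)"

definition Upsilon :: "nat \<Rightarrow> ext2 \<Rightarrow> ext \<Rightarrow> ext \<Rightarrow> ext" where
  "Upsilon N P q1 q2 S =
     (\<Sum>A\<in>Pow {..<N}. \<Sum>B\<in>Pow {..<N}.
        P A B * wedge (contract_set A (\<lambda>T. (-1) ^ (card T * card B) * q1 T))
                      (contract_set B q2) S)"


subsection \<open>The elements \<open>\<partial>\<^sub>\<theta>\<^sub>u\<close>\<close>

text \<open>\<open>support \<sigma> i\<close> is the list \<open>[i, \<sigma> i, \<sigma> (\<sigma> i), \<dots>]\<close> of the cycle of \<open>\<sigma>\<close> through \<open>i\<close>.\<close>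

definition special_cycle :: "elt \<Rightarrow> nat \<Rightarrow> bool" where
  "special_cycle u i \<longleftrightarrow> (\<Prod>j\<leftarrow>support (fst u) i. snd u j) = 1"

definition d_cycle :: "elt \<Rightarrow> nat \<Rightarrow> ext" where
  "d_cycle u i = (let c = support (fst u) i in
     if special_cycle u i
     then (\<lambda>S. \<Sum>m<length c.
             Cst ((-1) ^ m * (\<Prod>j\<leftarrow>take m c. snd u j)) *
             wedge_list (map ext_gen (take m c @ drop (Suc m) c)) S)
     else wedge_list (map ext_gen c))"

definition diag_support :: "nat \<Rightarrow> elt \<Rightarrow> nat set" where
  "diag_support N u = {i. i < N \<and> fst u i = i \<and> snd u i \<noteq> 1}"

text \<open>The factor of \<open>u\<close> whose smallest index is \<open>i\<close>, or \<open>1\<close> if there is none.\<close>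

definition d_factor :: "nat \<Rightarrow> elt \<Rightarrow> nat \<Rightarrow> ext" where
  "d_factor N u i =
     (if fst u i \<noteq> i \<and> i = Min (set (support (fst u) i)) then d_cycle u i
      else if diag_support N u \<noteq> {} \<and> i = Min (diag_support N u)
      then wedge_list (map ext_gen (sorted_list_of_set (diag_support N u)))
      else ext_one)"

definition d_theta :: "nat \<Rightarrow> elt \<Rightarrow> ext" where
  "d_theta N u = wedge_list (map (d_factor N u) [0..<N])"


subsection \<open>Eigencoordinates and \<open>H\<^sub>f\<^sub>,\<^sub>u\<close>\<close>

text \<open>
  Row \<open>i\<close> of \<open>coord_mat\<close> expresses the eigencoordinate \<open>x~\<^sub>i\<close> in \<open>x\<^sub>0, \<dots>, x\<^sub>N\<^sub>-\<^sub>1\<close>, and \<open>\<theta>~\<^sub>i\<close> in the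
  \<open>\<theta>\<^sub>j\<close>; \<open>coord_inv\<close> is the inverse matrix, so that its column \<open>i\<close> gives \<open>\<partial>\<^sub>\<theta>~\<^sub>i\<close>.
\<close>

record eigensystem =
  coord_mat :: "complex mat"
  coord_inv :: "complex mat"
  eigval :: "nat \<Rightarrow> complex"

definition xt :: "nat \<Rightarrow> eigensystem \<Rightarrow> nat \<Rightarrow> mpoly" where
  "xt N E i = (\<Sum>j<N. Cst (coord_mat E $$ (i, j)) * X j)"

definition thetat :: "nat \<Rightarrow> eigensystem \<Rightarrow> nat \<Rightarrow> ext" where
  "thetat N E i S = (\<Sum>j<N. Cst (coord_mat E $$ (i, j)) * ext_gen j S)"

definition d_thetat :: "nat \<Rightarrow> eigensystem \<Rightarrow> nat \<Rightarrow> ext" where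
  "d_thetat N E i S = (\<Sum>j<N. Cst (coord_inv E $$ (j, i)) * ext_gen j S)"

text \<open>
  Eigencoordinates are chosen cycle by cycle: \<open>x~\<^sub>i\<close> involves only the variables in the cycle of
  \<open>i\<close>. On a cycle of length \<open>k\<close> the eigenvalues are the \<open>k\<close> distinct \<open>k\<close>-th roots of the
  determinant, so such coordinates exist and are unique up to scaling and to their order within
  each cycle.
\<close>

definition eigencoordinates :: "nat \<Rightarrow> elt \<Rightarrow> eigensystem \<Rightarrow> bool" where
  "eigencoordinates N u E \<longleftrightarrow>
     coord_mat E \<in> carrier_mat N N \<and> coord_inv E \<in> carrier_mat N N \<and>
     inverts_mat (coord_mat E) (coord_inv E) \<and> inverts_mat (coord_inv E) (coord_mat E) \<and>
     (\<forall>i<N. act u (xt N E i) = Cst (eigval E i) * xt N E i) \<and>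
     (\<forall>i<N. \<forall>j<N. coord_mat E $$ (i, j) \<noteq> 0 \<longrightarrow> j \<in> set (support (fst u) i))"

text \<open>
  \<open>subst_xt N E y\<close> substitutes \<open>y k\<close> for the coordinate \<open>x~\<^sub>k\<close>. The second argument of \<open>nabla\<close>
  is the family substituted for the second set of variables.
\<close>

definition subst_xt :: "nat \<Rightarrow> eigensystem \<Rightarrow> (nat \<Rightarrow> mpoly) \<Rightarrow> mpoly \<Rightarrow> mpoly" where
  "subst_xt N E y = subst (\<lambda>j. \<Sum>k<N. Cst (coord_inv E $$ (j, k)) * y k)"

definition nabla :: "nat \<Rightarrow> eigensystem \<Rightarrow> (nat \<Rightarrow> mpoly) \<Rightarrow> nat \<Rightarrow> mpoly \<Rightarrow> mpoly" where
  "nabla N E y i p =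
     (THE q. q * (xt N E i - y i) =
        subst_xt N E (\<lambda>k. if k < i then y k else xt N E k) p -
        subst_xt N E (\<lambda>k. if k \<le> i then y k else xt N E k) p)"

definition H_fu :: "nat \<Rightarrow> nat \<Rightarrow> eigensystem \<Rightarrow> elt \<Rightarrow> ext" where
  "H_fu N n E u S =
     (\<Sum>i<N. \<Sum>j<i.
        if eigval E i \<noteq> 1 \<and> eigval E j \<noteq> 1
        then Cst (1 / (1 - eigval E j)) *
             nabla N E (\<lambda>k. if eigval E k = 1 then xt N E k else 0) j
               (nabla N E (\<lambda>k. act u (xt N E k)) i (fermat N n)) *
             wedge (thetat N E j) (thetat N E i) S
        else 0)"

definition xi_tilde :: "nat \<Rightarrow> nat \<Rightarrow> eigensystem \<Rightarrow> elt \<Rightarrow> ext" where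
  "xi_tilde N n E u = theta_act N (ext_exp N (H_fu N n E u)) (d_theta N u)"


subsection \<open>The product\<close>

definition H_f :: "nat \<Rightarrow> nat \<Rightarrow> elt \<Rightarrow> ext2" where
  "H_f N n u A B =
     (\<Sum>i<N. if A = {i} \<and> B = {i}
             then \<Sum>a\<le>n - 2. of_nat (a + 1) * X i ^ a * act u (X i) ^ (n - 2 - a)
             else 0)"

text \<open>
  The products of the \<open>\<partial>\<^sub>\<theta>~\<^sub>i\<close> form a basis of \<open>\<complex>[x][\<partial>\<^sub>\<theta>]\<close> over \<open>\<complex>[x]\<close>; since
  \<open>xi_tilde\<close> is a nonzero constant times the product over all \<open>i\<close> with \<open>\<lambda>\<^sub>i \<noteq> 1\<close> plus terms of
  lower degree, it may replace that product in the basis, and the coefficient is taken with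
  respect to the resulting basis.
\<close>

definition xi_coeff :: "nat \<Rightarrow> nat \<Rightarrow> eigensystem \<Rightarrow> elt \<Rightarrow> ext \<Rightarrow> mpoly" where
  "xi_coeff N n E w Z =
     (THE c. \<exists>z. z {i. i < N \<and> eigval E i \<noteq> 1} = 0 \<and>
        (\<forall>S. Z S = c * xi_tilde N n E w S +
           (\<Sum>I\<in>Pow {..<N}. z I * wedge_list (map (d_thetat N E) (sorted_list_of_set I)) S)))"

text \<open>
  As in \<open>\<phi>(x)\<psi>(u(x))\<close>, the variables of the second tensor factor are \<open>u(x)\<close>: the polynomial
  coefficients of \<open>xi_tilde\<close> for \<open>v\<close> enter as \<open>H\<^sub>f\<^sub>,\<^sub>v(u(x))\<close>.
\<close>

definition sigma_uv :: "nat \<Rightarrow> nat \<Rightarrow> (elt \<Rightarrow> eigensystem) \<Rightarrow> elt \<Rightarrow> elt \<Rightarrow> mpoly" where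
  "sigma_uv N n E u v = (let w = u \<otimes>\<^bsub>Gf N n\<^esub> v in
     xi_coeff N n (E w) w
       (Upsilon N (ext2_exp N (H_f N n u))
          (xi_tilde N n (E u) u) (\<lambda>S. act u (xi_tilde N n (E v) v S))))"

definition cup ::
    "nat \<Rightarrow> nat \<Rightarrow> elt set \<Rightarrow> (elt \<Rightarrow> eigensystem) \<Rightarrow> mpoly \<times> elt \<Rightarrow> mpoly \<times> elt \<Rightarrow>
     elt \<Rightarrow> (complex vec \<Rightarrow> complex) set" where
  "cup N n G E = (\<lambda>(\<phi>, u) (\<psi>, v).
     sector_elt N n G (u \<otimes>\<^bsub>Gf N n\<^esub> v) (\<phi> * act u \<psi> * sigma_uv N n E u v))"


subsection \<open>The bigrading\<close>

definition lin_mat :: "nat \<Rightarrow> elt \<Rightarrow> complex mat" where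
  "lin_mat N u = mat N N (\<lambda>(i, j). if j = fst u i then snd u i else 0)"

definition age :: "nat \<Rightarrow> elt \<Rightarrow> real" where
  "age N u = (\<Sum>z\<in>#proots (char_poly (lin_mat N u)). Arg2pi z / (2 * pi))"

text \<open>The charges of a class of a homogeneous polynomial of degree \<open>d\<close> in the sector of \<open>u\<close>.\<close>

definition q_l :: "nat \<Rightarrow> nat \<Rightarrow> nat \<Rightarrow> elt \<Rightarrow> real" where
  "q_l N n d u = (real d - real (Fix_codim N u)) / real n + age N u"

definition q_r :: "nat \<Rightarrow> nat \<Rightarrow> nat \<Rightarrow> elt \<Rightarrow> real" where
  "q_r N n d u = (real d - real (Fix_codim N u)) / real n + age N (inv\<^bsub>Gf N n\<^esub> u)"

definition bigraded_part ::
    "nat \<Rightarrow> nat \<Rightarrow> elt set \<Rightarrow> real \<Rightarrow> real \<Rightarrow> (elt \<Rightarrow> (complex vec \<Rightarrow> complex) set) set" where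
  "bigraded_part N n G a b =
     {x \<in> A_space N n G. \<forall>w\<in>G. \<exists>d \<phi>. \<phi> \<in> polys N \<and> homogeneous d \<phi> \<and> x w = jclass N n w \<phi> \<and>
        (\<phi> = 0 \<or> q_l N n d w = a \<and> q_r N n d w = b)}"

end

theory Submission
  imports Defs "Jordan_Normal_Form.Jordan_Normal_Form_Uniqueness"
begin

text \<open>
  Give \<open>x\<^sub>i\<close> weight 1 and \<open>\<partial>\<^sub>\<theta>\<^sub>i\<close> weight \<open>(n - 2) / 2\<close>. Every ingredient of \<open>\<sigma>\<^sub>u\<^sub>,\<^sub>v\<close> is homogeneous, and even
  homogeneous in the variables \<open>x\<^sub>i\<close>, \<open>\<theta>\<^sub>i\<close> with \<open>i \<in> Y\<close>, for each set \<open>Y\<close> of indices that is stable under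
  the permutations of \<open>u\<close> and \<open>v\<close>. So \<open>\<sigma>\<^sub>u\<^sub>,\<^sub>v\<close> has degree \<open>(n - 2) / 2 \<cdot> (d\<^sub>u + d\<^sub>v - d\<^sub>u\<^sub>v)\<close> in these variables,
  where \<open>d\<close> counts the eigenvalues different from 1 on \<open>Y\<close>. With \<open>Y\<close> the set of all indices this is the
  additivity of \<open>q\<^sub>l + q\<^sub>r\<close>.

  On a cycle with determinant \<open>D\<close> the eigenvalues are all roots of \<open>D\<close>, so the difference
  \<open>q\<^sub>l - q\<^sub>r = 2 age - d\<close> is the sum over the cycles of \<open>h(D)\<close>, where \<open>h(D) = arg(D) / \<pi> - 1\<close> for \<open>D \<noteq> 1\<close> and
  \<open>h(1) = 0\<close>. It is zero for \<open>n = 2\<close>. For \<open>n > 2\<close> let \<open>Y\<close> be an orbit of the two permutations.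
  The \<open>(n - 1)\<close>-st powers of the variables vanish in the Jacobian algebra, so a nonzero class has degree
  at most \<open>n - 2\<close> per special cycle of \<open>uv\<close> in \<open>Y\<close>, which yields that \<open>Y\<close> has at most as many elements as
  \<open>u\<close>, \<open>v\<close> and \<open>uv\<close> together have special cycles. All their cycles together number at most
  \<open>|Y| + 2\<close>, by the Riemann-Hurwitz formula. Hence at most two cycles are non-special; as determinants
  multiply and \<open>h(1 / D) = - h(D)\<close>, the values of \<open>h\<close> add up.
\<close>

subsection \<open>Cycle counts\<close>

text \<open>The weight (n - 2) / 2 is forced by \<open>H_f\<close>, which pairs polynomials of
  degree n - 2 with two letters \<theta>, and by \<open>H_fu\<close>, which does the same with
  second difference quotients of f. Both have total weight 0 once each \<theta> weighs -(n - 2) / 2.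
  The refinement to a stable set Y rests on f being a sum of powers of single variables: a second
  difference quotient with one index in Y and the other outside would have degree -1 in one of the
  two groups of variables, so it is zero.

  Let s_u, s_v, s_w be the numbers of special cycles of u, v, w = uv in Y. Each d is |Y| minus such
  a number, so \<sigma> has degree (n - 2) / 2 times |Y| - s_u - s_v + s_w on Y. Comparison with (n
  - 2) s_w and division by n - 2 give |Y| \<le> s_u + s_v + s_w; this division is why n = 2 is
  treated apart.

  The factors \<phi> and \<psi> are homogeneous only in all variables together, so the argument on
  an orbit concerns \<sigma> alone. Its class is nonzero because the Jacobian ideal absorbs
  factors.\<close>

definition conn :: "('a \<times> 'a) set \<Rightarrow> ('a \<times> 'a) set" where
  "conn R = (R \<union> R\<inverse>)\<^sup>*"

definition comps :: "'a set \<Rightarrow> ('a \<times> 'a) set \<Rightarrow> nat" where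
  "comps A R = card ((\<lambda>x. conn R `` {x}) ` A)"

definition fun_graph :: "'a set \<Rightarrow> ('a \<Rightarrow> 'a) \<Rightarrow> ('a \<times> 'a) set" where
  "fun_graph A s = (\<lambda>x. (x, s x)) ` A"

lemma conn_refl: "(x, x) \<in> conn R"
  by (simp add: conn_def)

lemma conn_sym: "(x, y) \<in> conn R \<Longrightarrow> (y, x) \<in> conn R"
  unfolding conn_def by (metis converse_Un converse_converse rtrancl_converseD rtrancl_converseI sup_commute)

lemma conn_trans: "(x, y) \<in> conn R \<Longrightarrow> (y, z) \<in> conn R \<Longrightarrow> (x, z) \<in> conn R"
  unfolding conn_def by (rule rtrancl_trans)

lemma conn_edge: "(x, y) \<in> R \<Longrightarrow> (x, y) \<in> conn R"
  unfolding conn_def by auto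

text \<open>Upper bounds on \<open>conn\<close> are obtained this way throughout: an invariant is
  packaged as an equivalence relation that contains all edges.\<close>

lemma conn_least:
  assumes "\<And>x y. (x, y) \<in> R \<Longrightarrow> (x, y) \<in> T" "refl T" "sym T" "trans T"
  shows "conn R \<subseteq> T"
proof
  fix z assume "z \<in> conn R"
  then obtain x y where z: "z = (x, y)" "(x, y) \<in> (R \<union> R\<inverse>)\<^sup>*"
    by (metis conn_def surj_pair)
  from z(2) have "(x, y) \<in> T"
  proof induction
    case (step y w)
    then have "(y, w) \<in> T"
      using assms(1,3) by (auto dest: symD)
    then show ?case
      using step.IH assms(4) by (blast dest: transD)
  qed (use assms(2) in \<open>auto dest: reflD\<close>)
  then show "z \<in> T"
    using z by simp
qed

lemma conn_equiv: "refl (conn R)" "sym (conn R)" "trans (conn R)"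
  by (auto intro!: reflI symI transI intro: conn_refl conn_sym conn_trans)

lemma conn_subset: "(\<And>x y. (x, y) \<in> R \<Longrightarrow> (x, y) \<in> conn S) \<Longrightarrow> conn R \<subseteq> conn S"
  by (intro conn_least conn_equiv)

lemma conn_class_eq: "conn R `` {x} = conn R `` {y} \<longleftrightarrow> (x, y) \<in> conn R"
proof
  assume "conn R `` {x} = conn R `` {y}"
  moreover have "y \<in> conn R `` {y}"
    by (simp add: conn_refl)
  ultimately show "(x, y) \<in> conn R"
    by blast
next
  assume "(x, y) \<in> conn R"
  then show "conn R `` {x} = conn R `` {y}"
    by (blast intro: conn_trans conn_sym)
qed

text \<open>A new edge merges the classes of its two ends and does nothing else. The right-hand side
  is itself an equivalence relation containing the edges, so \<open>conn_least\<close>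
  applies.\<close>

lemma conn_insert_iff:
  "(x, y) \<in> conn (insert (a, b) R) \<longleftrightarrow> (x, y) \<in> conn R \<or>
     ((x, a) \<in> conn R \<or> (x, b) \<in> conn R) \<and> ((y, a) \<in> conn R \<or> (y, b) \<in> conn R)"
  (is "?L \<longleftrightarrow> ?R x y")
proof
  have "conn (insert (a, b) R) \<subseteq> {(x, y). ?R x y}"
  proof (rule conn_least)
    show "trans {(x, y). ?R x y}"
      by (rule transI) (auto intro: conn_trans conn_sym)
    show "sym {(x, y). ?R x y}"
      by (rule symI) (auto intro: conn_sym)
    show "refl {(x, y). ?R x y}"
      by (rule reflI) (auto intro: conn_refl)
  qed (auto intro: conn_edge conn_refl)
  then show "?L \<Longrightarrow> ?R x y"
    by auto
next
  have sub: "(x, y) \<in> conn (insert (a, b) R)" if "(x, y) \<in> conn R" for x y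
    using conn_subset[of R "insert (a, b) R"] that by (auto intro: conn_edge)
  have ab: "(a, b) \<in> conn (insert (a, b) R)"
    by (rule conn_edge) simp
  have to_a: "(z, a) \<in> conn (insert (a, b) R)" if "(z, a) \<in> conn R \<or> (z, b) \<in> conn R" for z
    using that sub[of z a] conn_trans[OF sub[of z b] conn_sym[OF ab]] by blast
  show "?R x y \<Longrightarrow> ?L"
    using sub[of x y] conn_trans[OF to_a[of x] conn_sym[OF to_a[of y]]] by blast
qed

lemma comps_insert_same: "(a, b) \<in> conn R \<Longrightarrow> comps A (insert (a, b) R) = comps A R"
proof -
  assume "(a, b) \<in> conn R"
  then have "(x, y) \<in> conn (insert (a, b) R) \<longleftrightarrow> (x, y) \<in> conn R" for x y
    unfolding conn_insert_iff conn_class_eq[where R = R, symmetric] by metis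
  then have "conn (insert (a, b) R) = conn R"
    by auto
  then show ?thesis
    by (simp add: comps_def)
qed

text \<open>Only the classes of a and b change: their union replaces both. It is not one of the
  surviving classes, since a class containing a is the class of a.\<close>

lemma comps_insert_new:
  assumes "finite A" "a \<in> A" "b \<in> A" "(a, b) \<notin> conn R"
  shows "Suc (comps A (insert (a, b) R)) = comps A R"
proof -
  let ?c = "\<lambda>x. conn R `` {x}" and ?d = "\<lambda>x. conn (insert (a, b) R) `` {x}"
  have 1: "?d x = ?c x" if "(x, a) \<notin> conn R" "(x, b) \<notin> conn R" for x
    using that by (auto simp: conn_insert_iff)
  have 2: "?d x = ?c a \<union> ?c b" if "(x, a) \<in> conn R \<or> (x, b) \<in> conn R" for x
  proof (rule Set.set_eqI)
    fix y
    show "y \<in> ?d x \<longleftrightarrow> y \<in> ?c a \<union> ?c b"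
      using that unfolding Image_singleton_iff conn_insert_iff Un_iff
        conn_class_eq[where R = R, symmetric] by metis
  qed
  have img: "?d ` A = insert (?c a \<union> ?c b) (?c ` A - {?c a, ?c b})"
  proof (rule Set.set_eqI, rule iffI)
    fix X assume "X \<in> ?d ` A"
    then obtain x where x: "x \<in> A" "X = ?d x" by auto
    show "X \<in> insert (?c a \<union> ?c b) (?c ` A - {?c a, ?c b})"
    proof (cases "(x, a) \<in> conn R \<or> (x, b) \<in> conn R")
      case False
      then have "?c x \<noteq> ?c a" "?c x \<noteq> ?c b"
        by (simp_all add: conn_class_eq)
      then show ?thesis
        using False x 1[of x] by auto
    qed (use x 2 in auto)
  next
    fix X assume "X \<in> insert (?c a \<union> ?c b) (?c ` A - {?c a, ?c b})"
    then show "X \<in> ?d ` A"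
    proof
      assume "X = ?c a \<union> ?c b"
      then show ?thesis
        using 2[of a] conn_refl assms(2) by (metis imageI)
    next
      assume "X \<in> ?c ` A - {?c a, ?c b}"
      then obtain x where x: "x \<in> A" "X = ?c x" "?c x \<noteq> ?c a" "?c x \<noteq> ?c b"
        by auto
      then show ?thesis
        using 1[of x] by (metis conn_class_eq imageI)
    qed
  qed
  have new: "?c a \<union> ?c b \<notin> ?c ` A - {?c a, ?c b}"
  proof
    assume "?c a \<union> ?c b \<in> ?c ` A - {?c a, ?c b}"
    then obtain x where x: "?c x = ?c a \<union> ?c b" "?c x \<noteq> ?c a"
      by auto
    then have "a \<in> ?c x"
      using conn_refl by fastforce
    then show False
      using x(2) by (simp add: conn_class_eq)
  qed
  have ne: "?c a \<noteq> ?c b"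
    using assms(4) by (simp add: conn_class_eq)
  have "card (?c ` A - {?c a, ?c b}) = card (?c ` A) - 2"
    using assms ne by (subst card_Diff_subset) auto
  moreover have "card {?c a, ?c b} \<le> card (?c ` A)"
    using assms by (intro card_mono) auto
  then have "card (?c ` A) \<ge> 2"
    using ne by simp
  ultimately show ?thesis
    unfolding comps_def img using new assms(1) by (subst card_insert_disjoint) auto
qed

text \<open>As long as a and b are joined by an edge, composing with the transposition only
  exchanges the targets of two points that are already joined.\<close>

lemma fun_graph_transpose_subset:
  assumes "a \<in> A" "b \<in> A"
  shows "conn (insert (a, b) (fun_graph A r \<union> R)) \<subseteq> conn (insert (a, b) (fun_graph A (r \<circ> Transposition.transpose a b) \<union> R))"
proof (rule conn_subset)
  let ?T = "conn (insert (a, b) (fun_graph A (r \<circ> Transposition.transpose a b) \<union> R))"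
  have ab: "(a, b) \<in> ?T" "(b, a) \<in> ?T"
    by (auto intro: conn_edge conn_sym)
  have edge: "(x, r (Transposition.transpose a b x)) \<in> ?T" if "x \<in> A" for x
    using that by (intro conn_edge) (auto simp: fun_graph_def)
  have r: "(x, r x) \<in> ?T" if "x \<in> A" for x
    using edge[of x] edge[OF assms(1)] edge[OF assms(2)] ab that
    by (cases "x = a \<or> x = b") (auto simp: transpose_apply_other intro: conn_trans)
  fix x y assume "(x, y) \<in> insert (a, b) (fun_graph A r \<union> R)"
  then show "(x, y) \<in> ?T"
    using ab r by (auto simp: fun_graph_def intro: conn_edge)
qed

lemma comps_fun_graph_transpose:
  assumes "a \<in> A" "b \<in> A"
  shows "comps A (insert (a, b) (fun_graph A (r \<circ> Transposition.transpose a b) \<union> R)) =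
         comps A (insert (a, b) (fun_graph A r \<union> R))"
proof -
  have "r \<circ> Transposition.transpose a b \<circ> Transposition.transpose a b = r"
    by (simp add: fun_eq_iff)
  then have "conn (insert (a, b) (fun_graph A (r \<circ> Transposition.transpose a b) \<union> R)) =
         conn (insert (a, b) (fun_graph A r \<union> R))"
    using fun_graph_transpose_subset[OF assms, of r R]
      fun_graph_transpose_subset[OF assms, of "r \<circ> Transposition.transpose a b" R] by auto
  then show ?thesis
    by (simp add: comps_def)
qed

lemma funpow_returns:
  assumes "finite A" "bij_betw r A A" "x \<in> A"
  shows "\<exists>k>0. (r ^^ k) x = x"
proof -
  have in_A: "(r ^^ k) y \<in> A" if "y \<in> A" for k y
    using that bij_betwE[OF assms(2)] by (induction k) auto
  have inj: "x = y" if "(r ^^ k) x = (r ^^ k) y" "x \<in> A" "y \<in> A" for k x y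
    using that
  proof (induction k)
    case (Suc k)
    then show ?case
      using bij_betw_imp_inj_on[OF assms(2)] in_A[of x k] in_A[of y k] by (auto dest: inj_onD)
  qed simp
  have "\<not> inj (\<lambda>k. (r ^^ k) x)"
    using finite_subset[of "range (\<lambda>k. (r ^^ k) x)" A] in_A assms range_inj_infinite by blast
  then obtain i j where ij: "(r ^^ i) x = (r ^^ j) x" "i < j"
    unfolding inj_def by (metis linorder_neqE_nat)
  have "(r ^^ i) ((r ^^ (j - i)) x) = (r ^^ (i + (j - i))) x"
    by (simp only: funpow_add o_apply)
  then have "(r ^^ i) ((r ^^ (j - i)) x) = (r ^^ i) x"
    using ij by simp
  then have "(r ^^ (j - i)) x = x"
    using inj in_A assms(3) by blast
  then show ?thesis
    using ij(2) by (intro exI[of _ "j - i"]) simp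
qed

text \<open>Multiplication by a transposition merges two cycles or splits one. Both permutations are
  compared with the graph enlarged by the edge (a, b), for which their component counts agree; the
  extra edge changes a count by at most one.\<close>

lemma comps_transpose:
  assumes "finite A" "bij_betw r A A" "a \<in> A" "b \<in> A"
  shows "comps A (fun_graph A (r \<circ> Transposition.transpose a b)) \<le> Suc (comps A (fun_graph A r))"
    and "(a, b) \<notin> conn (fun_graph A r) \<Longrightarrow>
      Suc (comps A (fun_graph A (r \<circ> Transposition.transpose a b))) = comps A (fun_graph A r)"
proof -
  let ?s = "r \<circ> Transposition.transpose a b"
  have eq: "comps A (insert (a, b) (fun_graph A ?s)) = comps A (insert (a, b) (fun_graph A r))"
    using comps_fun_graph_transpose[OF assms(3,4), of r "{}"] by simp
  have le: "comps A (insert (a, b) R) \<le> comps A R" "comps A R \<le> Suc (comps A (insert (a, b) R))" for R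
    using comps_insert_same[of a b R A] comps_insert_new[OF assms(1,3,4), of R]
    by (cases "(a, b) \<in> conn R"; simp)+
  show "comps A (fun_graph A ?s) \<le> Suc (comps A (fun_graph A r))"
    using le[of "fun_graph A ?s"] le[of "fun_graph A r"] eq by linarith
  assume nc: "(a, b) \<notin> conn (fun_graph A r)"
  have in_A: "(r ^^ k) b \<in> A" for k
    using bij_betwE[OF assms(2)] assms(4) by (induction k) auto
  have rb: "(b, (r ^^ k) b) \<in> conn (fun_graph A r)" for k
  proof (induction k)
    case (Suc k)
    have "((r ^^ k) b, (r ^^ Suc k) b) \<in> conn (fun_graph A r)"
      using in_A[of k] by (intro conn_edge) (auto simp: fun_graph_def)
    with Suc show ?case
      by (rule conn_trans)
  qed (simp add: conn_refl)
  have ne: "(r ^^ k) b \<noteq> a" for k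
    using conn_sym[OF rb[of k]] nc by auto
  have edge: "(x, ?s x) \<in> conn (fun_graph A ?s)" if "x \<in> A" for x
    using that by (intro conn_edge) (auto simp: fun_graph_def)
  \<comment> \<open>From a, the permutation \<open>?s\<close> jumps to r b and then follows r along
    the cycle of b, which avoids a, until it reaches b. So a and b are joined even without the extra
    edge.\<close>
  have "(a, (r ^^ Suc k) b) \<in> conn (fun_graph A ?s) \<or> (a, b) \<in> conn (fun_graph A ?s)" for k
  proof (induction k)
    case 0
    have "?s a = (r ^^ Suc 0) b"
      by simp
    then show ?case
      using edge[OF assms(3)] by argo
  next
    case (Suc k)
    show ?case
    proof (cases "(r ^^ Suc k) b = b")
      case False
      then have "?s ((r ^^ Suc k) b) = (r ^^ Suc (Suc k)) b"
        using ne[of "Suc k"] by (simp add: transpose_apply_other)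
      then have "((r ^^ Suc k) b, (r ^^ Suc (Suc k)) b) \<in> conn (fun_graph A ?s)"
        using edge[OF in_A[of "Suc k"]] by argo
      then show ?thesis
        using Suc conn_trans[of a "(r ^^ Suc k) b" "fun_graph A ?s" "(r ^^ Suc (Suc k)) b"] by argo
    qed (use Suc in auto)
  qed
  moreover obtain k where "k > 0" "(r ^^ k) b = b"
    using funpow_returns[OF assms(1,2,4)] by blast
  ultimately have "(a, b) \<in> conn (fun_graph A ?s)"
    by (metis gr0_conv_Suc)
  then show "Suc (comps A (fun_graph A ?s)) = comps A (fun_graph A r)"
    using comps_insert_same[of a b "fun_graph A ?s" A] comps_insert_new[OF assms(1,3,4) nc] eq by argo
qed

text \<open>The genus of the branched covering of the sphere defined by \<open>s\<close>, \<open>t\<close> and \<open>s \<circ> t\<close> is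
  nonnegative. The induction removes a transposition from \<open>t\<close>.\<close>

lemma cycle_count_inequality:
  assumes "finite A" "bij_betw s A A" "bij_betw t A A"
  shows "comps A (fun_graph A s) + comps A (fun_graph A t) + comps A (fun_graph A (s \<circ> t))
    \<le> card A + 2 * comps A (fun_graph A s \<union> fun_graph A t)"
  using assms(3)
proof (induction "card {x \<in> A. t x \<noteq> x}" arbitrary: t rule: less_induct)
  case less
  show ?case
  proof (cases "{x \<in> A. t x \<noteq> x} = {}")
    case True
    then have id: "t x = x" if "x \<in> A" for x
      using that by auto
    then have "fun_graph A (s \<circ> t) = fun_graph A s"
      by (auto simp: fun_graph_def)
    moreover have "conn (fun_graph A s \<union> fun_graph A t) = conn (fun_graph A s)"
    proof (intro equalityI conn_subset)
      fix x y assume "(x, y) \<in> fun_graph A s \<union> fun_graph A t"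
      then show "(x, y) \<in> conn (fun_graph A s)"
        using id by (auto simp: fun_graph_def[of A t] intro: conn_edge conn_refl)
    qed (auto intro: conn_edge)
    moreover have "comps A (fun_graph A t) \<le> card A"
      using assms(1) by (simp add: comps_def card_image_le)
    ultimately show ?thesis
      by (simp add: comps_def)
  next
    case False
    then obtain a where a: "a \<in> A" "t a \<noteq> a"
      by auto
    then obtain p where p: "p \<in> A" "t p = a"
      using less.prems by (metis bij_betw_imp_surj_on imageE)
    \<comment> \<open>Since t p = a, the transposition makes a a fixed point of t'. Hence t' moves
      fewer points than t, and a forms a component of its own.\<close>
    define t' where "t' = t \<circ> Transposition.transpose a p"
    have t: "t = t' \<circ> Transposition.transpose a p" and st: "s \<circ> t = (s \<circ> t') \<circ> Transposition.transpose a p"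
      by (simp_all add: t'_def fun_eq_iff)
    have "bij_betw (Transposition.transpose a p) A A"
      using a p by (intro bij_betw_byWitness[of _ "Transposition.transpose a p"]) (auto simp: transpose_def)
    then have t'_bij: "bij_betw t' A A"
      unfolding t'_def using less.prems by (rule bij_betw_trans)
    have ap: "a \<noteq> p"
      using a p by auto
    have fix_a: "t' a = a"
      by (simp add: t'_def p)
    have "{x \<in> A. t' x \<noteq> x} \<subset> {x \<in> A. t x \<noteq> x}"
    proof
      show "{x \<in> A. t' x \<noteq> x} \<subseteq> {x \<in> A. t x \<noteq> x}"
      proof
        fix x assume x: "x \<in> {x \<in> A. t' x \<noteq> x}"
        then have "x \<noteq> a"
          using fix_a by auto
        then show "x \<in> {x \<in> A. t x \<noteq> x}"
          using x p ap by (cases "x = p") (auto simp: t'_def transpose_apply_other)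
      qed
      show "{x \<in> A. t' x \<noteq> x} \<noteq> {x \<in> A. t x \<noteq> x}"
        using a fix_a by auto
    qed
    then have "card {x \<in> A. t' x \<noteq> x} < card {x \<in> A. t x \<noteq> x}"
      using assms(1) by (intro psubset_card_mono) auto
    then have IH: "comps A (fun_graph A s) + comps A (fun_graph A t') + comps A (fun_graph A (s \<circ> t'))
        \<le> card A + 2 * comps A (fun_graph A s \<union> fun_graph A t')"
      using less.hyps t'_bij by blast
    have "conn (fun_graph A t') \<subseteq> {(x, y). x = a \<longleftrightarrow> y = a}"
    proof (rule conn_least)
      fix x y assume "(x, y) \<in> fun_graph A t'"
      then show "(x, y) \<in> {(x, y). x = a \<longleftrightarrow> y = a}"
        using fix_a a t'_bij by (auto simp: fun_graph_def bij_betw_def dest: inj_onD)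
    qed (auto intro!: reflI symI transI)
    then have "(a, p) \<notin> conn (fun_graph A t')"
      using ap by auto
    then have c1: "Suc (comps A (fun_graph A t)) = comps A (fun_graph A t')"
      unfolding t by (rule comps_transpose(2)[OF assms(1) t'_bij a(1) p(1)])
    have st'_bij: "bij_betw (s \<circ> t') A A"
      using t'_bij assms(2) by (rule bij_betw_trans)
    have c2: "comps A (fun_graph A (s \<circ> t)) \<le> Suc (comps A (fun_graph A (s \<circ> t')))"
      unfolding st by (rule comps_transpose(1)[OF assms(1) st'_bij a(1) p(1)])
    have orb: "comps A (insert (a, p) (fun_graph A s \<union> fun_graph A t')) = comps A (fun_graph A s \<union> fun_graph A t)"
    proof -
      have "(p, a) \<in> fun_graph A s \<union> fun_graph A t"
        using p by (auto simp: fun_graph_def)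
      then have "(a, p) \<in> conn (fun_graph A t \<union> fun_graph A s)"
        by (auto intro: conn_edge conn_sym)
      then show ?thesis
        using comps_fun_graph_transpose[OF a(1) p(1), of t' "fun_graph A s"] comps_insert_same
        unfolding t[symmetric] by (metis Un_commute)
    qed
    \<comment> \<open>Passing from t' to t costs one cycle of t. If a and p already lie in one joint
      orbit, s o t gains at most one cycle, which compensates. Otherwise the orbit count falls by
      one, so the right side drops by two, and so does the left, because s o t loses a cycle
      too.\<close>
    show ?thesis
    proof (cases "(a, p) \<in> conn (fun_graph A s \<union> fun_graph A t')")
      case True
      then show ?thesis
        using IH c1 c2 orb comps_insert_same[OF True, of A] by linarith
    next
      case False
      have "conn (fun_graph A (s \<circ> t')) \<subseteq> conn (fun_graph A s \<union> fun_graph A t')"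
      proof (rule conn_subset)
        fix x y assume "(x, y) \<in> fun_graph A (s \<circ> t')"
        then have xy: "x \<in> A" "y = s (t' x)" "t' x \<in> A"
          using bij_betwE[OF t'_bij] by (auto simp: fun_graph_def)
        then have "(x, t' x) \<in> conn (fun_graph A s \<union> fun_graph A t')"
            "(t' x, y) \<in> conn (fun_graph A s \<union> fun_graph A t')"
          by (auto intro!: conn_edge simp: fun_graph_def)
        then show "(x, y) \<in> conn (fun_graph A s \<union> fun_graph A t')"
          by (rule conn_trans)
      qed
      then have "(a, p) \<notin> conn (fun_graph A (s \<circ> t'))"
        using False by auto
      then have "Suc (comps A (fun_graph A (s \<circ> t))) = comps A (fun_graph A (s \<circ> t'))"
        unfolding st by (rule comps_transpose(2)[OF assms(1) st'_bij a(1) p(1)])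
      then show ?thesis
        using IH c1 orb comps_insert_new[OF assms(1) a(1) p(1) False] by linarith
    qed
  qed
qed

subsection \<open>Polynomials\<close>

lemma poly_mapping_eq_sum_single:
  "p = (\<Sum>m\<in>Poly_Mapping.keys p. Poly_Mapping.single m (Poly_Mapping.lookup p m))"
  by (rule poly_mapping_eqI)
    (simp add: lookup_sum lookup_single when_def in_keys_iff)

lemma prod_keys_mono_neutral:
  fixes s :: "nat \<Rightarrow> 'a :: comm_semiring_1"
  assumes "Poly_Mapping.keys m \<subseteq> A" "finite A"
  shows "(\<Prod>i\<in>Poly_Mapping.keys m. s i ^ Poly_Mapping.lookup m i) = (\<Prod>i\<in>A. s i ^ Poly_Mapping.lookup m i)"
  using assms by (intro prod.mono_neutral_left) (auto simp: in_keys_iff)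

lemma prod_keys_add:
  fixes s :: "nat \<Rightarrow> 'a :: comm_semiring_1"
  shows "(\<Prod>i\<in>Poly_Mapping.keys (m + m'). s i ^ Poly_Mapping.lookup (m + m') i) =
     (\<Prod>i\<in>Poly_Mapping.keys m. s i ^ Poly_Mapping.lookup m i) * (\<Prod>i\<in>Poly_Mapping.keys m'. s i ^ Poly_Mapping.lookup m' i)"
proof -
  let ?A = "Poly_Mapping.keys m \<union> Poly_Mapping.keys m'"
  have "(\<Prod>i\<in>Poly_Mapping.keys (m + m'). s i ^ Poly_Mapping.lookup (m + m') i) =
    (\<Prod>i\<in>?A. s i ^ Poly_Mapping.lookup (m + m') i)"
    by (rule prod_keys_mono_neutral) (simp_all add: Poly_Mapping.keys_add)
  also have "\<dots> = (\<Prod>i\<in>?A. s i ^ Poly_Mapping.lookup m i) * (\<Prod>i\<in>?A. s i ^ Poly_Mapping.lookup m' i)"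
    by (simp add: lookup_add power_add prod.distrib)
  finally show ?thesis
    by (simp add: prod_keys_mono_neutral[of m ?A] prod_keys_mono_neutral[of m' ?A])
qed

text \<open>Treats together the two uses of \<open>insertion\<close>: substitution of polynomials,
  with coefficients passing through \<open>Cst\<close>, and evaluation at a point, with coefficients
  unchanged.\<close>

locale coefficient_hom =
  fixes c :: "complex \<Rightarrow> 'a :: comm_ring_1"
  assumes c_zero: "c 0 = 0" and c_one: "c 1 = 1"
    and c_add: "\<And>a b. c (a + b) = c a + c b" and c_mult: "\<And>a b. c (a * b) = c a * c b"
begin

lemma insertion_zero: "insertion c s 0 = 0"
  by (simp add: insertion_def)

lemma insertion_single:
  "insertion c s (Poly_Mapping.single m a) = c a * (\<Prod>i\<in>Poly_Mapping.keys m. s i ^ Poly_Mapping.lookup m i)"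
  by (cases "a = 0") (simp_all add: insertion_def c_zero)

lemma insertion_add: "insertion c s (p + q) = insertion c s p + insertion c s q"
  unfolding insertion_def
  by (rule setsum_keys_plus_distrib[where f = "\<lambda>m a. c a * (\<Prod>i\<in>Poly_Mapping.keys m. s i ^ Poly_Mapping.lookup m i)"])
    (simp_all add: c_zero c_add distrib_right)

lemma insertion_sum: "insertion c s (sum f A) = (\<Sum>a\<in>A. insertion c s (f a))"
  by (induction A rule: infinite_finite_induct) (simp_all add: insertion_zero insertion_add)

lemma insertion_mult: "insertion c s (p * q) = insertion c s p * insertion c s q"
proof -
  have "p * q = (\<Sum>m\<in>Poly_Mapping.keys p. \<Sum>m'\<in>Poly_Mapping.keys q.
      Poly_Mapping.single m (Poly_Mapping.lookup p m) * Poly_Mapping.single m' (Poly_Mapping.lookup q m'))"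
    unfolding sum_product[symmetric] poly_mapping_eq_sum_single[symmetric] ..
  then have "insertion c s (p * q) =
    (\<Sum>m\<in>Poly_Mapping.keys p. \<Sum>m'\<in>Poly_Mapping.keys q.
      insertion c s (Poly_Mapping.single m (Poly_Mapping.lookup p m) * Poly_Mapping.single m' (Poly_Mapping.lookup q m')))"
    by (simp add: insertion_sum)
  also have "\<dots> = insertion c s p * insertion c s q"
    unfolding insertion_def[of c s p] insertion_def[of c s q] sum_product
    by (simp add: mult_single insertion_single c_mult prod_keys_add mult_ac)
  finally show ?thesis .
qed

lemma insertion_Cst: "insertion c s (Cst a) = c a"
  by (simp add: Cst_def insertion_single)

lemma insertion_one: "insertion c s 1 = 1"
  using insertion_Cst[of s 1] by (simp add: Cst_def c_one)

lemma insertion_X: "insertion c s (X i) = s i"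
  by (simp add: X_def insertion_single c_one)

lemma insertion_power: "insertion c s (p ^ k) = insertion c s p ^ k"
  by (induction k) (simp_all add: insertion_one insertion_mult)

lemma insertion_uminus: "insertion c s (- p) = - insertion c s p"
  using insertion_add[of s p "- p"] by (simp add: insertion_zero eq_neg_iff_add_eq_0 add.commute)

lemma insertion_diff: "insertion c s (p - q) = insertion c s p - insertion c s q"
  using insertion_add[of s p "- q"] by (simp add: insertion_uminus)

lemmas insertion_simps = insertion_zero insertion_one insertion_add insertion_mult insertion_Cst
  insertion_X insertion_power insertion_uminus insertion_diff insertion_sum

end

lemma Cst_zero [simp]: "Cst 0 = 0" and Cst_one [simp]: "Cst 1 = 1"
  by (simp_all add: Cst_def)

lemma Cst_add: "Cst (a + b) = Cst a + Cst b"
  by (simp add: Cst_def single_add)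

lemma Cst_mult: "Cst (a * b) = Cst a * Cst b"
  by (simp add: Cst_def mult_single)

lemma Cst_uminus: "Cst (- a) = - Cst a"
  by (simp add: Cst_def single_uminus)

lemma Cst_diff: "Cst (a - b) = Cst a - Cst b"
  by (simp add: Cst_def single_diff)

lemma Cst_power: "Cst (a ^ k) = Cst a ^ k"
  by (induction k) (simp_all add: Cst_mult)

lemma Cst_sum: "Cst (sum f A) = (\<Sum>a\<in>A. Cst (f a))"
  by (induction A rule: infinite_finite_induct) (simp_all add: Cst_add)

lemma Cst_prod: "Cst (prod f A) = (\<Prod>a\<in>A. Cst (f a))"
  by (induction A rule: infinite_finite_induct) (simp_all add: Cst_mult)

lemma Cst_eq_iff [simp]: "Cst a = Cst b \<longleftrightarrow> a = b"
  unfolding Cst_def by (metis lookup_single_eq)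

lemma Cst_eq_0_iff [simp]: "Cst a = 0 \<longleftrightarrow> a = 0"
  using Cst_eq_iff[of a 0] by (simp del: Cst_eq_iff)

lemma lookup_Cst_mult: "Poly_Mapping.lookup (Cst a * p) m = a * Poly_Mapping.lookup p m"
proof -
  have "Cst a * p = (\<Sum>k\<in>Poly_Mapping.keys p. Poly_Mapping.single k (a * Poly_Mapping.lookup p k))"
    by (subst (1) poly_mapping_eq_sum_single[of p]) (simp add: Cst_def sum_distrib_left mult_single)
  then show ?thesis
    by (simp add: lookup_sum lookup_single when_def in_keys_iff)
qed

interpretation subst: coefficient_hom Cst
  by unfold_locales (simp_all add: Cst_add Cst_mult)

interpretation evalp: coefficient_hom "\<lambda>c :: complex. c"
  by unfold_locales simp_all

text \<open>The factors of each monomial are exchanged one at a time, and each exchange contributes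
  a multiple of h. This is what makes the difference quotients \<open>nabla\<close> exist.\<close>

lemma subst_dvd_diff:
  assumes "\<And>i. h dvd s i - s' i"
  shows "h dvd subst s p - subst s' p"
proof -
  have *: "h dvd (\<Prod>i\<in>A. s i ^ k i) - (\<Prod>i\<in>A. s' i ^ k i)" if "finite A" for A and k :: "nat \<Rightarrow> nat"
    using that
  proof (induction A)
    case (insert a A)
    have 1: "h dvd s a ^ k a - s' a ^ k a"
      using assms[of a] by (simp add: power_diff_sumr2)
    have "(\<Prod>i\<in>insert a A. s i ^ k i) - (\<Prod>i\<in>insert a A. s' i ^ k i) =
      (s a ^ k a - s' a ^ k a) * (\<Prod>i\<in>A. s i ^ k i) +
      s' a ^ k a * ((\<Prod>i\<in>A. s i ^ k i) - (\<Prod>i\<in>A. s' i ^ k i))"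
      using insert.hyps by (simp add: algebra_simps)
    then show ?case
      using 1 insert.IH by (simp only: dvd_add dvd_mult dvd_mult2)
  qed simp
  have "subst s p - subst s' p = (\<Sum>m\<in>Poly_Mapping.keys p. Cst (Poly_Mapping.lookup p m) *
      ((\<Prod>i\<in>Poly_Mapping.keys m. s i ^ Poly_Mapping.lookup m i) - (\<Prod>i\<in>Poly_Mapping.keys m. s' i ^ Poly_Mapping.lookup m i)))"
    by (simp add: insertion_def sum_subtractf right_diff_distrib)
  then show ?thesis
    by (auto intro!: dvd_sum dvd_mult *)
qed

subsection \<open>Partial degrees\<close>

definition deg_on :: "nat set \<Rightarrow> (nat \<Rightarrow>\<^sub>0 nat) \<Rightarrow> nat" where
  "deg_on Y m = (\<Sum>i\<in>Poly_Mapping.keys m \<inter> Y. Poly_Mapping.lookup m i)"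

text \<open>The degree is real because the weights involve (n - 2) / 2 and differences. A value that
  is no natural number forces p = 0, which is how vanishing statements are derived.\<close>

definition hom_on :: "nat set \<Rightarrow> real \<Rightarrow> mpoly \<Rightarrow> bool" where
  "hom_on Y k p \<longleftrightarrow> (\<forall>m\<in>Poly_Mapping.keys p. real (deg_on Y m) = k)"

lemma deg_on_zero [simp]: "deg_on Y 0 = 0"
  by (simp add: deg_on_def)

lemma deg_on_add: "deg_on Y (m + m') = deg_on Y m + deg_on Y m'"
proof -
  let ?A = "(Poly_Mapping.keys m \<union> Poly_Mapping.keys m') \<inter> Y"
  have *: "deg_on Y x = (\<Sum>i\<in>?A. Poly_Mapping.lookup x i)"
    if "Poly_Mapping.keys x \<subseteq> Poly_Mapping.keys m \<union> Poly_Mapping.keys m'" for x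
    unfolding deg_on_def using that by (intro sum.mono_neutral_left) (auto simp: in_keys_iff)
  show ?thesis
    by (simp add: * Poly_Mapping.keys_add lookup_add sum.distrib)
qed

lemma homogeneous_iff_hom_on: "homogeneous d p \<longleftrightarrow> hom_on UNIV (real d) p"
  by (simp add: homogeneous_def hom_on_def deg_on_def flip: of_nat_sum)

text \<open>Degree 0 in the variables from index N on means that they are absent. A homogeneity
  result for all stable sets therefore also bounds the variables, by taking Y =
  \<open>{N..}\<close>.\<close>

lemma polys_iff_hom_on: "p \<in> polys N \<longleftrightarrow> hom_on {N..} 0 p"
proof -
  have "deg_on {N..} m = 0 \<longleftrightarrow> Poly_Mapping.keys m \<subseteq> {..<N}" for m
  proof -
    have "deg_on {N..} m = 0 \<longleftrightarrow> Poly_Mapping.keys m \<inter> {N..} = {}"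
      by (auto simp: deg_on_def in_keys_iff)
    then show ?thesis
      by fastforce
  qed
  then show ?thesis
    by (simp add: polys_def hom_on_def)
qed

lemma hom_on_zero [simp]: "hom_on Y k 0"
  by (simp add: hom_on_def)

lemma hom_on_add: "hom_on Y k p \<Longrightarrow> hom_on Y k q \<Longrightarrow> hom_on Y k (p + q)"
  using Poly_Mapping.keys_add[of p q] by (auto simp: hom_on_def)

lemma hom_on_uminus: "hom_on Y k p \<Longrightarrow> hom_on Y k (- p)"
  by (auto simp: hom_on_def in_keys_iff)

lemma hom_on_diff: "hom_on Y k p \<Longrightarrow> hom_on Y k q \<Longrightarrow> hom_on Y k (p - q)"
  using hom_on_add[of Y k p "- q"] by (simp add: hom_on_uminus)

lemma hom_on_sum: "(\<And>a. a \<in> A \<Longrightarrow> hom_on Y k (f a)) \<Longrightarrow> hom_on Y k (sum f A)"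
  by (induction A rule: infinite_finite_induct) (auto intro: hom_on_add)

lemma hom_on_mult:
  assumes "hom_on Y k p" "hom_on Y l q"
  shows "hom_on Y (k + l) (p * q)"
  unfolding hom_on_def
proof
  fix m assume "m \<in> Poly_Mapping.keys (p * q)"
  then obtain a b where "m = a + b" "a \<in> Poly_Mapping.keys p" "b \<in> Poly_Mapping.keys q"
    using keys_mult[of p q] by blast
  then show "real (deg_on Y m) = k + l"
    using assms by (simp add: hom_on_def deg_on_add)
qed

lemma hom_on_Cst: "hom_on Y 0 (Cst c)"
  by (auto simp: hom_on_def Cst_def)

lemma hom_on_one: "hom_on Y 0 1"
  using hom_on_Cst[of Y 1] by simp

lemma hom_on_minus_one_power: "hom_on Y 0 ((- 1) ^ k)"
  by (simp add: uminus_power_if hom_on_one hom_on_uminus)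

lemma hom_on_Cst_mult: "hom_on Y k p \<Longrightarrow> hom_on Y k (Cst c * p)"
  using hom_on_mult[OF hom_on_Cst] by simp

lemma hom_on_mult0: "hom_on Y 0 p \<Longrightarrow> hom_on Y k q \<Longrightarrow> hom_on Y k (p * q)"
  using hom_on_mult[of Y 0 p k q] by simp

lemma hom_on_power: "hom_on Y k p \<Longrightarrow> hom_on Y (real j * k) (p ^ j)"
proof (induction j)
  case (Suc j)
  then show ?case
    using hom_on_mult[of Y k p "real j * k" "p ^ j"] by (simp add: algebra_simps)
qed (simp add: hom_on_one)

lemma hom_on_prod:
  "finite A \<Longrightarrow> (\<And>a. a \<in> A \<Longrightarrow> hom_on Y (k a) (f a)) \<Longrightarrow> hom_on Y (sum k A) (prod f A)"
  by (induction A rule: finite_induct) (auto intro: hom_on_one hom_on_mult)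

lemma hom_on_X: "hom_on Y (of_bool (i \<in> Y)) (X i)"
  by (auto simp: hom_on_def X_def deg_on_def)

lemma hom_on_of_nat: "hom_on Y 0 (of_nat k)"
  by (induction k) (auto intro: hom_on_add hom_on_one)

lemma hom_on_unique: "hom_on Y k p \<Longrightarrow> hom_on Y l p \<Longrightarrow> p \<noteq> 0 \<Longrightarrow> k = l"
  unfolding hom_on_def using keys_eq_empty by (metis equals0I)

lemma hom_on_eq_nat: "hom_on Y k p \<Longrightarrow> p \<noteq> 0 \<Longrightarrow> \<exists>a. k = real a"
  unfolding hom_on_def by (metis ex_in_conv keys_eq_empty)

lemma hom_on_neg: "hom_on Y k p \<Longrightarrow> k < 0 \<Longrightarrow> p = 0"
  unfolding hom_on_def by (metis ex_in_conv keys_eq_empty not_le of_nat_0_le_iff)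

lemma hom_on_UNIV:
  assumes "hom_on {N..} 0 p" "hom_on {..<N} k p"
  shows "hom_on UNIV k p"
proof -
  have "deg_on UNIV m = deg_on {..<N} m + deg_on {N..} m" for m
  proof -
    have "Poly_Mapping.keys m = (Poly_Mapping.keys m \<inter> {..<N}) \<union> (Poly_Mapping.keys m \<inter> {N..})" by auto
    then show ?thesis
      unfolding deg_on_def by (subst sum.union_disjoint[symmetric]) auto
  qed
  then show ?thesis
    using assms by (simp add: hom_on_def)
qed

lemma hom_on_subst:
  assumes "\<And>i. hom_on Y (of_bool (i \<in> Y)) (s i)" "hom_on Y k p"
  shows "hom_on Y k (subst s p)"
  unfolding insertion_def
proof (rule hom_on_sum, rule hom_on_Cst_mult)
  fix m assume m: "m \<in> Poly_Mapping.keys p"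
  have "(\<Sum>i\<in>Poly_Mapping.keys m. real (Poly_Mapping.lookup m i) * of_bool (i \<in> Y)) = real (deg_on Y m)"
    unfolding deg_on_def of_nat_sum by (rule sum.mono_neutral_cong_right) auto
  then have "(\<Sum>i\<in>Poly_Mapping.keys m. real (Poly_Mapping.lookup m i) * of_bool (i \<in> Y)) = k"
    using m assms(2) by (simp add: hom_on_def)
  then show "hom_on Y k (\<Prod>i\<in>Poly_Mapping.keys m. s i ^ Poly_Mapping.lookup m i)"
    using hom_on_prod[of "Poly_Mapping.keys m" Y "\<lambda>i. real (Poly_Mapping.lookup m i) * of_bool (i \<in> Y)"]
    by (metis (no_types, lifting) assms(1) finite_keys hom_on_power)
qed

section \<open>Dilation of the variables in Y as a test for the degree\<close>

definition scale_on :: "nat set \<Rightarrow> complex \<Rightarrow> mpoly \<Rightarrow> mpoly" where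
  "scale_on Y t = subst (\<lambda>i. if i \<in> Y then Cst t * X i else X i)"

lemma prod_X: "(\<Prod>i\<in>Poly_Mapping.keys m. X i ^ Poly_Mapping.lookup m i) = Poly_Mapping.single m 1"
proof -
  have pow: "X i ^ k = Poly_Mapping.single (Poly_Mapping.single i k) 1" for i k
    by (induction k) (simp_all add: X_def mult_single single_add[symmetric])
  have "finite A \<Longrightarrow> (\<Prod>i\<in>A. X i ^ k i) = Poly_Mapping.single (\<Sum>i\<in>A. Poly_Mapping.single i (k i)) 1" for A k
    by (induction A rule: finite_induct) (simp_all add: pow mult_single)
  then show ?thesis
    by (simp add: poly_mapping_eq_sum_single[symmetric])
qed

lemma lookup_scale_on: "Poly_Mapping.lookup (scale_on Y t p) m = t ^ deg_on Y m * Poly_Mapping.lookup p m"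
proof -
  have *: "(\<Prod>i\<in>Poly_Mapping.keys m. (if i \<in> Y then Cst t * X i else X i) ^ Poly_Mapping.lookup m i) =
      Poly_Mapping.single m (t ^ deg_on Y m)" for m
  proof -
    have "(\<Prod>i\<in>Poly_Mapping.keys m. (if i \<in> Y then Cst t * X i else X i) ^ Poly_Mapping.lookup m i) =
      (\<Prod>i\<in>Poly_Mapping.keys m. Cst (if i \<in> Y then t ^ Poly_Mapping.lookup m i else 1) * X i ^ Poly_Mapping.lookup m i)"
      by (intro prod.cong) (auto simp: power_mult_distrib Cst_power)
    also have "\<dots> = Cst (\<Prod>i\<in>Poly_Mapping.keys m. if i \<in> Y then t ^ Poly_Mapping.lookup m i else 1) * Poly_Mapping.single m 1"
      by (simp add: prod.distrib prod_X Cst_prod)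
    also have "(\<Prod>i\<in>Poly_Mapping.keys m. if i \<in> Y then t ^ Poly_Mapping.lookup m i else 1) = t ^ deg_on Y m"
      by (simp add: deg_on_def power_sum prod.inter_restrict)
    finally show ?thesis
      by (simp add: Cst_def mult_single)
  qed
  have "scale_on Y t p = (\<Sum>m\<in>Poly_Mapping.keys p. Poly_Mapping.single m (t ^ deg_on Y m * Poly_Mapping.lookup p m))"
    by (simp add: scale_on_def insertion_def * Cst_def mult_single mult.commute)
  then show ?thesis
    by (simp add: lookup_sum lookup_single when_def in_keys_iff)
qed

lemma scale_on_hom:
  assumes "hom_on Y (real k) p"
  shows "scale_on Y t p = Cst (t ^ k) * p"
proof (rule poly_mapping_eqI)
  fix m
  show "Poly_Mapping.lookup (scale_on Y t p) m = Poly_Mapping.lookup (Cst (t ^ k) * p) m"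
    using assms by (cases "m \<in> Poly_Mapping.keys p") (auto simp: lookup_scale_on lookup_Cst_mult hom_on_def in_keys_iff)
qed

text \<open>Dilation by 2 multiplies q h and h by powers of 2. Cancelling h, which is possible in a
  domain, makes q an eigenvector of the dilation. Powers of 2 with different exponents differ, so
  all monomials of q have the same degree.\<close>

lemma hom_on_quotient:
  assumes "hom_on Y k (q * h)" "hom_on Y l h" "h \<noteq> 0"
  shows "hom_on Y (k - l) q"
proof (cases "q = 0")
  case False
  have "\<exists>a. k = real a" "\<exists>b. l = real b"
    using hom_on_eq_nat[OF assms(1)] hom_on_eq_nat[OF assms(2)] False assms(3) by auto
  then obtain a b where ab: "k = real a" "l = real b"
    by blast
  have "Cst (2 ^ a) * (q * h) = scale_on Y 2 (q * h)"
    using assms(1) by (simp add: ab scale_on_hom)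
  also have "\<dots> = scale_on Y 2 q * (Cst (2 ^ b) * h)"
    using assms(2) by (simp add: scale_on_hom[symmetric] ab) (simp add: scale_on_def subst.insertion_mult)
  finally have "(Cst (2 ^ a) * q) * h = (Cst (2 ^ b) * scale_on Y 2 q) * h"
    by (simp add: mult_ac)
  then have eq: "Cst (2 ^ a) * q = Cst (2 ^ b) * scale_on Y 2 q"
    using assms(3) by simp
  show ?thesis
    unfolding hom_on_def
  proof
    fix m assume m: "m \<in> Poly_Mapping.keys q"
    have "2 ^ a * Poly_Mapping.lookup q m = 2 ^ b * (2 ^ deg_on Y m * Poly_Mapping.lookup q m)"
      using arg_cong[OF eq, of "\<lambda>p. Poly_Mapping.lookup p m"]
      by (simp add: lookup_Cst_mult lookup_scale_on)
    then have "(2 :: complex) ^ a = 2 ^ (b + deg_on Y m)"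
      using m by (simp add: in_keys_iff power_add)
    then have "norm ((2 :: complex) ^ a) = norm ((2 :: complex) ^ (b + deg_on Y m))"
      by simp
    then have "(2 :: real) ^ a = 2 ^ (b + deg_on Y m)"
      by (simp only: norm_power norm_numeral)
    then have "a = b + deg_on Y m"
      by (subst (asm) power_inject_exp) simp_all
    then show "real (deg_on Y m) = k - l"
      by (simp add: ab)
  qed
qed simp

lemma act_simps:
  "act u (p + q) = act u p + act u q" "act u (p * q) = act u p * act u q"
  "act u (p - q) = act u p - act u q" "act u (- p) = - act u p"
  "act u (sum f A) = (\<Sum>a\<in>A. act u (f a))" "act u (p ^ k) = act u p ^ k"
  "act u 0 = 0" "act u 1 = 1" "act u (Cst c) = Cst c" "act u (X i) = Cst (snd u i) * X (fst u i)"
  by (simp_all add: act_def subst.insertion_simps)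

lemma hom_on_act:
  assumes "\<And>i. fst u i \<in> Y \<longleftrightarrow> i \<in> Y" "hom_on Y k p"
  shows "hom_on Y k (act u p)"
  unfolding act_def
proof (rule hom_on_subst)
  show "hom_on Y (of_bool (i \<in> Y)) (Cst (snd u i) * X (fst u i))" for i
    using hom_on_Cst_mult[OF hom_on_X[of Y "fst u i"], of "snd u i"] assms(1)[of i] by simp
qed fact

subsection \<open>The exterior algebra\<close>

lemma shuffle_sign_empty [simp]: "shuffle_sign {} B = 1"
  by (simp add: shuffle_sign_def)

lemma shuffle_sign_insert_left:
  assumes "finite A" "finite B" "i \<notin> A"
  shows "shuffle_sign (insert i A) B = (-1) ^ card {b \<in> B. b < i} * shuffle_sign A B"
proof -
  let ?Q = "{(a, b) \<in> A \<times> B. b < a}"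
  have eq: "{(a, b) \<in> insert i A \<times> B. b < a} = Pair i ` {b \<in> B. b < i} \<union> ?Q"
    by auto
  have "finite ?Q"
    by (rule finite_subset[of _ "A \<times> B"]) (use assms in auto)
  then have "card (Pair i ` {b \<in> B. b < i} \<union> ?Q) = card (Pair i ` {b \<in> B. b < i}) + card ?Q"
    using assms by (intro card_Un_disjoint) auto
  moreover have "card (Pair i ` {b \<in> B. b < i}) = card {b \<in> B. b < i}"
    by (rule card_image) (auto simp: inj_on_def)
  ultimately show ?thesis
    unfolding shuffle_sign_def eq by (simp only: power_add)
qed

lemma shuffle_sign_insert_right:
  assumes "finite A" "finite B" "i \<notin> B"
  shows "shuffle_sign A (insert i B) = (-1) ^ card {a \<in> A. i < a} * shuffle_sign A B"
proof -
  let ?Q = "{(a, b) \<in> A \<times> B. b < a}"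
  have eq: "{(a, b) \<in> A \<times> insert i B. b < a} = (\<lambda>a. (a, i)) ` {a \<in> A. i < a} \<union> ?Q"
    by auto
  have "finite ?Q"
    by (rule finite_subset[of _ "A \<times> B"]) (use assms in auto)
  then have "card ((\<lambda>a. (a, i)) ` {a \<in> A. i < a} \<union> ?Q) = card ((\<lambda>a. (a, i)) ` {a \<in> A. i < a}) + card ?Q"
    using assms by (intro card_Un_disjoint) auto
  moreover have "card ((\<lambda>a. (a, i)) ` {a \<in> A. i < a}) = card {a \<in> A. i < a}"
    by (rule card_image) (auto simp: inj_on_def)
  ultimately show ?thesis
    unfolding shuffle_sign_def eq by (simp only: power_add)
qed

lemma sum_Pow_insert:
  assumes "finite S" "i \<notin> S"
  shows "(\<Sum>A\<in>Pow (insert i S). f A) = (\<Sum>A\<in>Pow S. f A + f (insert i A))"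
proof -
  have "Pow S \<inter> insert i ` Pow S = {}" "inj_on (insert i) (Pow S)"
    using assms by (auto simp: inj_on_def)
  then show ?thesis
    using assms by (simp add: Pow_insert sum.union_disjoint sum.reindex sum.distrib)
qed

lemma wedge_infinite: "infinite S \<Longrightarrow> wedge p q S = 0"
  by (simp add: wedge_def)

lemma wedge_ext_one: "wedge ext_one q S = (if finite S then q S else 0)"
proof (cases "finite S")
  case True
  have "wedge ext_one q S = (\<Sum>A\<in>Pow S. if A = {} then q S else 0)"
    unfolding wedge_def by (rule sum.cong) (auto simp: ext_one_def)
  then show ?thesis
    using True by simp
qed (simp add: wedge_def)

text \<open>The grading involution: the sign that arises when an odd derivation passes a
  factor.\<close>

definition grade_sign :: "ext \<Rightarrow> ext" where
  "grade_sign p S = (-1) ^ card S * p S"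

lemma minus_one_power_square: "(-1) ^ k * (-1) ^ k = (1 :: mpoly)"
  by (simp add: power_mult_distrib[symmetric])

text \<open>The sign rules behind \<open>contract_wedge\<close>. Here s is the shuffle sign of A and
  its complement; a and c are the signs given by the number of elements of A below and above i, and
  b is the one given by the elements of the complement below i.\<close>

lemma contract_wedge_signs:
  fixes a b c s p p' q q' :: "'a :: comm_ring_1"
  assumes "b * b = 1"
  shows "(a * b) * ((c * s) * p * q' + (b * s) * p' * q) = s * (a * p') * q + s * ((a * c) * p) * (b * q')"
    and "(c * s) * (a * p') * q' + (b * s) * (- 1 * (a * c) * p') * (b * q') = 0"
proof -
  have "(a * b) * ((c * s) * p * q' + (b * s) * p' * q) =
      s * ((a * c) * p) * (b * q') + (b * b) * (s * (a * p') * q)"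
    by (simp add: algebra_simps)
  then show "(a * b) * ((c * s) * p * q' + (b * s) * p' * q) = s * (a * p') * q + s * ((a * c) * p) * (b * q')"
    by (simp add: assms)
  have "(c * s) * (a * p') * q' + (b * s) * (- 1 * (a * c) * p') * (b * q') =
      (1 - b * b) * ((c * s) * (a * p') * q')"
    by (simp add: algebra_simps)
  then show "(c * s) * (a * p') * q' + (b * s) * (- 1 * (a * c) * p') * (b * q') = 0"
    by (simp add: assms)
qed

lemma card_lt_add_gt:
  fixes i :: nat
  assumes "finite A" "i \<notin> A"
  shows "card A = card {a \<in> A. a < i} + card {a \<in> A. i < a}"
proof -
  have "{a \<in> A. a < i} \<union> {a \<in> A. i < a} = A"
    using assms(2) by auto (metis linorder_neqE_nat)
  moreover have "card ({a \<in> A. a < i} \<union> {a \<in> A. i < a}) = card {a \<in> A. a < i} + card {a \<in> A. i < a}"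
    using assms(1) by (intro card_Un_disjoint) auto
  ultimately show ?thesis
    by (simp only:)
qed

text \<open>The Leibniz rule of an odd derivation. In both cases the subsets are grouped in pairs A
  and \<open>insert i A\<close>.\<close>

lemma contract_wedge:
  "contract i (wedge p q) S = wedge (contract i p) q S + wedge (grade_sign p) (contract i q) S"
proof (cases "finite S")
  case fin: True
  show ?thesis
  proof (cases "i \<in> S")
    case False
    have "contract i (wedge p q) S = (\<Sum>A\<in>Pow S. (-1) ^ card {s \<in> S. s < i} *
        (shuffle_sign A (insert i S - A) * p A * q (insert i S - A) +
         shuffle_sign (insert i A) (insert i S - insert i A) * p (insert i A) * q (insert i S - insert i A)))"
      unfolding contract_def wedge_def sum_Pow_insert[OF fin False] sum_distrib_left
      using False by simp
    also have "\<dots> = (\<Sum>A\<in>Pow S. shuffle_sign A (S - A) * contract i p A * q (S - A) +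
        shuffle_sign A (S - A) * grade_sign p A * contract i q (S - A))"
    proof (rule sum.cong[OF refl])
      fix A assume "A \<in> Pow S"
      then have A: "A \<subseteq> S" "finite A" "i \<notin> A" "finite (S - A)" "i \<notin> S - A"
        using fin False finite_subset by auto
      have eqs: "insert i S - A = insert i (S - A)" "insert i S - insert i A = S - A"
        using A by auto
      have "{s \<in> S. s < i} = {s \<in> A. s < i} \<union> {s \<in> S - A. s < i}"
        using A by auto
      then have c: "card {s \<in> S. s < i} = card {s \<in> A. s < i} + card {s \<in> S - A. s < i}"
        using A by (subst card_Un_disjoint[symmetric]) auto
      show "(-1) ^ card {s \<in> S. s < i} *
        (shuffle_sign A (insert i S - A) * p A * q (insert i S - A) +
         shuffle_sign (insert i A) (insert i S - insert i A) * p (insert i A) * q (insert i S - insert i A)) =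
        shuffle_sign A (S - A) * contract i p A * q (S - A) +
        shuffle_sign A (S - A) * grade_sign p A * contract i q (S - A)"
        unfolding eqs shuffle_sign_insert_left[OF A(2,4,3)] shuffle_sign_insert_right[OF A(2,4,5)] c
          contract_def grade_sign_def card_lt_add_gt[OF A(2,3)] power_add if_not_P[OF A(3)] if_not_P[OF A(5)]
        by (rule contract_wedge_signs(1)) (rule minus_one_power_square)
    qed
    finally show ?thesis
      by (simp add: wedge_def sum.distrib)
  next
    \<comment> \<open>The left side is zero because i lies in S. On the right, the two surviving
      terms for a subset A of R are both the product of p at \<open>insert i A\<close> and q at
      \<open>insert i (R - A)\<close>, with opposite signs.\<close>
    case True
    then obtain R where R: "S = insert i R" "i \<notin> R" "finite R"
      by (metis Set.set_insert fin finite_insert)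
    have "wedge (contract i p) q S + wedge (grade_sign p) (contract i q) S = 
      (\<Sum>A\<in>Pow R. shuffle_sign A (S - A) * contract i p A * q (S - A) +
        shuffle_sign (insert i A) (S - insert i A) * contract i p (insert i A) * q (S - insert i A) +
        (shuffle_sign A (S - A) * grade_sign p A * contract i q (S - A) +
        shuffle_sign (insert i A) (S - insert i A) * grade_sign p (insert i A) * contract i q (S - insert i A)))"
      unfolding wedge_def R(1) sum_Pow_insert[OF R(3,2)] by (simp add: sum.distrib)
    also have "\<dots> = 0"
    proof (rule sum.neutral, rule ballI)
      fix A assume "A \<in> Pow R"
      then have A: "A \<subseteq> R" "finite A" "i \<notin> A" "finite (R - A)" "i \<notin> R - A"
        using R finite_subset by auto
      have eqs: "S - A = insert i (R - A)" "S - insert i A = R - A"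
        using A R by auto
      have c: "card A = card {a \<in> A. a < i} + card {a \<in> A. i < a}"
        using card_lt_add_gt[OF A(2,3)] .
      have e: "contract i p (insert i A) = 0" "contract i q (insert i (R - A)) = 0"
        "card (insert i A) = Suc (card A)"
        using A by (simp_all add: contract_def)
      have e': "contract i p A = (-1) ^ card {a \<in> A. a < i} * p (insert i A)"
        "contract i q (R - A) = (-1) ^ card {a \<in> R - A. a < i} * q (insert i (R - A))"
        using A by (simp_all add: contract_def)
      show "shuffle_sign A (S - A) * contract i p A * q (S - A) +
        shuffle_sign (insert i A) (S - insert i A) * contract i p (insert i A) * q (S - insert i A) +
        (shuffle_sign A (S - A) * grade_sign p A * contract i q (S - A) +
        shuffle_sign (insert i A) (S - insert i A) * grade_sign p (insert i A) * contract i q (S - insert i A)) = 0"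
        unfolding eqs shuffle_sign_insert_left[OF A(2,4,3)] shuffle_sign_insert_right[OF A(2,4,5)]
          grade_sign_def e e' c power_add power_Suc mult_zero_left mult_zero_right add_0_left add_0_right
        by (rule contract_wedge_signs(2)) (rule minus_one_power_square)
    qed
    finally show ?thesis
      using True by (simp add: contract_def)
  qed
next
  case False
  then have "infinite (insert i S)"
    by simp
  then show ?thesis
    unfolding contract_def[of i "wedge p q"] by (simp add: wedge_infinite[OF False] wedge_infinite)
qed

lemma contract_in: "i \<in> S \<Longrightarrow> contract i q S = 0"
  and contract_notin: "i \<notin> S \<Longrightarrow> contract i q S = (-1) ^ card {s \<in> S. s < i} * q (insert i S)"
  unfolding contract_def by (simp_all only: if_True if_False)

text \<open>For i < j, the element i counts among those below j, but j does not count among those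
  below i. This asymmetry is the only source of the sign.\<close>

lemma contract_contract_less:
  assumes "i < j"
  shows "contract i (contract j q) S = - contract j (contract i q) S"
proof (cases "i \<in> S \<or> j \<in> S")
  case False
  then have "{s \<in> insert i S. s < j} = insert i {s \<in> S. s < j}"
      "{s \<in> insert j S. s < i} = {s \<in> S. s < i}" and ne: "i \<noteq> j"
    using assms by auto
  moreover have "i \<notin> {s \<in> S. s < j}" "finite {s \<in> S. s < j}"
    using False by auto
  ultimately have card: "card {s \<in> insert i S. s < j} = Suc (card {s \<in> S. s < j})"
      "card {s \<in> insert j S. s < i} = card {s \<in> S. s < i}"
    by (metis card_insert_disjoint)+
  have "insert i (insert j S) = insert j (insert i S)"
    by blast
  moreover have "contract i (contract j q) S = (-1) ^ card {s \<in> S. s < i} *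
      ((-1) ^ card {s \<in> insert i S. s < j} * q (insert j (insert i S)))"
    "contract j (contract i q) S = (-1) ^ card {s \<in> S. s < j} *
      ((-1) ^ card {s \<in> insert j S. s < i} * q (insert i (insert j S)))"
  proof -
    have "i \<notin> S" "j \<notin> S" "j \<notin> insert i S" "i \<notin> insert j S"
      using False ne by auto
    then show "contract i (contract j q) S = (-1) ^ card {s \<in> S. s < i} *
        ((-1) ^ card {s \<in> insert i S. s < j} * q (insert j (insert i S)))"
      "contract j (contract i q) S = (-1) ^ card {s \<in> S. s < j} *
        ((-1) ^ card {s \<in> insert j S. s < i} * q (insert i (insert j S)))"
      by (simp_all only: contract_notin not_False_eq_True)
  qed
  ultimately show ?thesis
    unfolding card power_Suc by (simp only: mult_ac) simp
next
  case True
  have "contract i (contract j q) S = 0"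
  proof (cases "i \<in> S")
    case False
    with True have "j \<in> insert i S"
      by simp
    with False show ?thesis
      by (simp only: contract_notin contract_in not_False_eq_True mult_zero_right)
  qed (rule contract_in)
  moreover have "contract j (contract i q) S = 0"
  proof (cases "j \<in> S")
    case False
    with True have "i \<in> insert j S"
      by simp
    with False show ?thesis
      by (simp only: contract_notin contract_in not_False_eq_True mult_zero_right)
  qed (rule contract_in)
  ultimately show ?thesis
    by simp
qed

lemma contract_contract: "contract i (contract j q) S = - contract j (contract i q) S"
proof (cases i j rule: linorder_cases)
  case equal
  then show ?thesis
    by (cases "j \<in> S") (simp_all add: contract_in contract_notin)
next
  case greater
  then show ?thesis
    by (simp add: contract_contract_less[of j i])
qed (rule contract_contract_less)

lemma contract_gen: "contract i (ext_gen j) S = (if i = j then ext_one S else 0)"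
  by (auto simp: contract_def ext_gen_def ext_one_def doubleton_eq_iff)

lemma grade_sign_gen: "grade_sign (ext_gen j) S = - ext_gen j S"
  by (simp add: grade_sign_def ext_gen_def)

subsection \<open>Supports and weights\<close>

definition ext_in :: "nat \<Rightarrow> ext \<Rightarrow> bool" where
  "ext_in N q \<longleftrightarrow> (\<forall>S. \<not> S \<subseteq> {..<N} \<longrightarrow> q S = 0)"

lemma ext_inD: "ext_in N q \<Longrightarrow> \<not> S \<subseteq> {..<N} \<Longrightarrow> q S = 0"
  by (simp add: ext_in_def)

lemma ext_in_one: "ext_in N ext_one"
  by (auto simp: ext_in_def ext_one_def)

lemma ext_in_wedge: "ext_in N p \<Longrightarrow> ext_in N q \<Longrightarrow> ext_in N (wedge p q)"
  unfolding ext_in_def[of N "wedge p q"] wedge_def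
proof (intro allI impI sum.neutral ballI)
  fix S A assume p: "ext_in N p" and q: "ext_in N q" and S: "\<not> S \<subseteq> {..<N}"
  have "\<not> A \<subseteq> {..<N} \<or> \<not> S - A \<subseteq> {..<N}"
    using S by blast
  then show "shuffle_sign A (S - A) * p A * q (S - A) = 0"
    using ext_inD[OF p, of A] ext_inD[OF q, of "S - A"] by (elim disjE) simp_all
qed

lemma ext_in_contract: "ext_in N q \<Longrightarrow> ext_in N (contract i q)"
  by (auto simp: ext_in_def contract_def)

lemma ext_in_contract_set: "ext_in N q \<Longrightarrow> ext_in N (contract_set A q)"
proof -
  assume "ext_in N q"
  then have "ext_in N (foldr contract xs q)" for xs
    by (induction xs) (simp_all add: ext_in_contract)
  then show ?thesis
    by (simp add: contract_set_def)
qed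

lemma ext_in_theta_act: "ext_in N q \<Longrightarrow> ext_in N (theta_act N p q)"
  using ext_in_contract_set[of N q] by (simp add: ext_in_def theta_act_def)

lemma ext_in_Upsilon: "ext_in N p \<Longrightarrow> ext_in N q \<Longrightarrow> ext_in N (Upsilon N P p q)"
proof -
  assume p: "ext_in N p" and q: "ext_in N q"
  have "ext_in N (wedge (contract_set A (\<lambda>T. (-1) ^ (card T * card B) * p T)) (contract_set B q))" for A B
    by (intro ext_in_wedge ext_in_contract_set q) (use p in \<open>simp add: ext_in_def\<close>)
  then show ?thesis
    by (simp add: ext_in_def Upsilon_def)
qed

lemma ext_in_wedge_list: "(\<And>p. p \<in> set ps \<Longrightarrow> ext_in N p) \<Longrightarrow> ext_in N (wedge_list ps)"
  by (induction ps) (simp_all add: wedge_list_def ext_in_one ext_in_wedge)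

text \<open>Generators with index in Y weigh \<alpha>, variables with index in Y weigh 1, and k is
  the total. The generators are the \<partial> or, with a negative weight, the \<theta>.\<close>

definition wt_on :: "nat set \<Rightarrow> real \<Rightarrow> real \<Rightarrow> ext \<Rightarrow> bool" where
  "wt_on Y \<alpha> k q \<longleftrightarrow> (\<forall>S. finite S \<longrightarrow> hom_on Y (k - \<alpha> * real (card (S \<inter> Y))) (q S))"

lemma wt_onD: "wt_on Y \<alpha> k q \<Longrightarrow> finite S \<Longrightarrow> hom_on Y (k - \<alpha> * real (card (S \<inter> Y))) (q S)"
  by (simp add: wt_on_def)

lemma card_Int_split:
  assumes "T' \<subseteq> T" "finite T"
  shows "card (T \<inter> Y) = card (T' \<inter> Y) + card ((T - T') \<inter> Y)"
proof -
  have "card (T' \<inter> Y \<union> (T - T') \<inter> Y) = card (T' \<inter> Y) + card ((T - T') \<inter> Y)"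
    using assms finite_subset[OF assms] by (intro card_Un_disjoint) auto
  moreover have "T' \<inter> Y \<union> (T - T') \<inter> Y = T \<inter> Y"
    using assms by auto
  ultimately show ?thesis
    by (simp only:)
qed

lemma wt_on_wedge:
  assumes "wt_on Y \<alpha> k p" "wt_on Y \<alpha> l q"
  shows "wt_on Y \<alpha> (k + l) (wedge p q)"
  unfolding wt_on_def wedge_def
proof (intro allI impI hom_on_sum)
  fix S A :: "nat set" assume "finite S" "A \<in> Pow S"
  then have fin: "finite A" "finite (S - A)" and AS: "A \<subseteq> S"
    using finite_subset by auto
  have "card (S \<inter> Y) = card (A \<inter> Y) + card ((S - A) \<inter> Y)"
    using AS \<open>finite S\<close> by (rule card_Int_split)
  then have *: "k + l - \<alpha> * real (card (S \<inter> Y)) =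
      (0 + (k - \<alpha> * real (card (A \<inter> Y)))) + (l - \<alpha> * real (card ((S - A) \<inter> Y)))"
    by (simp add: algebra_simps)
  show "hom_on Y (k + l - \<alpha> * real (card (S \<inter> Y))) (shuffle_sign A (S - A) * p A * q (S - A))"
    unfolding * by (intro hom_on_mult wt_onD assms fin)
      (simp add: shuffle_sign_def hom_on_minus_one_power)
qed

lemma wt_on_one: "wt_on Y \<alpha> 0 ext_one"
  by (auto simp: wt_on_def ext_one_def hom_on_one)

lemma wt_on_gen: "wt_on Y \<alpha> (\<alpha> * of_bool (j \<in> Y)) (ext_gen j)"
  by (auto simp: wt_on_def ext_gen_def hom_on_one)

lemma wt_on_sum: "(\<And>a. a \<in> A \<Longrightarrow> wt_on Y \<alpha> k (f a)) \<Longrightarrow> wt_on Y \<alpha> k (\<lambda>S. \<Sum>a\<in>A. f a S)"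
  by (auto simp: wt_on_def intro!: hom_on_sum)

lemma wt_on_mult: "hom_on Y l c \<Longrightarrow> wt_on Y \<alpha> k q \<Longrightarrow> wt_on Y \<alpha> (l + k) (\<lambda>S. c * q S)"
  unfolding wt_on_def add_diff_eq[symmetric] by (intro allI impI hom_on_mult) simp_all

lemma wt_on_Cst_mult: "wt_on Y \<alpha> k q \<Longrightarrow> wt_on Y \<alpha> k (\<lambda>S. Cst c * q S)"
  using wt_on_mult[OF hom_on_Cst] by simp

lemma wt_on_contract:
  assumes "wt_on Y \<alpha> k q"
  shows "wt_on Y \<alpha> (k - \<alpha> * of_bool (i \<in> Y)) (contract i q)"
  unfolding wt_on_def
proof (intro allI impI)
  fix S :: "nat set" assume fin: "finite S"
  show "hom_on Y (k - \<alpha> * of_bool (i \<in> Y) - \<alpha> * real (card (S \<inter> Y))) (contract i q S)"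
  proof (cases "i \<in> S")
    case False
    then have "k - \<alpha> * of_bool (i \<in> Y) - \<alpha> * real (card (S \<inter> Y)) = 0 + (k - \<alpha> * real (card (insert i S \<inter> Y)))"
      using fin by (simp add: algebra_simps)
    then show ?thesis
      using False fin hom_on_mult[OF hom_on_minus_one_power wt_onD[OF assms, of "insert i S"]]
      by (simp only: contract_notin finite_insert not_False_eq_True)
  qed (simp add: contract_def)
qed

lemma wt_on_contract_set:
  assumes "wt_on Y \<alpha> k q" "finite A"
  shows "wt_on Y \<alpha> (k - \<alpha> * real (card (A \<inter> Y))) (contract_set A q)"
proof -
  have "wt_on Y \<alpha> (k - \<alpha> * real (card (set xs \<inter> Y))) (foldr contract xs q)" if "distinct xs" for xs
    using that
  proof (induction xs)
    case (Cons x xs)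
    have *: "k - \<alpha> * real (card (set (x # xs) \<inter> Y)) = k - \<alpha> * real (card (set xs \<inter> Y)) - \<alpha> * of_bool (x \<in> Y)"
      using Cons.prems by (simp add: algebra_simps)
    show ?case
      unfolding * using wt_on_contract[OF Cons.IH] Cons.prems by simp
  qed (simp add: assms)
  from this[of "sorted_list_of_set A"] show ?thesis
    using assms by (simp add: contract_set_def)
qed

text \<open>A \<theta> and the \<partial> that it removes have opposite weights, so contraction
  preserves the total.\<close>

lemma wt_on_theta_act:
  assumes "wt_on Y (- \<alpha>) k p" "wt_on Y \<alpha> l q"
  shows "wt_on Y \<alpha> (k + l) (theta_act N p q)"
  unfolding theta_act_def
proof (rule wt_on_sum)
  fix A assume "A \<in> Pow {..<N}"
  then have fin: "finite A"
    using finite_subset by blast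
  show "wt_on Y \<alpha> (k + l) (\<lambda>S. p A * contract_set A q S)"
    using wt_on_mult[OF wt_onD[OF assms(1) fin] wt_on_contract_set[OF assms(2) fin]] by simp
qed

lemma wt_on_ext_exp:
  assumes "wt_on Y \<alpha> 0 p"
  shows "wt_on Y \<alpha> 0 (ext_exp N p)"
proof -
  have "wt_on Y \<alpha> 0 ((wedge p ^^ k) ext_one)" for k
    using wt_on_wedge[OF assms] by (induction k) (simp_all add: wt_on_one)
  then show ?thesis
    unfolding ext_exp_def[abs_def] by (intro wt_on_sum wt_on_Cst_mult)
qed

text \<open>Total weight 0, where a \<theta> in either tensor factor weighs -\<alpha>. This is the
  weight of \<open>H_f\<close>; products keep it, hence so does the exponential.\<close>

definition wt2_on :: "nat set \<Rightarrow> real \<Rightarrow> ext2 \<Rightarrow> bool" where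
  "wt2_on Y \<alpha> P \<longleftrightarrow>
     (\<forall>A B. finite A \<longrightarrow> finite B \<longrightarrow> hom_on Y (\<alpha> * real (card (A \<inter> Y)) + \<alpha> * real (card (B \<inter> Y))) (P A B))"

lemma wt2_on_mult:
  assumes "wt2_on Y \<alpha> P" "wt2_on Y \<alpha> Q"
  shows "wt2_on Y \<alpha> (ext2_mult P Q)"
  unfolding wt2_on_def ext2_mult_def
proof (intro allI impI hom_on_sum)
  fix A B A' B' :: "nat set"
  assume fin: "finite A" "finite B" and sub: "A' \<in> Pow A" "B' \<in> Pow B"
  have fins: "finite A'" "finite B'"
    using fin sub finite_subset by blast+
  have *: "\<alpha> * real (card (A \<inter> Y)) + \<alpha> * real (card (B \<inter> Y)) =
    (0 + 0 + 0 + (\<alpha> * real (card (A' \<inter> Y)) + \<alpha> * real (card (B' \<inter> Y)))) +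
    (\<alpha> * real (card ((A - A') \<inter> Y)) + \<alpha> * real (card ((B - B') \<inter> Y)))"
    using card_Int_split[of A' A Y] card_Int_split[of B' B Y] fin sub by (simp add: algebra_simps)
  have P: "hom_on Y (\<alpha> * real (card (A' \<inter> Y)) + \<alpha> * real (card (B' \<inter> Y))) (P A' B')"
    using assms(1) fins by (simp add: wt2_on_def)
  have Q: "hom_on Y (\<alpha> * real (card ((A - A') \<inter> Y)) + \<alpha> * real (card ((B - B') \<inter> Y)))
      (Q (A - A') (B - B'))"
    using assms(2) fin by (simp add: wt2_on_def)
  show "hom_on Y (\<alpha> * real (card (A \<inter> Y)) + \<alpha> * real (card (B \<inter> Y)))
     ((-1) ^ (card B' * card (A - A')) * shuffle_sign A' (A - A') * shuffle_sign B' (B - B') *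
        P A' B' * Q (A - A') (B - B'))"
    unfolding shuffle_sign_def by (subst *, intro hom_on_mult hom_on_minus_one_power P Q)
qed

lemma wt2_on_ext2_exp:
  assumes "wt2_on Y \<alpha> P"
  shows "wt2_on Y \<alpha> (ext2_exp N P)"
proof -
  have "wt2_on Y \<alpha> ext2_one"
    by (auto simp: wt2_on_def ext2_one_def hom_on_one)
  then have "wt2_on Y \<alpha> ((ext2_mult P ^^ k) ext2_one)" for k
    using wt2_on_mult[OF assms] by (induction k) simp_all
  then show ?thesis
    unfolding ext2_exp_def[abs_def] wt2_on_def by (auto intro!: hom_on_sum hom_on_Cst_mult)
qed

lemma wt_on_Upsilon:
  assumes "wt2_on Y \<alpha> P" "wt_on Y \<alpha> k p" "wt_on Y \<alpha> l q"
  shows "wt_on Y \<alpha> (k + l) (Upsilon N P p q)"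
  unfolding Upsilon_def[abs_def]
proof (intro wt_on_sum)
  fix A B assume "A \<in> Pow {..<N}" "B \<in> Pow {..<N}"
  then have fin: "finite A" "finite B"
    using finite_subset by blast+
  have p: "wt_on Y \<alpha> k (\<lambda>T. (-1) ^ (card T * card B) * p T)"
    using assms(2) by (auto simp: wt_on_def intro!: hom_on_mult0 hom_on_minus_one_power)
  have *: "k + l = (\<alpha> * real (card (A \<inter> Y)) + \<alpha> * real (card (B \<inter> Y))) +
     ((k - \<alpha> * real (card (A \<inter> Y))) + (l - \<alpha> * real (card (B \<inter> Y))))"
    by simp
  have P: "hom_on Y (\<alpha> * real (card (A \<inter> Y)) + \<alpha> * real (card (B \<inter> Y))) (P A B)"
    using assms(1) fin by (simp add: wt2_on_def)
  show "wt_on Y \<alpha> (k + l) (\<lambda>S. P A B *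
      wedge (contract_set A (\<lambda>T. (-1) ^ (card T * card B) * p T)) (contract_set B q) S)"
    by (subst *, rule wt_on_mult[OF P wt_on_wedge[OF wt_on_contract_set[OF p fin(1)] wt_on_contract_set[OF assms(3) fin(2)]]])
qed

lemma wt_on_wedge_list:
  "(\<And>i. i \<in> set is \<Longrightarrow> wt_on Y \<alpha> (k i) (p i)) \<Longrightarrow> wt_on Y \<alpha> (\<Sum>i\<leftarrow>is. k i) (wedge_list (map p is))"
  by (induction "is") (simp_all add: wedge_list_def wt_on_one wt_on_wedge)

subsection \<open>Linear changes of the generators\<close>

definition contract_t :: "nat \<Rightarrow> eigensystem \<Rightarrow> nat \<Rightarrow> ext \<Rightarrow> ext" where
  "contract_t N E i q S = (\<Sum>j<N. Cst (coord_mat E $$ (i, j)) * contract j q S)"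

definition d_thetats :: "nat \<Rightarrow> eigensystem \<Rightarrow> nat list \<Rightarrow> ext" where
  "d_thetats N E js = wedge_list (map (d_thetat N E) js)"

text \<open>Dual to \<open>d_thetats\<close>: contracting by the \<open>thetat\<close> of the list,
  head first, and keeping the constant term reads off the coefficient of the product taken in that
  order.\<close>

definition coeff_t :: "nat \<Rightarrow> eigensystem \<Rightarrow> nat list \<Rightarrow> ext \<Rightarrow> mpoly" where
  "coeff_t N E js q = fold (contract_t N E) js q {}"

lemma wedge_sum_left: "wedge (\<lambda>S. \<Sum>a\<in>A. c a * p a S) q S = (\<Sum>a\<in>A. c a * wedge (p a) q S)"
  unfolding wedge_def
  by (simp add: sum_distrib_left sum_distrib_right sum.swap[of _ A] mult_ac)

lemma wedge_sum_right: "wedge q (\<lambda>S. \<Sum>a\<in>A. c a * p a S) S = (\<Sum>a\<in>A. c a * wedge q (p a) S)"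
  unfolding wedge_def
  by (simp add: sum_distrib_left sum_distrib_right sum.swap[of _ A] mult_ac)

lemma wedge_scale_right: "wedge q (\<lambda>S. c * p S) S = c * wedge q p S"
  using wedge_sum_right[of q "\<lambda>_. c" "\<lambda>_. p" "{()}" S] by simp

lemma wedge_zero_right: "wedge q (\<lambda>S. 0) S = 0"
  by (simp add: wedge_def)

lemma wedge_zero_left: "wedge (\<lambda>S. 0) q S = 0"
  by (simp add: wedge_def)

lemma contract_sum: "contract i (\<lambda>S. \<Sum>a\<in>A. c a * q a S) S = (\<Sum>a\<in>A. c a * contract i (q a) S)"
proof (cases "i \<in> S")
  case False
  then show ?thesis
    by (simp add: contract_notin sum_distrib_left mult.left_commute)
qed (simp add: contract_in)

lemma contract_t_sum:
  "contract_t N E i (\<lambda>S. \<Sum>a\<in>A. c a * q a S) S = (\<Sum>a\<in>A. c a * contract_t N E i (q a) S)"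
proof -
  have "contract_t N E i (\<lambda>S. \<Sum>a\<in>A. c a * q a S) S =
    (\<Sum>j<N. \<Sum>a\<in>A. Cst (coord_mat E $$ (i, j)) * (c a * contract j (q a) S))"
    by (simp add: contract_t_def contract_sum sum_distrib_left)
  also have "\<dots> = (\<Sum>a\<in>A. \<Sum>j<N. Cst (coord_mat E $$ (i, j)) * (c a * contract j (q a) S))"
    by (rule sum.swap)
  also have "\<dots> = (\<Sum>a\<in>A. c a * contract_t N E i (q a) S)"
    by (simp add: contract_t_def sum_distrib_left mult.left_commute)
  finally show ?thesis .
qed

lemma fold_contract_t_sum:
  "fold (contract_t N E) js (\<lambda>S. \<Sum>a\<in>A. c a * q a S) = (\<lambda>S. \<Sum>a\<in>A. c a * fold (contract_t N E) js (q a) S)"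
proof (induction js arbitrary: q)
  case (Cons j js)
  have "contract_t N E j (\<lambda>S. \<Sum>a\<in>A. c a * q a S) = (\<lambda>S. \<Sum>a\<in>A. c a * contract_t N E j (q a) S)"
    by (rule ext) (rule contract_t_sum)
  then show ?case
    using Cons[of "\<lambda>a. contract_t N E j (q a)"] by simp
qed simp

lemma coeff_t_sum: "coeff_t N E js (\<lambda>S. \<Sum>a\<in>A. c a * q a S) = (\<Sum>a\<in>A. c a * coeff_t N E js (q a))"
  by (simp add: coeff_t_def fold_contract_t_sum)

lemma coeff_t_scale: "coeff_t N E js (\<lambda>S. c * q S) = c * coeff_t N E js q"
  using coeff_t_sum[of N E js "\<lambda>_. c" "\<lambda>_. q" "{()}"] by simp

lemma coeff_t_add: "coeff_t N E js (\<lambda>S. p S + q S) = coeff_t N E js p + coeff_t N E js q"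
  using coeff_t_sum[of N E js "\<lambda>_. 1" "\<lambda>b. if b then p else q" UNIV] by (simp add: UNIV_bool add.commute)

lemma coeff_t_diff: "coeff_t N E js (\<lambda>S. p S - q S) = coeff_t N E js p - coeff_t N E js q"
  using coeff_t_add[of N E js p "\<lambda>S. - 1 * q S"] unfolding coeff_t_scale by simp

lemma contract_t_zero: "contract_t N E i (\<lambda>S. 0) = (\<lambda>S. 0)"
proof
  show "contract_t N E i (\<lambda>S. 0) S = 0" for S
    using contract_t_sum[of N E i "\<lambda>_. 0" "\<lambda>_ _. 0" "{}" S] by simp
qed

lemma fold_contract_t_zero: "fold (contract_t N E) js (\<lambda>S. 0) = (\<lambda>S. 0)"
  by (induction js) (simp_all add: contract_t_zero)

lemma contract_t_wedge:
  "contract_t N E i (wedge p q) S = wedge (contract_t N E i p) q S + wedge (grade_sign p) (contract_t N E i q) S"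
  unfolding contract_t_def[abs_def] wedge_sum_left wedge_sum_right
  by (simp add: contract_wedge distrib_left sum.distrib)

lemma contract_t_contract_t: "contract_t N E i (contract_t N E j q) S = - contract_t N E j (contract_t N E i q) S"
proof -
  have *: "contract_t N E i (contract_t N E j q) S =
    (\<Sum>k<N. \<Sum>l<N. Cst (coord_mat E $$ (i, k)) * (Cst (coord_mat E $$ (j, l)) * contract k (contract l q) S))" for i j
    unfolding contract_t_def[of N E j q, abs_def] contract_t_def[of N E i] contract_sum sum_distrib_left ..
  have "contract_t N E i (contract_t N E j q) S =
    (\<Sum>k<N. \<Sum>l<N. - (Cst (coord_mat E $$ (j, l)) * (Cst (coord_mat E $$ (i, k)) * contract l (contract k q) S)))"
    unfolding *
  proof (intro sum.cong refl)
    fix k l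
    show "Cst (coord_mat E $$ (i, k)) * (Cst (coord_mat E $$ (j, l)) * contract k (contract l q) S) =
      - (Cst (coord_mat E $$ (j, l)) * (Cst (coord_mat E $$ (i, k)) * contract l (contract k q) S))"
      by (subst contract_contract) (simp only: mult_minus_right mult.left_commute)
  qed
  also have "\<dots> = (\<Sum>l<N. \<Sum>k<N. - (Cst (coord_mat E $$ (j, l)) * (Cst (coord_mat E $$ (i, k)) * contract l (contract k q) S)))"
    by (rule sum.swap)
  also have "\<dots> = - contract_t N E j (contract_t N E i q) S"
    unfolding * sum_negf ..
  finally show ?thesis .
qed

text \<open>By anticommutation the element is its own negative, and 2 is not a zero divisor.\<close>

lemma contract_t_twice: "contract_t N E i (contract_t N E i q) S = 0"
proof -
  let ?x = "contract_t N E i (contract_t N E i q) S"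
  have "?x + ?x = 0"
    using contract_t_contract_t[of N E i i q S] unfolding eq_neg_iff_add_eq_0 .
  then have "(Cst 1 + Cst 1) * ?x = 0"
    by (simp only: distrib_right Cst_one mult_1_left)
  then have "Cst (1 + 1) * ?x = 0"
    by (simp only: Cst_add)
  then show ?thesis
    by (simp only: mult_eq_0_iff Cst_eq_0_iff) simp
qed

lemma contract_t_anti: "contract_t N E i q = (\<lambda>S. 0) \<Longrightarrow> contract_t N E i (contract_t N E j q) = (\<lambda>S. 0)"
  by (rule ext, subst contract_t_contract_t) (simp add: contract_t_zero)

lemma fold_contract_t_anti:
  "contract_t N E i q = (\<lambda>S. 0) \<Longrightarrow> contract_t N E i (fold (contract_t N E) js q) = (\<lambda>S. 0)"
  by (induction js arbitrary: q) (simp_all add: contract_t_anti)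

lemma fold_contract_t_killed:
  assumes "contract_t N E i q = (\<lambda>S. 0)" "i \<in> set js"
  shows "fold (contract_t N E) js q = (\<lambda>S. 0)"
proof -
  obtain xs ys where "js = xs @ i # ys"
    using assms(2) by (meson split_list)
  then show ?thesis
    using fold_contract_t_anti[OF assms(1), of xs] by (simp add: fold_contract_t_zero)
qed

lemma ext_in_contract_t: "ext_in N q \<Longrightarrow> ext_in N (contract_t N E i q)"
  using ext_in_contract[of N q] by (simp add: ext_in_def contract_t_def)

lemma fold_contract_t_graded:
  assumes "\<And>S. finite S \<Longrightarrow> card S = card T + length js \<Longrightarrow> q S = 0" "finite T"
  shows "fold (contract_t N E) js q T = 0"
  using assms
proof (induction js arbitrary: q)
  case (Cons j js)
  have "contract_t N E j q S = 0" if S: "finite S" "card S = card T + length js" for S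
    unfolding contract_t_def
  proof (intro sum.neutral ballI)
    fix i
    show "Cst (coord_mat E $$ (j, i)) * contract i q S = 0"
    proof (cases "i \<in> S")
      case False
      then have "q (insert i S) = 0"
        using S by (intro Cons.prems(1)) simp_all
      then show ?thesis
        using False by (simp add: contract_notin)
    qed (simp add: contract_in)
  qed
  then show ?case
    using Cons.IH[of "contract_t N E j q"] Cons.prems(2) by simp
qed simp

lemma coeff_t_graded:
  "(\<And>S. finite S \<Longrightarrow> card S = length js \<Longrightarrow> q S = 0) \<Longrightarrow> coeff_t N E js q = 0"
  unfolding coeff_t_def by (rule fold_contract_t_graded) simp_all

lemma wt_on_contract_t:
  assumes "\<And>j. j < N \<Longrightarrow> coord_mat E $$ (i, j) \<noteq> 0 \<Longrightarrow> j \<in> Y \<longleftrightarrow> i \<in> Y" "wt_on Y \<alpha> k q"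
  shows "wt_on Y \<alpha> (k - \<alpha> * of_bool (i \<in> Y)) (contract_t N E i q)"
  unfolding contract_t_def[abs_def]
proof (rule wt_on_sum)
  fix j assume "j \<in> {..<N}"
  then show "wt_on Y \<alpha> (k - \<alpha> * of_bool (i \<in> Y)) (\<lambda>S. Cst (coord_mat E $$ (i, j)) * contract j q S)"
    using assms(1)[of j] wt_on_Cst_mult[OF wt_on_contract[OF assms(2), of j]]
    by (cases "coord_mat E $$ (i, j) = 0") (auto simp: wt_on_def)
qed

lemma hom_on_coeff_t:
  assumes "\<And>i j. i \<in> set js \<Longrightarrow> j < N \<Longrightarrow> coord_mat E $$ (i, j) \<noteq> 0 \<Longrightarrow> j \<in> Y \<longleftrightarrow> i \<in> Y"
    and "distinct js" "wt_on Y \<alpha> k q"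
  shows "hom_on Y (k - \<alpha> * real (card (set js \<inter> Y))) (coeff_t N E js q)"
proof -
  have "wt_on Y \<alpha> (k - \<alpha> * real (card (set js \<inter> Y))) (fold (contract_t N E) js q)"
    using assms
  proof (induction js arbitrary: q k)
    case (Cons j js)
    have "wt_on Y \<alpha> (k - \<alpha> * of_bool (j \<in> Y)) (contract_t N E j q)"
      using Cons.prems(1)[of j] by (intro wt_on_contract_t Cons.prems(3)) simp
    then have "wt_on Y \<alpha> (k - \<alpha> * of_bool (j \<in> Y) - \<alpha> * real (card (set js \<inter> Y)))
        (fold (contract_t N E) js (contract_t N E j q))"
      using Cons.prems(1,2) by (intro Cons.IH) simp_all
    moreover have "k - \<alpha> * of_bool (j \<in> Y) - \<alpha> * real (card (set js \<inter> Y)) =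
        k - \<alpha> * real (card (set (j # js) \<inter> Y))"
      using Cons.prems(2) by (simp add: algebra_simps)
    ultimately show ?case
      by simp
  qed simp
  from wt_onD[OF this, of "{}"] show ?thesis
    by (simp add: coeff_t_def)
qed

section \<open>Duality between products of \<open>d_thetat\<close> and contractions by
  \<open>thetat\<close>\<close>

locale dual_frames =
  fixes N :: nat and E :: eigensystem
  assumes coord_mult: "\<And>i j. i < N \<Longrightarrow> j < N \<Longrightarrow>
      (\<Sum>k<N. coord_mat E $$ (i, k) * coord_inv E $$ (k, j)) = of_bool (i = j)"
    and inv_mult: "\<And>i j. i < N \<Longrightarrow> j < N \<Longrightarrow>
      (\<Sum>k<N. coord_inv E $$ (i, k) * coord_mat E $$ (k, j)) = of_bool (i = j)"
begin

lemma contract_t_d_thetat: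
  assumes "i < N" "j < N"
  shows "contract_t N E i (d_thetat N E j) S = of_bool (i = j) * ext_one S"
proof -
  have "contract_t N E i (d_thetat N E j) S =
    (\<Sum>k<N. \<Sum>l<N. Cst (coord_mat E $$ (i, k)) * (Cst (coord_inv E $$ (l, j)) * contract k (ext_gen l) S))"
    unfolding contract_t_def d_thetat_def[abs_def] contract_sum sum_distrib_left ..
  also have "\<dots> = (\<Sum>k<N. \<Sum>l<N. if k = l then Cst (coord_mat E $$ (i, k) * coord_inv E $$ (l, j)) * ext_one S else 0)"
    by (intro sum.cong) (auto simp: contract_gen Cst_mult)
  also have "\<dots> = Cst (\<Sum>k<N. coord_mat E $$ (i, k) * coord_inv E $$ (k, j)) * ext_one S"
    by (simp add: Cst_sum sum_distrib_right)
  finally show ?thesis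
    using coord_mult[OF assms] by (auto simp: of_bool_def)
qed

lemma grade_sign_d_thetat: "grade_sign (d_thetat N E j) = (\<lambda>S. - 1 * d_thetat N E j S)"
  by (rule ext) (auto simp: grade_sign_def d_thetat_def ext_gen_def sum_distrib_left sum_negf[symmetric] intro!: sum.cong)

lemma ext_in_d_thetat: "ext_in N (d_thetat N E j)"
  by (auto simp: ext_in_def d_thetat_def ext_gen_def intro!: sum.neutral)

lemma ext_in_d_thetats: "ext_in N (d_thetats N E js)"
  unfolding d_thetats_def by (rule ext_in_wedge_list) (auto intro: ext_in_d_thetat)

lemma wedge_of_bool_one: "ext_in N q \<Longrightarrow> wedge (\<lambda>S. of_bool b * ext_one S) q S = of_bool b * q S"
proof -
  assume q: "ext_in N q"
  have "q S = 0" if "infinite S"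
    using that by (intro ext_inD[OF q]) (auto dest: finite_subset)
  then have "wedge ext_one q S = q S"
    by (simp add: wedge_ext_one)
  then show ?thesis
    by (cases b) (simp_all add: wedge_zero_left)
qed

lemma wedge_neg_left: "wedge (\<lambda>S. - 1 * p S) q S = - wedge p q S"
  using wedge_sum_left[of "\<lambda>_. - 1" "\<lambda>_. p" "{()}" q S] by simp

lemma contract_t_wedge_d_thetat:
  assumes "i < N" "j < N" "ext_in N q"
  shows "contract_t N E i (wedge (d_thetat N E j) q) S =
    of_bool (i = j) * q S - wedge (d_thetat N E j) (contract_t N E i q) S"
proof -
  have "contract_t N E i (d_thetat N E j) = (\<lambda>S. of_bool (i = j) * ext_one S)"
    using assms by (intro ext contract_t_d_thetat)
  then show ?thesis
    unfolding contract_t_wedge grade_sign_d_thetat wedge_neg_left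
    using assms(3) by (simp add: wedge_of_bool_one)
qed

lemma d_thetats_Cons: "d_thetats N E (j # js) = wedge (d_thetat N E j) (d_thetats N E js)"
  by (simp add: d_thetats_def wedge_list_def)

lemma contract_t_d_thetats_notin:
  assumes "i < N" "set js \<subseteq> {..<N}" "i \<notin> set js"
  shows "contract_t N E i (d_thetats N E js) = (\<lambda>S. 0)"
  using assms(2,3)
proof (induction js)
  case Nil
  have "contract j ext_one S = 0" for j S
    by (simp add: contract_def ext_one_def)
  then show ?case
    by (simp add: d_thetats_def wedge_list_def contract_t_def fun_eq_iff)
next
  case (Cons j js)
  then have IH: "contract_t N E i (d_thetats N E js) = (\<lambda>S. 0)"
    by simp
  show ?case
    unfolding d_thetats_Cons using Cons.prems assms(1)
    by (intro ext) (simp add: contract_t_wedge_d_thetat ext_in_d_thetats IH wedge_zero_right)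
qed

lemma contract_t_d_thetats_hd:
  assumes "set (j # js) \<subseteq> {..<N}" "distinct (j # js)"
  shows "contract_t N E j (d_thetats N E (j # js)) = d_thetats N E js"
proof -
  have "contract_t N E j (d_thetats N E js) = (\<lambda>S. 0)"
    using assms by (intro contract_t_d_thetats_notin) simp_all
  then show ?thesis
    unfolding d_thetats_Cons using assms
    by (intro ext) (simp add: contract_t_wedge_d_thetat ext_in_d_thetats wedge_zero_right)
qed

lemma contract_t_d_thetats_in:
  assumes "set js \<subseteq> {..<N}" "distinct js" "i \<in> set js"
  shows "\<exists>c. contract_t N E i (d_thetats N E js) = (\<lambda>S. c * d_thetats N E (remove1 i js) S)"
  using assms
proof (induction js)
  case (Cons j js)
  show ?case
  proof (cases "i = j")
    case True
    have "contract_t N E j (d_thetats N E (j # js)) = (\<lambda>S. 1 * d_thetats N E js S)"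
      using contract_t_d_thetats_hd[of j js] Cons.prems by simp
    then show ?thesis
      unfolding True by (intro exI[of _ 1]) simp
  next
    case False
    then obtain c where c: "contract_t N E i (d_thetats N E js) = (\<lambda>S. c * d_thetats N E (remove1 i js) S)"
      using Cons by auto
    have "contract_t N E i (d_thetats N E (j # js)) = (\<lambda>S. - c * d_thetats N E (remove1 i (j # js)) S)"
    proof
      fix S
      have "i < N" "j < N"
        using Cons.prems by auto
      then show "contract_t N E i (d_thetats N E (j # js)) S = - c * d_thetats N E (remove1 i (j # js)) S"
        using False by (simp add: d_thetats_Cons contract_t_wedge_d_thetat ext_in_d_thetats c wedge_scale_right)
    qed
    then show ?thesis
      by blast
  qed
qed simp

lemma coeff_t_d_thetats_same:
  "set js \<subseteq> {..<N} \<Longrightarrow> distinct js \<Longrightarrow> coeff_t N E js (d_thetats N E js) = 1"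
proof (induction js)
  case (Cons j js)
  then show ?case
    using contract_t_d_thetats_hd[of j js] by (simp add: coeff_t_def)
qed (simp add: coeff_t_def d_thetats_def wedge_list_def ext_one_def)

lemma coeff_t_d_thetats_diff:
  assumes "set is \<subseteq> {..<N}" "distinct is" "set js \<subseteq> {..<N}" "distinct js" "set is \<noteq> set js"
  shows "coeff_t N E is (d_thetats N E js) = 0"
  using assms
proof (induction "is" arbitrary: js)
  case Nil
  then obtain j js' where "js = j # js'"
    by (cases js) auto
  then show ?case
    by (simp add: coeff_t_def d_thetats_Cons wedge_def d_thetat_def ext_gen_def)
next
  case (Cons i "is")
  show ?case
  proof (cases "i \<in> set js")
    case False
    then have "contract_t N E i (d_thetats N E js) = (\<lambda>S. 0)"
      using Cons.prems by (intro contract_t_d_thetats_notin) simp_all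
    then show ?thesis
      by (simp add: coeff_t_def fold_contract_t_zero)
  next
    case True
    obtain c where c: "contract_t N E i (d_thetats N E js) = (\<lambda>S. c * d_thetats N E (remove1 i js) S)"
      using contract_t_d_thetats_in[OF Cons.prems(3,4) True] by blast
    have "set is \<noteq> set (remove1 i js)"
      using Cons.prems True by auto
    then have "coeff_t N E is (d_thetats N E (remove1 i js)) = 0"
      using Cons.prems by (intro Cons.IH) (auto dest: notin_set_remove1)
    then show ?thesis
      using coeff_t_scale[of N E "is" c] by (simp add: coeff_t_def c)
  qed
qed

lemma contract_eq_contract_t:
  assumes "j < N"
  shows "contract j q S = (\<Sum>i<N. Cst (coord_inv E $$ (j, i)) * contract_t N E i q S)"
proof -
  have "(\<Sum>i<N. Cst (coord_inv E $$ (j, i)) * contract_t N E i q S) =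
      (\<Sum>i<N. \<Sum>k<N. Cst (coord_inv E $$ (j, i) * coord_mat E $$ (i, k)) * contract k q S)"
    by (simp add: contract_t_def sum_distrib_left Cst_mult mult.assoc)
  also have "\<dots> = (\<Sum>k<N. \<Sum>i<N. Cst (coord_inv E $$ (j, i) * coord_mat E $$ (i, k)) * contract k q S)"
    by (rule sum.swap)
  also have "\<dots> = (\<Sum>k<N. Cst (of_bool (j = k)) * contract k q S)"
    using inv_mult[OF assms] by (simp add: sum_distrib_right[symmetric] Cst_sum[symmetric])
  also have "\<dots> = (\<Sum>k<N. if j = k then contract k q S else 0)"
    by (intro sum.cong) auto
  finally show ?thesis
    using assms by simp
qed

text \<open>Greedy choice: for k = 0, 1, ... contract by k whenever the result is nonzero. What
  remains is nonzero and killed by every contraction, hence by every \<open>contract j\<close>, so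
  it is a constant.\<close>

lemma coeff_t_nondegenerate:
  assumes R: "ext_in N R" "R \<noteq> (\<lambda>S. 0)"
  shows "\<exists>I\<subseteq>{..<N}. coeff_t N E (sorted_list_of_set I) R \<noteq> 0"
proof -
  let ?F = "\<lambda>I. fold (contract_t N E) (sorted_list_of_set I) R"
  have "\<exists>I\<subseteq>{..<k}. ?F I \<noteq> (\<lambda>S. 0) \<and> (\<forall>i<k. contract_t N E i (?F I) = (\<lambda>S. 0))" for k
  proof (induction k)
    case 0
    then show ?case
      using R(2) by (intro exI[of _ "{}"]) simp
  next
    case (Suc k)
    then obtain I where I: "I \<subseteq> {..<k}" "?F I \<noteq> (\<lambda>S. 0)" "\<forall>i<k. contract_t N E i (?F I) = (\<lambda>S. 0)"
      by blast
    show ?case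
    proof (cases "contract_t N E k (?F I) = (\<lambda>S. 0)")
      case True
      then show ?thesis
        using I by (intro exI[of _ I]) (auto simp: less_Suc_eq)
    next
      case False
      have fin: "finite I"
        using I(1) finite_subset by blast
      have "sorted_list_of_set (insert k I) = sorted_list_of_set I @ [k]"
      proof (rule sorted_distinct_set_unique)
        show "sorted (sorted_list_of_set I @ [k])"
          using I(1) fin by (auto simp: sorted_append)
        show "distinct (sorted_list_of_set I @ [k])"
          using I(1) fin by auto
        show "set (sorted_list_of_set (insert k I)) = set (sorted_list_of_set I @ [k])"
          using fin by (simp only: set_sorted_list_of_set finite_insert set_append list.set) auto
      qed (rule sorted_sorted_list_of_set distinct_sorted_list_of_set)+
      then have F: "?F (insert k I) = contract_t N E k (?F I)"
        by simp
      have "contract_t N E i (contract_t N E k (?F I)) = (\<lambda>S. 0)" if "i < Suc k" for i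
      proof (cases "i = k")
        case True
        then show ?thesis
          using contract_t_twice by auto
      next
        case False
        then show ?thesis
          using that I(3) by (intro contract_t_anti) simp
      qed
      then show ?thesis
        using False I(1) unfolding F[symmetric]
        by (intro exI[of _ "insert k I"]) auto
    qed
  qed
  then obtain I where I: "I \<subseteq> {..<N}" "?F I \<noteq> (\<lambda>S. 0)" "\<forall>i<N. contract_t N E i (?F I) = (\<lambda>S. 0)"
    by blast
  have "ext_in N (fold (contract_t N E) js R)" for js
    using R(1)
  proof (induction js arbitrary: R)
    case (Cons j js)
    then show ?case
      using ext_in_contract_t by simp
  qed simp
  then have F_in: "ext_in N (?F I)" .
  have "?F I S = 0" if "S \<noteq> {}" for S
  proof (cases "S \<subseteq> {..<N}")
    case True
    from that obtain j where j: "j \<in> S" by blast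
    then have "contract j (?F I) (S - {j}) = 0"
      using True I(3) by (subst contract_eq_contract_t) auto
    then show ?thesis
      using j by (simp add: contract_notin insert_absorb)
  next
    case False
    then show ?thesis
      by (rule ext_inD[OF F_in])
  qed
  then have "?F I {} \<noteq> 0"
    using I(2) by metis
  then show ?thesis
    using I(1) by (auto simp: coeff_t_def)
qed

text \<open>By duality the difference of the two sides has all its coefficients zero, so it vanishes
  by \<open>coeff_t_nondegenerate\<close>.\<close>

lemma ext_expansion:
  assumes "ext_in N Z"
  shows "Z S = (\<Sum>I\<in>Pow {..<N}. coeff_t N E (sorted_list_of_set I) Z * d_thetats N E (sorted_list_of_set I) S)"
proof -
  let ?R = "\<lambda>S. Z S - (\<Sum>I\<in>Pow {..<N}. coeff_t N E (sorted_list_of_set I) Z * d_thetats N E (sorted_list_of_set I) S)"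
  have "coeff_t N E (sorted_list_of_set J) ?R = 0" if "J \<subseteq> {..<N}" for J
  proof -
    have "coeff_t N E (sorted_list_of_set J) (d_thetats N E (sorted_list_of_set I)) = of_bool (I = J)"
      if "I \<subseteq> {..<N}" for I
    proof -
      have fin: "finite I" "finite J"
        using that \<open>J \<subseteq> {..<N}\<close> finite_subset by blast+
      show ?thesis
        using fin that \<open>J \<subseteq> {..<N}\<close> coeff_t_d_thetats_same[of "sorted_list_of_set I"]
          coeff_t_d_thetats_diff[of "sorted_list_of_set J" "sorted_list_of_set I"]
        by (cases "I = J") auto
    qed
    then have "(\<Sum>I\<in>Pow {..<N}. coeff_t N E (sorted_list_of_set I) Z *
        coeff_t N E (sorted_list_of_set J) (d_thetats N E (sorted_list_of_set I))) =
      (\<Sum>I\<in>Pow {..<N}. if I = J then coeff_t N E (sorted_list_of_set I) Z else 0)"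
      by (intro sum.cong) auto
    also have "\<dots> = coeff_t N E (sorted_list_of_set J) Z"
      using that by simp
    finally show ?thesis
      unfolding coeff_t_diff coeff_t_sum by simp
  qed
  moreover have "ext_in N ?R"
    using assms ext_in_d_thetats by (simp add: ext_in_def)
  ultimately have "?R = (\<lambda>S. 0)"
    using coeff_t_nondegenerate[of ?R] by blast
  then show ?thesis
    by (simp add: fun_eq_iff)
qed

text \<open>Evaluates the description in \<open>xi_coeff\<close>. The basis product for I is
  exchanged for an element whose own I-coefficient is the invertible constant \<kappa>; comparing
  I-coefficients yields c \<kappa> = \<open>coeff_t\<close> of Z, and this c works.\<close>

lemma replaced_basis_coeff:
  assumes "I \<subseteq> {..<N}" "ext_in N \<xi>" "coeff_t N E (sorted_list_of_set I) \<xi> = Cst \<kappa>" "\<kappa> \<noteq> 0" "ext_in N Z"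
  shows "(THE c. \<exists>z. z I = 0 \<and> (\<forall>S. Z S = c * \<xi> S +
           (\<Sum>J\<in>Pow {..<N}. z J * wedge_list (map (d_thetat N E) (sorted_list_of_set J)) S))) =
         Cst (1 / \<kappa>) * coeff_t N E (sorted_list_of_set I) Z"
  (is "(THE c. ?P c) = ?c")
proof (rule the_equality)
  let ?l = sorted_list_of_set
  show "?P ?c"
  proof (rule exI[of _ "\<lambda>J. coeff_t N E (?l J) (\<lambda>S. Z S - ?c * \<xi> S)"], intro conjI allI)
    let ?z = "\<lambda>J. coeff_t N E (?l J) (\<lambda>S. Z S - ?c * \<xi> S)"
    have "Cst (1 / \<kappa>) * Cst \<kappa> = 1"
      using assms(4) by (simp add: Cst_mult[symmetric])
    then show "?z I = 0"
      unfolding coeff_t_diff coeff_t_scale assms(3) by (simp add: mult_ac)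
    have "ext_in N (\<lambda>S. Z S - ?c * \<xi> S)"
      using assms by (simp add: ext_in_def)
    note expansion = ext_expansion[OF this]
    fix S
    show "Z S = ?c * \<xi> S + (\<Sum>J\<in>Pow {..<N}. ?z J * wedge_list (map (d_thetat N E) (?l J)) S)"
      using expansion[of S] unfolding d_thetats_def by (simp only: diff_eq_eq add.commute)
  qed
next
  let ?l = sorted_list_of_set
  fix c assume "?P c"
  then obtain z where z: "z I = 0" "\<And>S. Z S = c * \<xi> S + (\<Sum>J\<in>Pow {..<N}. z J * d_thetats N E (?l J) S)"
    unfolding d_thetats_def by blast
  have fin: "finite J" if "J \<subseteq> {..<N}" for J
    using that finite_subset by blast
  have "z J * coeff_t N E (?l I) (d_thetats N E (?l J)) = 0" if "J \<subseteq> {..<N}" for J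
    using that assms(1) fin[OF that] fin[OF assms(1)] z(1)
      coeff_t_d_thetats_diff[of "?l I" "?l J"] by (cases "I = J") auto
  then have "(\<Sum>J\<in>Pow {..<N}. z J * coeff_t N E (?l I) (d_thetats N E (?l J))) = 0"
    by (intro sum.neutral) blast
  then have "coeff_t N E (?l I) Z = c * Cst \<kappa>"
    unfolding z(2)[abs_def] coeff_t_add coeff_t_scale coeff_t_sum assms(3) by simp
  then have "?c = c * (Cst (1 / \<kappa>) * Cst \<kappa>)"
    by (simp only: mult.left_commute)
  then show "c = ?c"
    using assms(4) by (simp only: Cst_mult[symmetric]) simp
qed

end

subsection \<open>Cycles of a permutation\<close>

definition cyc :: "(nat \<Rightarrow> nat) \<Rightarrow> nat \<Rightarrow> nat set" where
  "cyc s i = set (support s i)"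

text \<open>An equivalence instead of an implication, so that the complement of a stable set is
  stable as well.\<close>

definition closed_under :: "(nat \<Rightarrow> nat) \<Rightarrow> nat set \<Rightarrow> bool" where
  "closed_under s Y \<longleftrightarrow> (\<forall>i. s i \<in> Y \<longleftrightarrow> i \<in> Y)"

text \<open>Cycles are represented by their smallest elements, in agreement with the choice in
  \<open>d_factor\<close>. Fixed points count as cycles of length 1.\<close>

definition cycle_reps :: "(nat \<Rightarrow> nat) \<Rightarrow> nat set \<Rightarrow> nat set" where
  "cycle_reps s Y = {i \<in> Y. Min (cyc s i) = i}"

lemma closed_under_Compl: "closed_under s Y \<Longrightarrow> closed_under s (- Y)"
  by (simp add: closed_under_def)

context
  fixes s :: "nat \<Rightarrow> nat" and N :: nat
  assumes perm: "s permutes {..<N}"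
begin

lemma permutation_s: "permutation s"
  using perm finite_lessThan unfolding permutation_permutes by blast

lemma cyc_range: "cyc s i = range (\<lambda>k. (s ^^ k) i)"
  unfolding cyc_def by (rule support_set[OF permutation_s])

lemma finite_cyc: "finite (cyc s i)"
  by (simp only: cyc_def finite_set)

lemma cyc_self: "i \<in> cyc s i"
  unfolding cyc_range by (rule range_eqI[of _ _ 0]) simp

lemma cyc_next: "j \<in> cyc s i \<Longrightarrow> s j \<in> cyc s i"
proof -
  assume "j \<in> cyc s i"
  then obtain k where "j = (s ^^ k) i"
    unfolding cyc_range by blast
  then have "s j = (s ^^ Suc k) i"
    by simp
  then show ?thesis
    unfolding cyc_range by (rule range_eqI)
qed

lemma cyc_eq:
  assumes "j \<in> cyc s i"
  shows "cyc s j = cyc s i"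
proof -
  have "j \<in> cyc s j \<inter> cyc s i"
    using assms cyc_self by simp
  then show ?thesis
    using disjoint_support[OF permutation_s] unfolding cyc_def disjoint_def by blast
qed

lemma cyc_closed:
  assumes "closed_under s Y" "j \<in> cyc s i"
  shows "j \<in> Y \<longleftrightarrow> i \<in> Y"
proof -
  have "(s ^^ k) i \<in> Y \<longleftrightarrow> i \<in> Y" for k
    using assms(1) by (induction k) (simp_all add: closed_under_def)
  then show ?thesis
    using assms(2) unfolding cyc_range by auto
qed

lemma closed_lessThan: "closed_under s {..<N}"
  using permutes_in_image[OF perm] by (simp add: closed_under_def)

lemma cyc_less: "i < N \<Longrightarrow> j \<in> cyc s i \<Longrightarrow> j < N"
  using cyc_closed[OF closed_lessThan] by simp

lemma closed_cyc: "closed_under s (cyc s i)"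
proof -
  have pre: "j \<in> cyc s i" if "s j \<in> cyc s i" for j
    using cyc_eq[OF that] cyc_eq[OF cyc_next[OF cyc_self, of j]] cyc_self[of j] by simp
  show ?thesis
    unfolding closed_under_def by (intro allI iffI) (erule pre, erule cyc_next)
qed

lemma distinct_support: "distinct (support s i)"
  by (rule cycle_of_permutation[OF permutation_s])

lemma card_cyc: "card (cyc s i) = least_power s i"
  unfolding cyc_def using distinct_card[OF distinct_support[of i]] by simp

lemma card_cyc_pos: "card (cyc s i) > 0"
  using finite_cyc cyc_self by (auto simp: card_gt_0_iff)

lemma funpow_card_cyc: "(s ^^ card (cyc s i)) i = i"
  unfolding card_cyc by (rule least_power_of_permutation(1)[OF permutation_s])

lemma cyc_reps_fiber:
  assumes "closed_under s Y" "c \<in> cycle_reps s Y"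
  shows "{i \<in> Y. Min (cyc s i) = c} = cyc s c"
proof -
  have c: "c \<in> Y" "Min (cyc s c) = c"
    using assms(2) by (auto simp: cycle_reps_def)
  show ?thesis
  proof (intro equalityI subsetI)
    fix i assume "i \<in> {i \<in> Y. Min (cyc s i) = c}"
    then have "c \<in> cyc s i"
      using Min_in[OF finite_cyc, of i] cyc_self by blast
    then show "i \<in> cyc s c"
      using cyc_eq cyc_self by blast
  next
    fix i assume i: "i \<in> cyc s c"
    then show "i \<in> {i \<in> Y. Min (cyc s i) = c}"
      using cyc_eq[OF i] cyc_closed[OF assms(1) i] c by simp
  qed
qed

lemma Min_cyc_reps: "closed_under s Y \<Longrightarrow> i \<in> Y \<Longrightarrow> Min (cyc s i) \<in> cycle_reps s Y"
proof -
  assume Y: "closed_under s Y" "i \<in> Y"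
  have m: "Min (cyc s i) \<in> cyc s i"
    using Min_in[OF finite_cyc] cyc_self by blast
  then show ?thesis
    using cyc_eq[OF m] cyc_closed[OF Y(1) m] Y(2) by (simp add: cycle_reps_def)
qed

lemma sum_cycle_reps:
  fixes f :: "nat \<Rightarrow> 'a :: comm_monoid_add"
  assumes "closed_under s Y" "finite Y"
  shows "(\<Sum>i\<in>Y. f i) = (\<Sum>c\<in>cycle_reps s Y. \<Sum>i\<in>cyc s c. f i)"
proof -
  have "(\<Sum>i\<in>Y. f i) = (\<Sum>c\<in>cycle_reps s Y. \<Sum>i\<in>{i \<in> Y. Min (cyc s i) = c}. f i)"
    using assms Min_cyc_reps[OF assms(1)]
    by (intro sum.group[symmetric]) (auto simp: cycle_reps_def)
  also have "\<dots> = (\<Sum>c\<in>cycle_reps s Y. \<Sum>i\<in>cyc s c. f i)"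
    using cyc_reps_fiber[OF assms(1)] by (intro sum.cong) simp_all
  finally show ?thesis .
qed

lemma prod_cycle_reps:
  fixes f :: "nat \<Rightarrow> complex"
  assumes "closed_under s Y" "finite Y"
  shows "(\<Prod>i\<in>Y. f i) = (\<Prod>c\<in>cycle_reps s Y. \<Prod>i\<in>cyc s c. f i)"
proof -
  have "(\<Prod>i\<in>Y. f i) = (\<Prod>c\<in>cycle_reps s Y. \<Prod>i\<in>{i \<in> Y. Min (cyc s i) = c}. f i)"
    using assms Min_cyc_reps[OF assms(1)]
    by (intro prod.group[symmetric]) (auto simp: cycle_reps_def)
  also have "\<dots> = (\<Prod>c\<in>cycle_reps s Y. \<Prod>i\<in>cyc s c. f i)"
    using cyc_reps_fiber[OF assms(1)] by (intro prod.cong) simp_all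
  finally show ?thesis .
qed

text \<open>Connects the component count of the cycle inequality with sums over cycles: the
  components of the graph of a permutation are its cycles.\<close>

lemma comps_fun_graph_eq:
  assumes "closed_under s Y" "finite Y"
  shows "comps Y (fun_graph Y s) = card (cycle_reps s Y)"
proof -
  have cls: "conn (fun_graph Y s) `` {i} = cyc s i" if i: "i \<in> Y" for i
  proof (intro equalityI subsetI)
    fix j assume "j \<in> conn (fun_graph Y s) `` {i}"
    moreover have "conn (fun_graph Y s) \<subseteq> {(x, y). cyc s x = cyc s y}"
      using cyc_eq[OF cyc_next[OF cyc_self]]
      by (intro conn_least reflI symI transI) (auto simp: fun_graph_def)
    ultimately show "j \<in> cyc s i"
      using cyc_self[of j] by auto
  next
    fix j assume "j \<in> cyc s i"
    then obtain k where j: "j = (s ^^ k) i"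
      unfolding cyc_range by auto
    have "(i, (s ^^ k) i) \<in> conn (fun_graph Y s)"
    proof (induction k)
      case (Suc k)
      have "(s ^^ k) i \<in> cyc s i"
        unfolding cyc_range by simp
      then have "(s ^^ k) i \<in> Y"
        using cyc_closed[OF assms(1)] i by simp
      then have "((s ^^ k) i, (s ^^ Suc k) i) \<in> conn (fun_graph Y s)"
        by (intro conn_edge) (auto simp: fun_graph_def)
      with Suc show ?case
        by (rule conn_trans)
    qed (simp add: conn_refl)
    then show "j \<in> conn (fun_graph Y s) `` {i}"
      by (simp add: j)
  qed
  have "card ((\<lambda>x. conn (fun_graph Y s) `` {x}) ` Y) = card (cyc s ` Y)"
    using cls by (intro arg_cong[where f = card] image_cong) auto
  also have "cyc s ` Y = cyc s ` cycle_reps s Y"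
  proof (intro equalityI subsetI)
    fix X assume "X \<in> cyc s ` Y"
    then obtain i where i: "i \<in> Y" "X = cyc s i" by auto
    have "Min (cyc s i) \<in> cyc s i"
      using Min_in[OF finite_cyc] cyc_self by blast
    then show "X \<in> cyc s ` cycle_reps s Y"
      using cyc_eq i Min_cyc_reps[OF assms(1) i(1)] by (intro image_eqI[of _ _ "Min (cyc s i)"]) simp_all
  qed (auto simp: cycle_reps_def)
  also have "card \<dots> = card (cycle_reps s Y)"
  proof (rule card_image, rule inj_onI)
    fix x y assume xy: "x \<in> cycle_reps s Y" "y \<in> cycle_reps s Y" "cyc s x = cyc s y"
    have "x = Min (cyc s x)" "Min (cyc s y) = y"
      using xy(1,2) unfolding cycle_reps_def by auto
    then show "x = y"
      unfolding xy(3) by (rule trans)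
  qed
  finally show ?thesis
    by (simp add: comps_def)
qed

end

subsection \<open>Roots of unit complex numbers\<close>

lemma Arg2pi_cis_eq: "0 \<le> t \<Longrightarrow> t < 2 * pi \<Longrightarrow> Arg2pi (cis t) = t"
  by (rule Arg2pi_unique[of 1]) (simp_all add: cis_conv_exp)

lemma cis_Arg2pi_eq: "norm z = 1 \<Longrightarrow> cis (Arg2pi z) = z"
  using Arg2pi_eq[of z] by (simp add: cis_conv_exp)

text \<open>The roots have the arguments (t + 2 pi j) / k for j < k, where t =
  \<open>Arg2pi D\<close>. All of them already lie in [0, 2 pi), so no reduction intervenes and the
  sum is an arithmetic series.\<close>

lemma sum_Arg2pi_roots:
  assumes "norm D = 1" "k > 0"
  shows "(\<Sum>z | z ^ k = D. Arg2pi z) = Arg2pi D + pi * (real k - 1)"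
proof -
  define a where "a j = (Arg2pi D + 2 * pi * real j) / real k" for j
  have a: "0 \<le> a j" "a j < 2 * pi" if "j < k" for j
  proof -
    have "Arg2pi D + 2 * pi * real j < 2 * pi + 2 * pi * real j"
      using Arg2pi_lt_2pi[of D] by simp
    also have "\<dots> = 2 * pi * real (Suc j)"
      by (simp add: algebra_simps)
    also have "\<dots> \<le> 2 * pi * real k"
      using that by (intro mult_left_mono) simp_all
    finally show "a j < 2 * pi"
      using assms(2) by (simp add: a_def divide_simps mult_ac)
    show "0 \<le> a j"
      using Arg2pi_ge_0[of D] by (simp add: a_def)
  qed
  have "inj_on (\<lambda>j. cis (a j)) {..<k}"
  proof (rule inj_onI)
    fix i j assume ij: "i \<in> {..<k}" "j \<in> {..<k}" "cis (a i) = cis (a j)"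
    then have "a i = a j"
      using a[of i] a[of j] by (metis Arg2pi_cis_eq lessThan_iff)
    then show "i = j"
      using assms(2) by (simp add: a_def)
  qed
  moreover have "cis (a j) ^ k = D" for j
  proof -
    have "real k * a j = Arg2pi D + 2 * pi * real j"
      using assms(2) by (simp add: a_def)
    then have "cis (a j) ^ k = cis (Arg2pi D + 2 * pi * real j)"
      using Complex.DeMoivre[of "a j" k] by (simp only:)
    also have "\<dots> = cis (Arg2pi D) * cis (2 * pi * real j)"
      by (rule cis_mult[symmetric])
    also have "cis (2 * pi * real j) = 1"
      by (intro cis_multiple_2pi) simp
    finally show ?thesis
      using cis_Arg2pi_eq[OF assms(1)] by simp
  qed
  moreover have card: "card {z. z ^ k = D} = k"
    using assms by (intro card_nth_roots) auto
  moreover have "finite {z. z ^ k = D}"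
    using card assms(2) by (metis card.infinite less_irrefl)
  ultimately have "(\<lambda>j. cis (a j)) ` {..<k} = {z. z ^ k = D}"
    by (intro card_subset_eq) (auto simp: card_image)
  then have "(\<Sum>z | z ^ k = D. Arg2pi z) = (\<Sum>j<k. Arg2pi (cis (a j)))"
    using \<open>inj_on (\<lambda>j. cis (a j)) {..<k}\<close> by (metis (no_types, lifting) sum.reindex_cong)
  also have "\<dots> = (\<Sum>j<k. a j)"
    using a by (intro sum.cong) (simp_all add: Arg2pi_cis_eq)
  also have "\<dots> = (real k * Arg2pi D + 2 * pi * (\<Sum>j<k. real j)) / real k"
    by (simp add: a_def sum_divide_distrib[symmetric] sum.distrib sum_distrib_left)
  also have "(\<Sum>j<k. real j) = real k * (real k - 1) / 2"
    by (induction k) (simp_all add: field_simps)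
  also have "(real k * Arg2pi D + 2 * pi * (real k * (real k - 1) / 2)) / real k = Arg2pi D + pi * (real k - 1)"
    using assms(2) by (simp add: field_simps)
  finally show ?thesis .
qed

subsection \<open>Diagonalisation\<close>

text \<open>Diagonal matrices are written with Jordan blocks of size 1, so that the theory of Jordan
  forms yields both the characteristic polynomial and the dimensions of the eigenspaces.\<close>

lemma jordan_matrix_diag:
  "jordan_matrix (map (Pair 1) as) = mat (length as) (length as) (\<lambda>(i, j). if i = j then as ! i else 0)"
proof (induction as)
  case Nil
  show ?case
    by (intro eq_matI) (simp_all add: jordan_matrix_def)
next
  case (Cons a as)
  let ?J = "mat (length as) (length as) (\<lambda>(i, j). if i = j then as ! i else 0)"
  have "jordan_matrix (map (Pair 1) (a # as)) =
    four_block_mat (jordan_block 1 a) (0\<^sub>m 1 (dim_col ?J)) (0\<^sub>m (dim_row ?J) 1) ?J"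
    using Cons unfolding jordan_matrix_def list.map(2) diag_block_mat.simps(2) prod.case Let_def by simp
  then show ?case
    by (intro eq_matI) (auto simp: nth_Cons split: nat.splits)
qed

text \<open>The last hypothesis says that the rows of M are left eigenvectors of P, that is M P = D
  M with D diagonal. Hence P = L D M.\<close>

lemma similar_jordan_diag:
  assumes "P \<in> carrier_mat N N" "M \<in> carrier_mat N N" "L \<in> carrier_mat N N"
    and "M * L = 1\<^sub>m N" "L * M = 1\<^sub>m N"
    and "\<And>i l. i < N \<Longrightarrow> l < N \<Longrightarrow> (\<Sum>j<N. M $$ (i, j) * P $$ (j, l)) = lam i * M $$ (i, l)"
  shows "similar_mat P (jordan_matrix (map (Pair 1) (map lam [0..<N])))"
proof -
  let ?D = "mat N N (\<lambda>(i, j). if i = j then map lam [0..<N] ! i else 0)"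
  have "M * P = ?D * M"
  proof (rule eq_matI)
    fix i l assume "i < dim_row (?D * M)" "l < dim_col (?D * M)"
    then have il: "i < N" "l < N"
      using assms(2) by auto
    have "(M * P) $$ (i, l) = (\<Sum>j<N. M $$ (i, j) * P $$ (j, l))"
      using il assms(1,2) by (auto simp: scalar_prod_def atLeast0LessThan)
    also have "\<dots> = (\<Sum>j<N. (if i = j then lam i else 0) * M $$ (j, l))"
      unfolding assms(6)[OF il] using il by (simp add: if_distrib[of "\<lambda>x. x * _"] cong: if_cong)
    also have "\<dots> = (?D * M) $$ (i, l)"
      using il assms(2) by (auto simp: scalar_prod_def atLeast0LessThan intro!: sum.cong)
    finally show "(M * P) $$ (i, l) = (?D * M) $$ (i, l)" .
  qed (use assms in auto)
  moreover have "L * (M * P) = P"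
    using assms by (simp flip: assoc_mult_mat[of L N N M N P N])
  moreover have "L * (?D * M) = L * ?D * M"
    using assms by (intro assoc_mult_mat[symmetric]) auto
  ultimately have "P = L * ?D * M"
    by argo
  then show ?thesis
    unfolding jordan_matrix_diag using assms by (intro similar_matI[of _ _ L M N]) auto
qed

lemma age_of_similar:
  assumes "similar_mat (lin_mat N u) (jordan_matrix (map (Pair 1) (map lam [0..<N])))"
  shows "age N u = (\<Sum>i<N. Arg2pi (lam i) / (2 * pi))"
proof -
  have "(\<Prod>(n, a)\<leftarrow>map (Pair 1) (map lam [0..<m]). [:- a, 1:] ^ n) = (\<Prod>i<m. [:- lam i, 1:])" for m
    by (induction m) (simp_all add: mult.commute)
  then have "char_poly (lin_mat N u) = (\<Prod>i<N. [:- lam i, 1:])"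
    unfolding char_poly_similar[OF assms] jordan_matrix_char_poly .
  then have "proots (char_poly (lin_mat N u)) = (\<Sum>i<N. {#lam i#})"
    by (simp add: proots_prod)
  moreover have "(\<Sum>z\<in>#(\<Sum>i<m. {#lam i#}). Arg2pi z / (2 * pi)) = (\<Sum>i<m. Arg2pi (lam i) / (2 * pi))" for m
    by (induction m) simp_all
  ultimately show ?thesis
    by (simp add: age_def)
qed

lemma kernel_dim_similar:
  assumes "similar_mat P (jordan_matrix (map (Pair 1) (map lam [0..<N])))" "P \<in> carrier_mat N N"
  shows "kernel_dim (char_matrix P e) = card {i. i < N \<and> lam i = e}"
proof -
  have "kernel_dim (char_matrix P e) = dim_gen_eigenspace P e 1"
    using assms(2) by (simp add: dim_gen_eigenspace_def)
  also have "\<dots> = (\<Sum>m\<leftarrow>map fst [(m, e')\<leftarrow>map (Pair 1) (map lam [0..<N]). e' = e]. min 1 m)"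
    unfolding dim_gen_eigenspace_similar[OF assms(1)] by (rule dim_gen_eigenspace_jordan_matrix)
  also have "\<dots> = length (filter (\<lambda>i. lam i = e) [0..<N])"
    by (induction N) simp_all
  also have "\<dots> = card {i. i < N \<and> lam i = e}"
    by (simp add: distinct_length_filter Int_def conj_commute)
  finally show ?thesis .
qed

subsection \<open>Eigencoordinates of a group element\<close>

definition cycle_det :: "elt \<Rightarrow> nat \<Rightarrow> complex" where
  "cycle_det u i = (\<Prod>j\<in>cyc (fst u) i. snd u j)"

lemma lookup_linear_form:
  "Poly_Mapping.lookup (\<Sum>j\<in>A. Cst (a j) * X (f j)) (Poly_Mapping.single k 1) = (\<Sum>j\<in>A. a j * of_bool (f j = k))"
proof -
  have "Poly_Mapping.lookup (X i) (Poly_Mapping.single k 1) = of_bool (i = k)" for i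
  proof -
    have "Poly_Mapping.single i (1 :: nat) = Poly_Mapping.single k 1 \<longleftrightarrow> i = k"
      by (metis lookup_single_eq lookup_single_not_eq one_neq_zero)
    then show ?thesis
      by (auto simp: X_def lookup_single when_def)
  qed
  then show ?thesis
    by (simp add: lookup_sum lookup_Cst_mult)
qed

lemma Arg2pi_one: "Arg2pi 1 = 0"
  using Arg2pi_cis_eq[of 0] by simp

locale eigen_elt =
  fixes N :: nat and u :: elt and E :: eigensystem
  assumes perm: "fst u permutes {..<N}"
    and norm_g: "\<And>k. k < N \<Longrightarrow> norm (snd u k) = 1"
    and eig: "eigencoordinates N u E"
begin

abbreviation "s \<equiv> fst u"
abbreviation "g \<equiv> snd u"
abbreviation "M i j \<equiv> coord_mat E $$ (i, j)"
abbreviation "L i j \<equiv> coord_inv E $$ (i, j)"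
abbreviation "lam \<equiv> eigval E"
abbreviation "C \<equiv> cyc (fst u)"

lemma carriers: "coord_mat E \<in> carrier_mat N N" "coord_inv E \<in> carrier_mat N N"
  and mat_inverse: "coord_mat E * coord_inv E = 1\<^sub>m N" "coord_inv E * coord_mat E = 1\<^sub>m N"
  using eig by (auto simp: eigencoordinates_def inverts_mat_def)

lemma mult_entry:
  assumes "A \<in> carrier_mat N N" "B \<in> carrier_mat N N" "A * B = 1\<^sub>m N" "i < N" "j < N"
  shows "(\<Sum>k<N. A $$ (i, k) * B $$ (k, j)) = of_bool (i = j)"
proof -
  have "(A * B) $$ (i, j) = (\<Sum>k<N. A $$ (i, k) * B $$ (k, j))"
    using assms(1,2,4,5) by (auto simp: scalar_prod_def atLeast0LessThan)
  then show ?thesis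
    unfolding assms(3) using assms(4,5) by (cases "i = j") simp_all
qed

sublocale dual_frames N E
  by unfold_locales (intro mult_entry carriers mat_inverse; assumption)+

lemma g_ne: "k < N \<Longrightarrow> g k \<noteq> 0"
  using norm_g[of k] by auto

lemma s_less: "s j < N \<longleftrightarrow> j < N"
  using permutes_in_image[OF perm, of j] by simp

lemma s_onto: "k < N \<Longrightarrow> \<exists>j<N. k = s j"
proof -
  assume "k < N"
  moreover have "s (inv_into UNIV s k) = k"
    using permutes_inverses(1)[OF perm] .
  ultimately show ?thesis
    using s_less[of "inv_into UNIV s k"] by (intro exI[of _ "inv_into UNIV s k"]) simp
qed

lemma funpow_less: "(s ^^ k) j < N \<longleftrightarrow> j < N"
  by (induction k) (simp_all add: s_less)

lemma act_xt: "act u (xt N E i) = (\<Sum>j<N. Cst (M i j * g j) * X (s j))"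
  by (simp add: xt_def act_simps Cst_mult mult.assoc)

text \<open>The coefficient of the variable with index s j in the eigenvalue equation of coordinate
  i. The spectral facts about a cycle come from iterating this relation along it.\<close>

lemma row_step:
  assumes "i < N" "j < N"
  shows "M i (s j) * lam i = M i j * g j"
proof -
  have "act u (xt N E i) = Cst (lam i) * xt N E i"
    using eig assms by (simp add: eigencoordinates_def)
  then have eq: "(\<Sum>k<N. Cst (M i k * g k) * X (s k)) = Cst (lam i) * (\<Sum>k<N. Cst (M i k) * X k)"
    unfolding act_xt by (simp only: xt_def)
  have "s k = s j \<longleftrightarrow> k = j" for k
    using permutes_inj[OF perm] by (auto dest: injD)
  then have 1: "(\<Sum>k<N. (M i k * g k) * of_bool (s k = s j)) = M i j * g j"
    using assms(2) by simp
  have 2: "(\<Sum>k<N. M i k * of_bool (k = s j)) = M i (s j)"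
    using assms(2) s_less by simp
  from arg_cong[OF eq, of "\<lambda>p. Poly_Mapping.lookup p (Poly_Mapping.single (s j) 1)"] show ?thesis
    unfolding lookup_Cst_mult lookup_linear_form 1 2 by (simp only: mult.commute)
qed

lemma row_pow:
  assumes "i < N" "j < N"
  shows "M i ((s ^^ k) j) * lam i ^ k = M i j * (\<Prod>l<k. g ((s ^^ l) j))"
proof (induction k)
  case (Suc k)
  have "M i ((s ^^ Suc k) j) * lam i ^ Suc k = (M i (s ((s ^^ k) j)) * lam i) * lam i ^ k"
    by simp
  also have "\<dots> = (M i ((s ^^ k) j) * lam i ^ k) * g ((s ^^ k) j)"
    using assms by (subst row_step) (simp_all add: funpow_less mult_ac)
  finally show ?case
    unfolding Suc by (simp add: mult_ac)
qed simp

lemma row_support: "i < N \<Longrightarrow> j < N \<Longrightarrow> M i j \<noteq> 0 \<Longrightarrow> j \<in> C i"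
  using eig by (simp add: eigencoordinates_def cyc_def)

lemma row_nonzero: "i < N \<Longrightarrow> \<exists>j<N. M i j \<noteq> 0"
proof (rule ccontr)
  assume i: "i < N" and "\<not> (\<exists>j<N. M i j \<noteq> 0)"
  then have "(\<Sum>k<N. M i k * L k i) = 0"
    by (intro sum.neutral) auto
  then show False
    using coord_mult[OF i i] by simp
qed

lemma lam_ne: "i < N \<Longrightarrow> lam i \<noteq> 0"
proof
  assume i: "i < N" and 0: "lam i = 0"
  obtain j where "j < N" "M i j \<noteq> 0"
    using row_nonzero[OF i] by blast
  then show False
    using row_step[OF i, of j] g_ne[of j] 0 by simp
qed

text \<open>A nonzero entry propagates along the whole cycle, because no scalar g vanishes.\<close>

lemma row_cyc_ne:
  assumes "i < N" "j \<in> C i"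
  shows "M i j \<noteq> 0"
proof -
  obtain j0 where j0: "j0 < N" "M i j0 \<noteq> 0"
    using row_nonzero[OF assms(1)] by blast
  then have "C j0 = C i"
    using row_support assms(1) cyc_eq[OF perm] by blast
  then obtain k where k: "j = (s ^^ k) j0"
    using assms(2) unfolding cyc_range[OF perm] by blast
  have "(\<Prod>l<k. g ((s ^^ l) j0)) \<noteq> 0"
    using j0(1) g_ne by (simp add: funpow_less)
  then have "M i ((s ^^ k) j0) * lam i ^ k \<noteq> 0"
    unfolding row_pow[OF assms(1) j0(1)] using j0(2) by simp
  then show ?thesis
    unfolding k by auto
qed

lemma prod_funpow_eq_cycle_det: "(\<Prod>l<card (C i). g ((s ^^ l) i)) = cycle_det u i"
proof -
  have "inj_on (\<lambda>l. (s ^^ l) i) {..<card (C i)}"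
    using distinct_support[OF perm, of i] unfolding distinct_map card_cyc[OF perm]
    by (simp add: atLeast0LessThan)
  moreover have "(\<lambda>l. (s ^^ l) i) ` {..<card (C i)} = C i"
    unfolding card_cyc[OF perm] by (auto simp: cyc_def)
  ultimately show ?thesis
    unfolding cycle_det_def by (metis (no_types, lifting) prod.reindex_cong)
qed

lemma special_cycle_iff: "special_cycle u i \<longleftrightarrow> cycle_det u i = 1"
  unfolding special_cycle_def cycle_det_def cyc_def
  using distinct_support[OF perm, of i] by (simp only: prod.distinct_set_conv_list)

text \<open>One full turn around the cycle returns to the nonzero entry at (i, i).\<close>

lemma lam_pow:
  assumes "i < N"
  shows "lam i ^ card (C i) = cycle_det u i"
proof -
  have "M i i * lam i ^ card (C i) = M i i * cycle_det u i"
    using row_pow[OF assms assms, of "card (C i)"]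
    unfolding funpow_card_cyc[OF perm] prod_funpow_eq_cycle_det .
  then show ?thesis
    using row_cyc_ne[OF assms cyc_self[OF perm]] by simp
qed

lemma cycle_det_eq: "i \<in> C c \<Longrightarrow> cycle_det u i = cycle_det u c"
  using cyc_eq[OF perm] by (simp add: cycle_det_def)

lemma norm_cycle_det: "c < N \<Longrightarrow> norm (cycle_det u c) = 1"
proof -
  assume c: "c < N"
  have "norm (cycle_det u c) = (\<Prod>j\<in>C c. norm (g j))"
    by (simp add: cycle_det_def prod_norm)
  also have "\<dots> = (\<Prod>j\<in>C c. 1)"
    using norm_g cyc_less[OF perm c] by (intro prod.cong) auto
  finally show ?thesis
    by simp
qed

text \<open>Two rows on one cycle with the same eigenvalue satisfy the same recursion, so they are
  proportional. Pairing both with column i of the inverse matrix contradicts this.\<close>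

lemma lam_inj:
  assumes c: "c < N"
  shows "inj_on lam (C c)"
proof (rule inj_onI, rule ccontr)
  fix i i' assume i: "i \<in> C c" and i': "i' \<in> C c" and eq: "lam i = lam i'" and ne: "i \<noteq> i'"
  have less: "i < N" "i' < N"
    using i i' c cyc_less[OF perm] by blast+
  have Ci: "C i = C c" "C i' = C c"
    using i i' cyc_eq[OF perm] by blast+
  have rows: "M i' i * M i j = M i i * M i' j" if j: "j < N" for j
  proof (cases "j \<in> C c")
    case True
    then obtain k where k: "j = (s ^^ k) i"
      using Ci unfolding cyc_range[OF perm] by blast
    have 1: "M i j * lam i ^ k = M i i * (\<Prod>l<k. g ((s ^^ l) i))"
      unfolding k by (rule row_pow[OF less(1) less(1)])
    have 2: "M i' j * lam i ^ k = M i' i * (\<Prod>l<k. g ((s ^^ l) i))"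
      unfolding k eq by (rule row_pow[OF less(2) less(1)])
    have "(M i' i * M i j) * lam i ^ k = M i' i * (M i j * lam i ^ k)"
      by (simp only: mult.assoc)
    also have "\<dots> = M i i * (M i' j * lam i ^ k)"
      unfolding 1 2 by (simp only: mult_ac)
    finally have "(M i' i * M i j) * lam i ^ k = (M i i * M i' j) * lam i ^ k"
      by (simp only: mult.assoc)
    then show ?thesis
      using lam_ne[OF less(1)] by simp
  next
    case False
    then have "M i j = 0" "M i' j = 0"
      using row_support less j Ci by blast+
    then show ?thesis
      by simp
  qed
  have "M i' i * (\<Sum>j<N. M i j * L j i) = (\<Sum>j<N. (M i' i * M i j) * L j i)"
    by (simp add: sum_distrib_left mult.assoc)
  also have "\<dots> = (\<Sum>j<N. (M i i * M i' j) * L j i)"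
    using rows by (intro sum.cong) auto
  also have "\<dots> = M i i * (\<Sum>j<N. M i' j * L j i)"
    by (simp add: sum_distrib_left mult.assoc)
  finally have "M i' i = 0"
    using coord_mult[OF less(1) less(1)] coord_mult[OF less(2) less(1)] ne by simp
  then show False
    using row_cyc_ne[OF less(2)] Ci i by simp
qed

text \<open>The eigenvalues are distinct roots of the determinant, and there are as many of them as
  there are roots.\<close>

lemma lam_image:
  assumes c: "c < N"
  shows "lam ` C c = {z. z ^ card (C c) = cycle_det u c}"
proof -
  have D: "cycle_det u c \<noteq> 0"
    using norm_cycle_det[OF c] by auto
  have card: "card {z. z ^ card (C c) = cycle_det u c} = card (C c)"
    using D card_cyc_pos[OF perm] by (rule card_nth_roots)
  show ?thesis
  proof (rule card_subset_eq)
    show "finite {z. z ^ card (C c) = cycle_det u c}"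
      using card card_cyc_pos[OF perm, of c] by (metis card.infinite less_irrefl)
    show "lam ` C c \<subseteq> {z. z ^ card (C c) = cycle_det u c}"
    proof
      fix z assume "z \<in> lam ` C c"
      then obtain i where i: "i \<in> C c" "z = lam i" by auto
      then show "z \<in> {z. z ^ card (C c) = cycle_det u c}"
        using lam_pow[OF cyc_less[OF perm c i(1)]] cycle_det_eq[OF i(1)] cyc_eq[OF perm i(1)] by simp
    qed
    show "card (lam ` C c) = card {z. z ^ card (C c) = cycle_det u c}"
      using card card_image[OF lam_inj[OF c]] by simp
  qed
qed

lemma card_eigval_one:
  assumes c: "c < N"
  shows "card {i \<in> C c. lam i = 1} = of_bool (cycle_det u c = 1)"
proof -
  have "card {i \<in> C c. lam i = 1} = card (lam ` {i \<in> C c. lam i = 1})"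
    by (rule card_image[symmetric], rule inj_on_subset[OF lam_inj[OF c]]) auto
  also have "lam ` {i \<in> C c. lam i = 1} = {z \<in> lam ` C c. z = 1}"
    by auto
  also have "\<dots> = (if cycle_det u c = 1 then {1} else {})"
    unfolding lam_image[OF c] by auto
  finally show ?thesis
    by simp
qed

lemma card_eigval_not_one:
  assumes c: "c < N"
  shows "real (card {i \<in> C c. lam i \<noteq> 1}) = real (card (C c)) - of_bool (cycle_det u c = 1)"
proof -
  have "{i \<in> C c. lam i \<noteq> 1} = C c - {i \<in> C c. lam i = 1}"
    by auto
  then have "card {i \<in> C c. lam i \<noteq> 1} = card (C c) - card {i \<in> C c. lam i = 1}"
    using finite_cyc[OF perm] by (simp add: card_Diff_subset)
  moreover have "card {i \<in> C c. lam i = 1} \<le> card (C c)"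
    using finite_cyc[OF perm] by (intro card_mono) auto
  ultimately show ?thesis
    using card_eigval_one[OF c] by (simp add: of_nat_diff)
qed

lemma sum_Arg2pi_cycle:
  assumes c: "c < N"
  shows "(\<Sum>i\<in>C c. Arg2pi (lam i)) = Arg2pi (cycle_det u c) + pi * (real (card (C c)) - 1)"
proof -
  have "(\<Sum>i\<in>C c. Arg2pi (lam i)) = (\<Sum>z\<in>lam ` C c. Arg2pi z)"
    by (simp add: sum.reindex[OF lam_inj[OF c]])
  then show ?thesis
    unfolding lam_image[OF c] using sum_Arg2pi_roots[OF norm_cycle_det[OF c] card_cyc_pos[OF perm]] by simp
qed

text \<open>Indices of eigencoordinates, not the points moved by the permutation: for a special
  cycle one index of the cycle is absent. The cardinality is the codimension of the fixed
  space.\<close>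

definition moved :: "nat set" where
  "moved = {i. i < N \<and> lam i \<noteq> 1}"

lemma card_moved_Int:
  assumes Y: "closed_under s Y"
  shows "real (card (moved \<inter> Y)) =
    (\<Sum>c\<in>cycle_reps s (Y \<inter> {..<N}). real (card (C c)) - of_bool (cycle_det u c = 1))"
proof -
  have cl: "closed_under s (Y \<inter> {..<N})"
    using Y closed_lessThan[OF perm] by (auto simp: closed_under_def)
  have "moved \<inter> Y = {i \<in> Y \<inter> {..<N}. lam i \<noteq> 1}"
    by (auto simp: moved_def)
  then have "real (card (moved \<inter> Y)) = (\<Sum>i\<in>Y \<inter> {..<N}. of_bool (lam i \<noteq> 1))"
    by (simp add: of_bool_def sum.If_cases Int_def)
  also have "\<dots> = (\<Sum>c\<in>cycle_reps s (Y \<inter> {..<N}). \<Sum>i\<in>C c. of_bool (lam i \<noteq> 1))"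
    by (rule sum_cycle_reps[OF perm cl]) simp
  also have "\<dots> = (\<Sum>c\<in>cycle_reps s (Y \<inter> {..<N}). real (card {i \<in> C c. lam i \<noteq> 1}))"
    using finite_cyc[OF perm] by (intro sum.cong) (simp_all add: of_bool_def sum.If_cases Int_def)
  also have "\<dots> = (\<Sum>c\<in>cycle_reps s (Y \<inter> {..<N}). real (card (C c)) - of_bool (cycle_det u c = 1))"
    by (intro sum.cong refl card_eigval_not_one) (auto simp: cycle_reps_def)
  finally show ?thesis .
qed

lemma lin_mat_similar:
  "similar_mat (lin_mat N u) (jordan_matrix (map (Pair 1) (map lam [0..<N])))"
proof (rule similar_jordan_diag[OF _ carriers mat_inverse])
  fix i l assume il: "i < N" "l < N"
  obtain j where j: "j < N" "l = s j"
    using s_onto[OF il(2)] by blast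
  have "(\<Sum>k<N. M i k * lin_mat N u $$ (k, l)) = (\<Sum>k<N. if k = j then M i k * g k else 0)"
    using il j permutes_inj[OF perm] by (intro sum.cong) (auto simp: lin_mat_def dest: injD)
  also have "\<dots> = lam i * M i l"
    using row_step[OF il(1) j(1)] j by (simp add: mult.commute)
  finally show "(\<Sum>k<N. M i k * lin_mat N u $$ (k, l)) = lam i * M i l" .
qed (simp add: lin_mat_def)

lemma age_eq: "age N u = (\<Sum>i<N. Arg2pi (lam i) / (2 * pi))"
  by (rule age_of_similar[OF lin_mat_similar])

text \<open>The hypotheses say that u' inverts u on the indices below N. The same eigencoordinates
  diagonalise u' with inverse eigenvalues, and the arguments of z and of its inverse add up to 2 pi
  unless z = 1.\<close>

lemma age_inverse:
  assumes "\<And>l. l < N \<Longrightarrow> fst u' (s l) = l" "\<And>l. l < N \<Longrightarrow> snd u' (s l) * g l = 1"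
    and "\<And>l. fst u' l < N \<longleftrightarrow> l < N"
  shows "age N u + age N u' = real (card moved)"
proof -
  have "similar_mat (lin_mat N u') (jordan_matrix (map (Pair 1) (map (\<lambda>i. inverse (lam i)) [0..<N])))"
  proof (rule similar_jordan_diag[OF _ carriers mat_inverse])
    fix i l assume il: "i < N" "l < N"
    have fst_u': "fst u' k = l \<longleftrightarrow> k = s l" if k: "k < N" for k
    proof -
      obtain k' where k': "k' < N" "k = s k'"
        using s_onto[OF k] by blast
      then have "fst u' k = k'"
        using assms(1)[OF k'(1)] by simp
      then show ?thesis
        unfolding k'(2) using injD[OF permutes_inj[OF perm]] by auto
    qed
    have "(\<Sum>k<N. M i k * lin_mat N u' $$ (k, l)) = (\<Sum>k<N. if k = s l then M i k * snd u' k else 0)"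
    proof (rule sum.cong[OF refl])
      fix k assume "k \<in> {..<N}"
      then show "M i k * lin_mat N u' $$ (k, l) = (if k = s l then M i k * snd u' k else 0)"
        using fst_u'[of k] il by (auto simp: lin_mat_def)
    qed
    also have "\<dots> = M i (s l) * snd u' (s l)"
      using il s_less by simp
    also have "\<dots> = inverse (lam i) * ((M i (s l) * lam i) * snd u' (s l))"
      using lam_ne[OF il(1)] by simp
    also have "\<dots> = inverse (lam i) * M i l"
      unfolding row_step[OF il] using assms(2)[OF il(2)] by (simp add: mult_ac)
    finally show "(\<Sum>k<N. M i k * lin_mat N u' $$ (k, l)) = inverse (lam i) * M i l" .
  qed (simp add: lin_mat_def)
  then have "age N u' = (\<Sum>i<N. Arg2pi (inverse (lam i)) / (2 * pi))"
    by (rule age_of_similar)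
  then have "age N u + age N u' = (\<Sum>i<N. (Arg2pi (lam i) + Arg2pi (inverse (lam i))) / (2 * pi))"
    unfolding age_eq by (simp add: sum.distrib add_divide_distrib)
  also have "\<dots> = (\<Sum>i<N. of_bool (lam i \<noteq> 1))"
  proof (rule sum.cong[OF refl])
    fix i assume "i \<in> {..<N}"
    then have i: "i < N" by simp
    have norm: "norm (lam i) = 1"
    proof -
      have "norm (lam i) ^ card (C i) = 1"
        unfolding norm_power[symmetric] lam_pow[OF i] by (rule norm_cycle_det[OF i])
      then show ?thesis
        using card_cyc_pos[OF perm, of i] power_eq_iff_eq_base[of "card (C i)" "norm (lam i)" 1] by simp
    qed
    have eq0: "Arg2pi (lam i) = 0 \<longleftrightarrow> lam i = 1"
      using cis_Arg2pi_eq[OF norm] Arg2pi_one by auto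
    have "Arg2pi (inverse (lam i)) = (if lam i = 1 then 0 else 2 * pi - Arg2pi (lam i))"
    proof (cases "lam i = 1")
      case False
      have "cis (2 * pi - Arg2pi (lam i)) = inverse (cis (Arg2pi (lam i)))"
        by (simp add: cis_divide[symmetric] divide_inverse)
      then have "inverse (lam i) = cis (2 * pi - Arg2pi (lam i))"
        unfolding cis_Arg2pi_eq[OF norm] by simp
      then show ?thesis
        using False eq0 Arg2pi_ge_0[of "lam i"] Arg2pi_lt_2pi[of "lam i"]
        by (auto simp: Arg2pi_cis_eq)
    qed (simp add: Arg2pi_one)
    then show "(Arg2pi (lam i) + Arg2pi (inverse (lam i))) / (2 * pi) = of_bool (lam i \<noteq> 1)"
      using eq0 by auto
  qed
  also have "\<dots> = real (card moved)"
    by (simp add: moved_def of_bool_def sum.If_cases Int_def)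
  finally show ?thesis .
qed

text \<open>A cycle of length k with determinant D contributes arg(D) / \<pi> + k - 1 to twice the
  age, and k or k - 1 to the codimension as D differs from 1 or not; so k cancels.\<close>

lemma age_eq_dets:
  "2 * age N u - real (card moved) =
    (\<Sum>c\<in>cycle_reps s {..<N}. if cycle_det u c = 1 then 0 else Arg2pi (cycle_det u c) / pi - 1)"
proof -
  have UNIV: "closed_under s UNIV"
    by (simp add: closed_under_def)
  have "2 * age N u = (\<Sum>i<N. Arg2pi (lam i) / pi)"
    unfolding age_eq sum_distrib_left by simp
  also have "\<dots> = (\<Sum>c\<in>cycle_reps s {..<N}. \<Sum>i\<in>C c. Arg2pi (lam i) / pi)"
    by (rule sum_cycle_reps[OF perm closed_lessThan[OF perm]]) simp
  also have "\<dots> = (\<Sum>c\<in>cycle_reps s {..<N}. Arg2pi (cycle_det u c) / pi + real (card (C c)) - 1)"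
  proof (rule sum.cong[OF refl])
    fix c assume "c \<in> cycle_reps s {..<N}"
    then have c: "c < N"
      by (auto simp: cycle_reps_def)
    have "(\<Sum>i\<in>C c. Arg2pi (lam i) / pi) = (Arg2pi (cycle_det u c) + pi * (real (card (C c)) - 1)) / pi"
      unfolding sum_Arg2pi_cycle[OF c, symmetric] by (simp add: sum_divide_distrib)
    then show "(\<Sum>i\<in>C c. Arg2pi (lam i) / pi) = Arg2pi (cycle_det u c) / pi + real (card (C c)) - 1"
      by (simp add: add_divide_distrib)
  qed
  finally have "2 * age N u - real (card moved) =
    (\<Sum>c\<in>cycle_reps s {..<N}. Arg2pi (cycle_det u c) / pi + real (card (C c)) - 1) -
    (\<Sum>c\<in>cycle_reps s {..<N}. real (card (C c)) - of_bool (cycle_det u c = 1))"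
    using card_moved_Int[OF UNIV] by simp
  also have "\<dots> = (\<Sum>c\<in>cycle_reps s {..<N}. if cycle_det u c = 1 then 0 else Arg2pi (cycle_det u c) / pi - 1)"
    unfolding sum_subtractf[symmetric]
  proof (rule sum.cong[OF refl])
    fix c
    show "Arg2pi (cycle_det u c) / pi + real (card (C c)) - 1 - (real (card (C c)) - of_bool (cycle_det u c = 1)) =
      (if cycle_det u c = 1 then 0 else Arg2pi (cycle_det u c) / pi - 1)"
      by (simp add: Arg2pi_one)
  qed
  finally show ?thesis .
qed

lemma evalp_Fix: "evalp (act u (X i) - X i) x = g i * x $ s i - x $ i"
  by (simp add: evalp_def act_simps evalp.insertion_simps)

lemma Fix_eq: "Fix N u = {x \<in> carrier_vec N. \<forall>i<N. g i * x $ s i = x $ i}"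
  by (simp add: Fix_def evalp_Fix)

text \<open>The fixed space is the kernel of \<open>lin_mat\<close> minus the identity, and its
  dimension is the number of eigenvalues equal to 1.\<close>

lemma Fix_codim_eq: "Fix_codim N u = card moved"
proof -
  let ?A = "char_matrix (lin_mat N u) 1"
  have P: "lin_mat N u \<in> carrier_mat N N"
    by (simp add: lin_mat_def)
  then have A: "?A \<in> carrier_mat N N"
    by simp
  have "Fix N u = mat_kernel ?A"
  proof (intro equalityI subsetI)
    have entry: "(?A *\<^sub>v x) $ i = g i * x $ s i - x $ i" if x: "x \<in> carrier_vec N" and i: "i < N" for x i
    proof -
      have "(?A *\<^sub>v x) $ i = (\<Sum>j<N. ?A $$ (i, j) * x $ j)"
        using A x i by (auto simp: scalar_prod_def atLeast0LessThan)
      also have "\<dots> = (\<Sum>j<N. (if j = s i then g i * x $ j else 0) - (if j = i then x $ j else 0))"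
        using i by (intro sum.cong) (auto simp: char_matrix_def lin_mat_def algebra_simps)
      also have "\<dots> = g i * x $ s i - x $ i"
        using i s_less by (simp add: sum_subtractf)
      finally show ?thesis .
    qed
    {
      fix x assume "x \<in> Fix N u"
      then have x: "x \<in> carrier_vec N" "\<And>i. i < N \<Longrightarrow> g i * x $ s i = x $ i"
        by (auto simp: Fix_eq)
      have "?A *\<^sub>v x = 0\<^sub>v N"
        using A entry[OF x(1)] x(2) by (intro eq_vecI) auto
      then show "x \<in> mat_kernel ?A"
        using A x(1) by (intro mat_kernelI)
    next
      fix x assume "x \<in> mat_kernel ?A"
      then have x: "x \<in> carrier_vec N" "?A *\<^sub>v x = 0\<^sub>v N"
        using mat_kernelD[OF A] by auto
      then show "x \<in> Fix N u"
        using entry[OF x(1)] by (simp add: Fix_eq)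
    }
  qed
  then have "Fix_dim N u = kernel_dim ?A"
    using A unfolding Fix_dim_def kernel_dim_def by simp
  also have "\<dots> = card {i. i < N \<and> lam i = 1}"
    by (rule kernel_dim_similar[OF lin_mat_similar P])
  finally have "Fix_codim N u = card ({..<N} - {i. i < N \<and> lam i = 1})"
    unfolding Fix_codim_def by (subst card_Diff_subset) auto
  also have "{..<N} - {i. i < N \<and> lam i = 1} = moved"
    by (auto simp: moved_def)
  finally show ?thesis .
qed

end

lemma hom_on_zero_Cst:
  assumes "hom_on UNIV 0 p"
  shows "\<exists>c. p = Cst c"
proof -
  have "Poly_Mapping.keys p \<subseteq> {0}"
  proof
    fix m assume m: "m \<in> Poly_Mapping.keys p"
    then have "deg_on UNIV m = 0"
      using assms by (simp add: hom_on_def)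
    then have "Poly_Mapping.keys m = {}"
      by (auto simp: deg_on_def in_keys_iff simp del: keys_eq_empty)
    then show "m \<in> {0}"
      by simp
  qed
  then have "p = Cst (Poly_Mapping.lookup p 0)"
    by (intro poly_mapping_eqI) (auto simp: Cst_def lookup_single when_def in_keys_iff)
  then show ?thesis
    by blast
qed

subsection \<open>Supports of products of generators\<close>

definition supp_in :: "nat set \<Rightarrow> ext \<Rightarrow> bool" where
  "supp_in A p \<longleftrightarrow> (\<forall>S. p S \<noteq> 0 \<longrightarrow> S \<subseteq> A \<and> finite S)"

lemma supp_in_mono: "supp_in A p \<Longrightarrow> A \<subseteq> B \<Longrightarrow> supp_in B p"
  by (auto simp: supp_in_def)

lemma supp_in_one: "supp_in A ext_one"
  by (auto simp: supp_in_def ext_one_def)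

lemma supp_in_gen: "supp_in {j} (ext_gen j)"
  by (auto simp: supp_in_def ext_gen_def)

lemma supp_in_wedge:
  assumes "supp_in A p" "supp_in B q"
  shows "supp_in (A \<union> B) (wedge p q)"
  unfolding supp_in_def
proof (intro allI impI)
  fix S assume nz: "wedge p q S \<noteq> 0"
  then have fin: "finite S"
    using wedge_infinite by blast
  from nz have "(\<Sum>T\<in>Pow S. shuffle_sign T (S - T) * p T * q (S - T)) \<noteq> 0"
    unfolding wedge_def .
  then obtain T where T: "T \<subseteq> S" "shuffle_sign T (S - T) * p T * q (S - T) \<noteq> 0"
    by (meson Pow_iff sum.not_neutral_contains_not_neutral)
  then have "p T \<noteq> 0" "q (S - T) \<noteq> 0"
    by auto
  then have "T \<subseteq> A" "S - T \<subseteq> B"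
    using assms by (auto simp: supp_in_def)
  then show "S \<subseteq> A \<union> B \<and> finite S"
    using fin by auto
qed

text \<open>With disjoint supports, the only splitting of the union that contributes is the one into
  S and T, so nothing can cancel.\<close>

lemma wedge_disjoint_nonzero:
  assumes "supp_in A p" "supp_in B q" "A \<inter> B = {}" "p S \<noteq> 0" "q T \<noteq> 0"
  shows "wedge p q (S \<union> T) \<noteq> 0"
proof -
  have S: "S \<subseteq> A" "finite S" and T: "T \<subseteq> B" "finite T"
    using assms by (auto simp: supp_in_def)
  let ?f = "\<lambda>R. shuffle_sign R (S \<union> T - R) * p R * q (S \<union> T - R)"
  have zero: "?f R = 0" if "R \<in> Pow (S \<union> T) - {S}" for R
  proof (rule ccontr)
    assume "\<not> ?thesis"
    then have "p R \<noteq> 0" "q (S \<union> T - R) \<noteq> 0"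
      by auto
    then have "R \<subseteq> A" "S \<union> T - R \<subseteq> B"
      using assms(1,2) by (auto simp: supp_in_def)
    then have "R \<subseteq> S" "S \<subseteq> R"
      using that S T assms(3) by blast+
    then have "R = S"
      by blast
    then show False
      using that by simp
  qed
  have "wedge p q (S \<union> T) = ?f S + (\<Sum>R\<in>Pow (S \<union> T) - {S}. ?f R)"
    unfolding wedge_def using S T by (intro sum.remove) auto
  also have "(\<Sum>R\<in>Pow (S \<union> T) - {S}. ?f R) = 0"
    by (intro sum.neutral ballI zero)
  finally have "wedge p q (S \<union> T) = shuffle_sign S (S \<union> T - S) * p S * q (S \<union> T - S)"
    by simp
  moreover have "S \<union> T - S = T"
    using S T assms(3) by auto
  moreover have "shuffle_sign S T \<noteq> 0"
    by (simp add: shuffle_sign_def)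
  ultimately show ?thesis
    using assms(4,5) by simp
qed

lemma supp_in_wedge_list:
  "(\<And>i. i \<in> set is \<Longrightarrow> supp_in (A i) (p i)) \<Longrightarrow> supp_in (\<Union>i\<in>set is. A i) (wedge_list (map p is))"
proof (induction "is")
  case (Cons i "is")
  then have "supp_in (A i \<union> (\<Union>i\<in>set is. A i)) (wedge (p i) (wedge_list (map p is)))"
    by (intro supp_in_wedge) simp_all
  then show ?case
    by (simp add: wedge_list_def)
qed (simp add: wedge_list_def supp_in_one)

lemma wedge_list_nonzero:
  assumes "\<And>i. i \<in> set is \<Longrightarrow> supp_in (A i) (p i)" "distinct is"
    and "\<And>i j. i \<in> set is \<Longrightarrow> j \<in> set is \<Longrightarrow> i \<noteq> j \<Longrightarrow> A i \<inter> A j = {}"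
    and "\<And>i. i \<in> set is \<Longrightarrow> p i (S i) \<noteq> 0"
  shows "wedge_list (map p is) (\<Union>i\<in>set is. S i) \<noteq> 0"
  using assms
proof (induction "is")
  case (Cons i "is")
  have "wedge (p i) (wedge_list (map p is)) (S i \<union> (\<Union>i\<in>set is. S i)) \<noteq> 0"
  proof (rule wedge_disjoint_nonzero)
    show "supp_in (A i) (p i)" "p i (S i) \<noteq> 0"
      using Cons.prems by simp_all
    show "supp_in (\<Union>i\<in>set is. A i) (wedge_list (map p is))"
      using Cons.prems by (intro supp_in_wedge_list) simp
    show "wedge_list (map p is) (\<Union>i\<in>set is. S i) \<noteq> 0"
      using Cons.prems by (intro Cons.IH) simp_all
    have "A i \<inter> A j = {}" if "j \<in> set is" for j
      using Cons.prems(2) that by (intro Cons.prems(3)) auto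
    then show "A i \<inter> (\<Union>i\<in>set is. A i) = {}"
      by blast
  qed
  then show ?case
    by (simp add: wedge_list_def)
qed (simp add: wedge_list_def ext_one_def)

lemma wedge_gens_nonzero: "distinct c \<Longrightarrow> wedge_list (map ext_gen c) (set c) \<noteq> 0"
  using wedge_list_nonzero[of c "\<lambda>i. {i}" ext_gen "\<lambda>i. {i}"] supp_in_gen by (simp add: ext_gen_def)

lemma supp_in_wedge_gens: "supp_in (set c) (wedge_list (map ext_gen c))"
  using supp_in_wedge_list[of c "\<lambda>i. {i}" ext_gen] supp_in_gen by simp

text \<open>The product is homogeneous for every value of \<alpha>. The values 1 and 2 give two
  expressions for the degree of one nonzero coefficient, and together they determine the number of
  generators.\<close>

lemma wedge_gens_support: "distinct c \<Longrightarrow> wedge_list (map ext_gen c) S \<noteq> 0 \<Longrightarrow> S = set c"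
proof -
  assume c: "distinct c" and nz: "wedge_list (map ext_gen c) S \<noteq> 0"
  have S: "S \<subseteq> set c" "finite S"
    using nz supp_in_wedge_gens[of c] by (auto simp: supp_in_def)
  have "wt_on UNIV 1 (\<Sum>i\<leftarrow>c. 1 * of_bool (i \<in> UNIV)) (wedge_list (map ext_gen c))"
    by (rule wt_on_wedge_list) (rule wt_on_gen)
  then have "wt_on UNIV 1 (real (length c)) (wedge_list (map ext_gen c))"
    by (simp add: sum_list_triv)
  from wt_onD[OF this S(2)] have "hom_on UNIV (real (length c) - real (card S)) (wedge_list (map ext_gen c) S)"
    by simp
  moreover have "wt_on UNIV 2 (\<Sum>i\<leftarrow>c. 2 * of_bool (i \<in> UNIV)) (wedge_list (map ext_gen c))"
    by (rule wt_on_wedge_list) (rule wt_on_gen)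
  then have "wt_on UNIV 2 (2 * real (length c)) (wedge_list (map ext_gen c))"
    by (simp add: sum_list_triv mult.commute)
  from wt_onD[OF this S(2)] have "hom_on UNIV (2 * real (length c) - 2 * real (card S)) (wedge_list (map ext_gen c) S)"
    by simp
  ultimately have "real (length c) - real (card S) = 2 * real (length c) - 2 * real (card S)"
    using hom_on_unique nz by blast
  then have "card S = card (set c)"
    using c by (simp add: distinct_card)
  then show "S = set c"
    using S by (intro card_subset_eq) simp_all
qed

lemma contract_supp_notin: "supp_in A p \<Longrightarrow> k \<notin> A \<Longrightarrow> contract k p S = 0"
proof (cases "k \<in> S")
  case False
  assume "supp_in A p" "k \<notin> A"
  then have "p (insert k S) = 0"
    by (auto simp: supp_in_def)
  then show ?thesis
    using False by (simp add: contract_notin)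
qed (simp add: contract_in)

lemma wedge_list_infinite: "infinite S \<Longrightarrow> wedge_list ps S = 0"
  by (cases ps) (auto simp: wedge_list_def ext_one_def wedge_infinite)

text \<open>The sign counts the m generators that the contraction passes.\<close>

lemma contract_wedge_gens:
  assumes "distinct c" "m < length c"
  shows "contract (c ! m) (wedge_list (map ext_gen c)) S =
    (-1) ^ m * wedge_list (map ext_gen (take m c @ drop (Suc m) c)) S"
  using assms
proof (induction c arbitrary: m S)
  case (Cons j c)
  let ?R = "wedge_list (map ext_gen c)"
  have gen: "contract i (ext_gen j) = (\<lambda>S. of_bool (i = j) * ext_one S)" for i
    by (rule ext) (simp add: contract_gen)
  have grade: "grade_sign (ext_gen j) = (\<lambda>S. - 1 * ext_gen j S)"
    by (rule ext) (simp add: grade_sign_gen)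
  have wl: "wedge_list (map ext_gen (j # c)) = wedge (ext_gen j) ?R"
    by (simp add: wedge_list_def)
  have neg: "wedge (\<lambda>S. - 1 * ext_gen j S) q S = - wedge (ext_gen j) q S" for q S
    using wedge_sum_left[of "\<lambda>_. - 1" "\<lambda>_. ext_gen j" "{()}" q S] by simp
  have step: "contract i (wedge_list (map ext_gen (j # c))) S =
      of_bool (i = j) * ?R S - wedge (ext_gen j) (contract i ?R) S" for i S
  proof -
    have "wedge (\<lambda>S. of_bool (i = j) * ext_one S) ?R S = of_bool (i = j) * wedge ext_one ?R S"
      using wedge_sum_left[of "\<lambda>_. of_bool (i = j)" "\<lambda>_. ext_one" "{()}" ?R S] by simp
    also have "wedge ext_one ?R S = ?R S"
      using wedge_list_infinite[of S "map ext_gen c"] by (simp add: wedge_ext_one)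
    finally show ?thesis
      unfolding wl contract_wedge gen grade neg by simp
  qed
  show ?case
  proof (cases m)
    case 0
    have "contract j ?R = (\<lambda>S. 0)"
      using Cons.prems contract_supp_notin[OF supp_in_wedge_gens, of j c] by (intro ext) simp
    then show ?thesis
      using step[of j S] by (simp add: 0 wedge_zero_right)
  next
    case (Suc m')
    then have m': "m' < length c" "c ! m' \<noteq> j" "distinct c"
      using Cons.prems by auto
    have IH: "contract (c ! m') ?R = (\<lambda>S. (-1) ^ m' * wedge_list (map ext_gen (take m' c @ drop (Suc m') c)) S)"
      using m' by (intro ext Cons.IH)
    have "contract ((j # c) ! m) (wedge_list (map ext_gen (j # c))) S =
        - wedge (ext_gen j) (contract (c ! m') ?R) S"
      using step[of "c ! m'" S] m' by (simp add: Suc)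
    also have "\<dots> = - ((-1) ^ m' * wedge (ext_gen j) (wedge_list (map ext_gen (take m' c @ drop (Suc m') c))) S)"
      unfolding IH wedge_scale_right ..
    also have "\<dots> = (-1) ^ m * wedge_list (map ext_gen (take m (j # c) @ drop (Suc m) (j # c))) S"
      by (simp add: Suc wedge_list_def)
    finally show ?thesis .
  qed
qed simp

lemma contract_t_wedge_list_zero:
  assumes "\<And>p. p \<in> set ps \<Longrightarrow> contract_t N E i p = (\<lambda>S. 0)"
  shows "contract_t N E i (wedge_list ps) = (\<lambda>S. 0)"
  using assms
proof (induction ps)
  case Nil
  have "contract j ext_one S = 0" for j S
    by (simp add: contract_def ext_one_def)
  then show ?case
    by (simp add: wedge_list_def contract_t_def fun_eq_iff)
next
  case (Cons p ps)
  have "contract_t N E i p = (\<lambda>S. 0)" "contract_t N E i (wedge_list ps) = (\<lambda>S. 0)"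
    using Cons by simp_all
  moreover have "wedge_list (p # ps) = wedge p (wedge_list ps)"
    by (simp add: wedge_list_def)
  ultimately show ?case
    by (intro ext) (simp only: contract_t_wedge wedge_zero_left wedge_zero_right add_0)
qed

subsection \<open>The elements \<open>d_theta\<close>\<close>

context eigen_elt
begin

text \<open>The indices on which \<open>d_factor\<close> lives. Their disjointness for different
  factors is what keeps the product \<open>d_theta\<close> nonzero.\<close>

definition factor_set :: "nat \<Rightarrow> nat set" where
  "factor_set i = (if s i \<noteq> i \<and> i = Min (C i) then C i
     else if diag_support N u \<noteq> {} \<and> i = Min (diag_support N u) then diag_support N u else {})"

lemma finite_diag: "finite (diag_support N u)"
  by (simp add: diag_support_def)

lemma cyc_fixed: "s i = i \<Longrightarrow> C i = {i}"
proof -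
  assume "s i = i"
  then have "(s ^^ k) i = i" for k
    by (induction k) simp_all
  then show ?thesis
    by (simp add: cyc_range[OF perm])
qed

lemma cyc_not_fixed: "s i \<noteq> i \<Longrightarrow> j \<in> C i \<Longrightarrow> s j \<noteq> j"
  using cyc_fixed[of j] cyc_eq[OF perm, of j i] cyc_self[OF perm, of i] by auto

lemma factor_set_disjoint:
  assumes "i \<noteq> j"
  shows "factor_set i \<inter> factor_set j = {}"
proof -
  have 1: "C i \<inter> C j = {}" if "i = Min (C i)" "j = Min (C j)"
  proof (rule ccontr)
    assume "C i \<inter> C j \<noteq> {}"
    then obtain k where "k \<in> C i" "k \<in> C j"
      by auto
    then have "C i = C j"
      using cyc_eq[OF perm] by blast
    then have "Min (C i) = Min (C j)"
      by simp
    then show False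
      using that assms by simp
  qed
  have 2: "C i \<inter> diag_support N u = {}" if "s i \<noteq> i" for i
    using cyc_not_fixed[OF that] by (auto simp: diag_support_def)
  show ?thesis
    unfolding factor_set_def using 1 2[of i] 2[of j] assms by (auto simp del: Min_gr_iff)
qed

lemma d_cycle_cases:
  shows "special_cycle u i \<Longrightarrow> d_cycle u i = (\<lambda>S. \<Sum>m<card (C i).
      Cst ((-1) ^ m * (\<Prod>l<m. g ((s ^^ l) i))) *
      wedge_list (map ext_gen (take m (support s i) @ drop (Suc m) (support s i))) S)"
    and "\<not> special_cycle u i \<Longrightarrow> d_cycle u i = wedge_list (map ext_gen (support s i))"
proof -
  have "(\<Prod>j\<leftarrow>take m (support s i). g j) = (\<Prod>l<m. g ((s ^^ l) i))" if "m < card (C i)" for m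
  proof -
    have "take m (support s i) = map (\<lambda>l. (s ^^ l) i) [0..<m]"
      using that unfolding card_cyc[OF perm] by (simp add: take_map)
    then have "(\<Prod>j\<leftarrow>take m (support s i). g j) = (\<Prod>l\<leftarrow>[0..<m]. g ((s ^^ l) i))"
      by (simp only: map_map o_def)
    then show ?thesis
      by (simp add: prod.distinct_set_conv_list[symmetric] atLeast0LessThan)
  qed
  then show "special_cycle u i \<Longrightarrow> d_cycle u i = (\<lambda>S. \<Sum>m<card (C i).
      Cst ((-1) ^ m * (\<Prod>l<m. g ((s ^^ l) i))) *
      wedge_list (map ext_gen (take m (support s i) @ drop (Suc m) (support s i))) S)"
    unfolding d_cycle_def Let_def card_cyc[OF perm] by (intro ext) (simp cong: sum.cong_simp)
  show "\<not> special_cycle u i \<Longrightarrow> d_cycle u i = wedge_list (map ext_gen (support s i))"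
    unfolding d_cycle_def Let_def by simp
qed

lemma set_hat_list:
  assumes "distinct c" "m < length c"
  shows "set (take m c @ drop (Suc m) c) = set c - {c ! m}"
proof -
  have c: "c = take m c @ c ! m # drop (Suc m) c"
    using assms(2) by (rule id_take_nth_drop)
  have "distinct (take m c @ c ! m # drop (Suc m) c)"
    using assms c by simp
  moreover have "set c = set (take m c) \<union> insert (c ! m) (set (drop (Suc m) c))"
    by (subst c) (simp only: set_append list.set)
  ultimately show ?thesis
    by auto
qed

lemma distinct_hat_list: "distinct c \<Longrightarrow> distinct (take m c @ drop (Suc m) c)"
  using set_take_disj_set_drop_if_distinct[of c m "Suc m"] by simp

lemma wt_on_d_cycle:
  assumes Y: "closed_under s Y"
  shows "wt_on Y \<alpha> (\<alpha> * of_bool (i \<in> Y) * (real (card (C i)) - of_bool (cycle_det u i = 1))) (d_cycle u i)"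
proof -
  let ?c = "support s i"
  have gens: "wt_on Y \<alpha> (\<alpha> * of_bool (i \<in> Y) * real (length l)) (wedge_list (map ext_gen l))"
    if "set l \<subseteq> C i" for l
  proof -
    have "wt_on Y \<alpha> (\<Sum>j\<leftarrow>l. \<alpha> * of_bool (j \<in> Y)) (wedge_list (map ext_gen l))"
      by (rule wt_on_wedge_list) (rule wt_on_gen)
    moreover have "(\<Sum>j\<leftarrow>l. \<alpha> * of_bool (j \<in> Y)) = (\<Sum>j\<leftarrow>l. \<alpha> * of_bool (i \<in> Y))"
      using that cyc_closed[OF perm Y] by (intro arg_cong[where f = sum_list] map_cong) auto
    ultimately show ?thesis
      by (simp add: sum_list_triv mult_ac)
  qed
  have len: "length ?c = card (C i)"
    unfolding card_cyc[OF perm] by simp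
  have set: "set ?c = C i"
    by (simp only: cyc_def)
  show ?thesis
  proof (cases "special_cycle u i")
    case True
    have "wt_on Y \<alpha> (\<alpha> * of_bool (i \<in> Y) * (real (card (C i)) - 1))
        (\<lambda>S. Cst a * wedge_list (map ext_gen (take m ?c @ drop (Suc m) ?c)) S)"
      if m: "m < card (C i)" for m a
    proof (rule wt_on_Cst_mult)
      have "set (take m ?c @ drop (Suc m) ?c) \<subseteq> C i"
        using set set_take_subset[of m ?c] set_drop_subset[of "Suc m" ?c] by auto
      moreover have "real (length (take m ?c @ drop (Suc m) ?c)) = real (card (C i)) - 1"
        using m len by simp
      ultimately show "wt_on Y \<alpha> (\<alpha> * of_bool (i \<in> Y) * (real (card (C i)) - 1))
          (wedge_list (map ext_gen (take m ?c @ drop (Suc m) ?c)))"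
        using gens by metis
    qed
    then show ?thesis
      unfolding d_cycle_cases(1)[OF True] using True special_cycle_iff
      by (auto intro!: wt_on_sum)
  next
    case False
    then show ?thesis
      unfolding d_cycle_cases(2)[OF False] using gens[of ?c] len set special_cycle_iff by simp
  qed
qed

lemma supp_in_d_cycle: "supp_in (C i) (d_cycle u i)"
proof (cases "special_cycle u i")
  case True
  let ?c = "support s i"
  have "S \<subseteq> C i \<and> finite S" if nz: "d_cycle u i S \<noteq> 0" for S
  proof -
    obtain m where m: "wedge_list (map ext_gen (take m ?c @ drop (Suc m) ?c)) S \<noteq> 0"
      using nz unfolding d_cycle_cases(1)[OF True]
      by (metis (no_types, lifting) mult_zero_right sum.neutral)
    then have "S = set (take m ?c @ drop (Suc m) ?c)"
      using wedge_gens_support distinct_hat_list distinct_support[OF perm] by blast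
    then show ?thesis
      using set_take_subset[of m ?c] set_drop_subset[of "Suc m" ?c] by (auto simp: cyc_def)
  qed
  then show ?thesis
    by (simp add: supp_in_def)
next
  case False
  then show ?thesis
    unfolding d_cycle_cases(2)[OF False] using supp_in_wedge_gens[of "support s i"] by (simp only: cyc_def)
qed

text \<open>For a special cycle, only the summand m = 0 omits the first index, so its monomial meets
  no other summand.\<close>

lemma d_cycle_nonzero: "\<exists>S. d_cycle u i S \<noteq> 0"
proof (cases "special_cycle u i")
  case True
  let ?c = "support s i"
  let ?S = "set (take 0 ?c @ drop (Suc 0) ?c)"
  have dist: "distinct ?c"
    by (rule distinct_support[OF perm])
  have len: "length ?c = card (C i)"
    by (simp add: card_cyc[OF perm])
  have rest: "Cst a * wedge_list (map ext_gen (take m ?c @ drop (Suc m) ?c)) ?S = 0"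
    if m: "m < card (C i)" "m \<noteq> 0" for m a
  proof (rule ccontr)
    assume "\<not> ?thesis"
    then have "?S = set (take m ?c @ drop (Suc m) ?c)"
      using wedge_gens_support[OF distinct_hat_list[OF dist]] by auto
    then have "set ?c - {?c ! 0} = set ?c - {?c ! m}"
      using m len card_cyc_pos[OF perm, of i] by (simp only: set_hat_list[OF dist])
    moreover have "?c ! 0 \<in> set ?c" "?c ! m \<in> set ?c"
      using m len card_cyc_pos[OF perm, of i] by (simp_all only: nth_mem)
    ultimately have "?c ! 0 = ?c ! m"
      by blast
    then show False
      using m len nth_eq_iff_index_eq[OF dist, of 0 m] by simp
  qed
  let ?f = "\<lambda>m. Cst ((-1) ^ m * (\<Prod>l<m. g ((s ^^ l) i))) *
      wedge_list (map ext_gen (take m ?c @ drop (Suc m) ?c)) ?S"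
  have "d_cycle u i ?S = ?f 0 + (\<Sum>m\<in>{..<card (C i)} - {0}. ?f m)"
    unfolding d_cycle_cases(1)[OF True] using card_cyc_pos[OF perm, of i] by (intro sum.remove) simp_all
  also have "(\<Sum>m\<in>{..<card (C i)} - {0}. ?f m) = 0"
    by (intro sum.neutral ballI rest) simp_all
  finally have "d_cycle u i ?S = Cst 1 * wedge_list (map ext_gen (take 0 ?c @ drop (Suc 0) ?c)) ?S"
    by (simp only: power_0 lessThan_0 prod.empty mult_1_left add_0_right)
  moreover have "wedge_list (map ext_gen (take 0 ?c @ drop (Suc 0) ?c)) ?S \<noteq> 0"
    by (rule wedge_gens_nonzero[OF distinct_hat_list[OF dist]])
  ultimately have "d_cycle u i ?S \<noteq> 0"
    by (simp only: Cst_one mult_1_left not_False_eq_True)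
  then show ?thesis
    by blast
next
  case False
  then show ?thesis
    unfolding d_cycle_cases(2)[OF False] using wedge_gens_nonzero[OF distinct_support[OF perm]] by blast
qed

lemma d_factor_cases:
  obtains "s i \<noteq> i" "i = Min (C i)" "d_factor N u i = d_cycle u i" "factor_set i = C i"
  | "s i = i" "i \<in> diag_support N u" "i = Min (diag_support N u)"
    "d_factor N u i = wedge_list (map ext_gen (sorted_list_of_set (diag_support N u)))"
    "factor_set i = diag_support N u"
  | "\<not> (s i \<noteq> i \<and> i = Min (C i))" "\<not> (diag_support N u \<noteq> {} \<and> i = Min (diag_support N u))"
    "d_factor N u i = ext_one" "factor_set i = {}"
proof (cases "s i \<noteq> i \<and> i = Min (C i)")
  case True
  then show ?thesis
    using that(1) by (simp add: d_factor_def factor_set_def cyc_def)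
next
  case F: False
  show ?thesis
  proof (cases "diag_support N u \<noteq> {} \<and> i = Min (diag_support N u)")
    case True
    then have i: "i \<in> diag_support N u"
      using Min_in[OF finite_diag] by simp
    then show ?thesis
      using F True that(2) by (simp add: d_factor_def factor_set_def diag_support_def)
  next
    case False
    then show ?thesis
      using F that(3) unfolding d_factor_def factor_set_def cyc_def by presburger
  qed
qed

lemma supp_in_d_factor: "supp_in (factor_set i) (d_factor N u i)"
proof (cases rule: d_factor_cases[of i])
  case 1
  then show ?thesis
    using supp_in_d_cycle by simp
next
  case 2
  then show ?thesis
    using supp_in_wedge_gens[of "sorted_list_of_set (diag_support N u)"] finite_diag by simp
qed (simp add: supp_in_one)

lemma d_factor_nonzero: "\<exists>S. d_factor N u i S \<noteq> 0"
proof (cases rule: d_factor_cases[of i])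
  case 1
  then show ?thesis
    using d_cycle_nonzero by simp
next
  case 2
  then show ?thesis
    using wedge_gens_nonzero[of "sorted_list_of_set (diag_support N u)"] by auto
next
  case 3
  then show ?thesis
    by (intro exI[of _ "{}"]) (simp add: ext_one_def)
qed

lemma d_theta_nonzero: "\<exists>S. d_theta N u S \<noteq> 0"
proof -
  obtain S where "\<And>i. d_factor N u i (S i) \<noteq> 0"
    using d_factor_nonzero by metis
  then have "wedge_list (map (d_factor N u) [0..<N]) (\<Union>i\<in>set [0..<N]. S i) \<noteq> 0"
    using supp_in_d_factor factor_set_disjoint by (intro wedge_list_nonzero[of _ factor_set]) simp_all
  then show ?thesis
    unfolding d_theta_def by blast
qed

lemma factor_set_less: "i < N \<Longrightarrow> factor_set i \<subseteq> {..<N}"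
proof (cases rule: d_factor_cases[of i])
  case 1
  assume "i < N"
  then show ?thesis
    unfolding 1(4) using cyc_less[OF perm] by blast
next
  case 2
  then show ?thesis
    unfolding 2(5) by (auto simp: diag_support_def)
next
  case 3
  then show ?thesis
    unfolding 3(4) by blast
qed

lemma ext_in_d_theta: "ext_in N (d_theta N u)"
proof -
  have "supp_in (\<Union>i\<in>set [0..<N]. factor_set i) (d_theta N u)"
    unfolding d_theta_def by (rule supp_in_wedge_list) (rule supp_in_d_factor)
  then have "supp_in {..<N} (d_theta N u)"
    by (rule supp_in_mono) (intro UN_least factor_set_less, simp)
  then show ?thesis
    by (auto simp: supp_in_def ext_in_def)
qed

text \<open>Along a row with eigenvalue 1 the entries are M i j times the partial products of g,
  which are the coefficients in \<open>d_cycle\<close>. So \<open>d_cycle\<close> is, up to the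
  nonzero constant M i j, the contraction of the full product of generators by the invariant
  \<open>thetat\<close>, and contracting a second time gives zero.\<close>

lemma contract_t_d_cycle:
  assumes "i < N" "lam i = 1" "j \<in> C i"
  shows "contract_t N E i (d_cycle u j) = (\<lambda>S. 0)"
proof -
  let ?c = "support s j"
  have Cj: "C j = C i"
    using assms(3) cyc_eq[OF perm] by blast
  have j: "j < N"
    using cyc_less[OF perm assms(1,3)] .
  have "cycle_det u j = 1"
    using lam_pow[OF assms(1)] assms(2) cycle_det_eq[OF assms(3)] by simp
  then have special: "special_cycle u j"
    by (simp add: special_cycle_iff)
  have Mij: "M i j \<noteq> 0"
    by (rule row_cyc_ne[OF assms(1,3)])
  have len: "length ?c = card (C j)"
    unfolding card_cyc[OF perm] by simp
  have dist: "distinct ?c"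
    by (rule distinct_support[OF perm])
  have set: "set ?c = C j"
    by (simp only: cyc_def)
  have "contract_t N E i (wedge_list (map ext_gen ?c)) S = Cst (M i j) * d_cycle u j S" for S
  proof -
    let ?f = "\<lambda>k. Cst (M i k) * contract k (wedge_list (map ext_gen ?c)) S"
    have "contract_t N E i (wedge_list (map ext_gen ?c)) S = (\<Sum>k\<in>C j. ?f k)"
      unfolding contract_t_def
    proof (rule sum.mono_neutral_right)
      show "C j \<subseteq> {..<N}"
        using cyc_less[OF perm j] by auto
      show "\<forall>k\<in>{..<N} - C j. ?f k = 0"
        using row_support[OF assms(1)] Cj by (metis Cst_zero Diff_iff lessThan_iff mult_zero_left)
    qed simp
    also have "\<dots> = (\<Sum>m<card (C j). ?f (?c ! m))"
    proof (rule sum.reindex_bij_betw[symmetric])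
      show "bij_betw ((!) ?c) {..<card (C j)} (C j)"
        by (rule bij_betw_nth[OF dist]) (simp_all only: len set)
    qed
    also have "\<dots> = (\<Sum>m<card (C j). Cst (M i j) * (Cst ((-1) ^ m * (\<Prod>l<m. g ((s ^^ l) j))) *
        wedge_list (map ext_gen (take m ?c @ drop (Suc m) ?c)) S))"
    proof (rule sum.cong[OF refl])
      fix m assume "m \<in> {..<card (C j)}"
      then have m: "m < length ?c"
        using len by simp
      then have "?c ! m = (s ^^ m) j"
        by simp
      then have "M i (?c ! m) = M i j * (\<Prod>l<m. g ((s ^^ l) j))"
        using row_pow[OF assms(1) j, of m] assms(2) by simp
      then have "?f (?c ! m) = Cst (M i j * (\<Prod>l<m. g ((s ^^ l) j))) *
          ((-1) ^ m * wedge_list (map ext_gen (take m ?c @ drop (Suc m) ?c)) S)"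
        unfolding contract_wedge_gens[OF dist m] by (simp only:)
      also have "(-1 :: mpoly) ^ m = Cst ((-1) ^ m)"
        by (simp add: Cst_power Cst_uminus)
      finally show "?f (?c ! m) = Cst (M i j) * (Cst ((-1) ^ m * (\<Prod>l<m. g ((s ^^ l) j))) *
        wedge_list (map ext_gen (take m ?c @ drop (Suc m) ?c)) S)"
        by (simp only: Cst_mult mult_ac)
    qed
    also have "\<dots> = Cst (M i j) * d_cycle u j S"
      unfolding d_cycle_cases(1)[OF special] by (rule sum_distrib_left[symmetric])
    finally show ?thesis .
  qed
  then have "Cst (1 / M i j) * contract_t N E i (wedge_list (map ext_gen ?c)) S = d_cycle u j S" for S
    using Mij by (simp only: mult.assoc[symmetric] Cst_mult[symmetric]) simp
  then have "d_cycle u j = (\<lambda>S. \<Sum>a\<in>{()}. Cst (1 / M i j) * contract_t N E i (wedge_list (map ext_gen ?c)) S)"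
    by (intro ext) simp
  then show ?thesis
    by (intro ext) (simp only: contract_t_sum contract_t_twice mult_zero_right sum.neutral_const)
qed

text \<open>By the Leibniz rule it suffices to treat single factors. A factor that avoids the cycle
  of i is killed because row i is supported on that cycle.\<close>

lemma contract_t_d_theta:
  assumes i: "i < N" "lam i = 1"
  shows "contract_t N E i (d_theta N u) = (\<lambda>S. 0)"
  unfolding d_theta_def
proof (rule contract_t_wedge_list_zero)
  fix p assume "p \<in> set (map (d_factor N u) [0..<N])"
  then obtain j where p: "p = d_factor N u j"
    by auto
  have disj: "contract_t N E i q = (\<lambda>S. 0)" if q: "supp_in A q" "A \<inter> C i = {}" for q A
  proof
    fix S
    have "Cst (M i k) * contract k q S = 0" if "k < N" for k
    proof (cases "k \<in> C i")
      case True
      then have "contract k q S = 0"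
        using q by (intro contract_supp_notin[OF q(1)]) auto
      then show ?thesis
        by simp
    next
      case False
      then have "M i k = 0"
        using row_support[OF i(1) that] by blast
      then show ?thesis
        by simp
    qed
    then show "contract_t N E i q S = 0"
      unfolding contract_t_def by (intro sum.neutral ballI) blast
  qed
  show "contract_t N E i p = (\<lambda>S. 0)"
  proof (cases "factor_set j \<inter> C i = {}")
    case True
    then show ?thesis
      unfolding p using disj[OF supp_in_d_factor] by blast
  next
    case False
    then obtain k where k: "k \<in> factor_set j" "k \<in> C i"
      by auto
    show ?thesis
    proof (cases rule: d_factor_cases[of j])
      case 1
      then have "C j = C i"
        using k cyc_eq[OF perm] by (metis (no_types))
      then have "j \<in> C i"
        using cyc_self[OF perm, of j] by simp
      then show ?thesis
        unfolding p 1(3) by (rule contract_t_d_cycle[OF i])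
    next
      case 2
      then have k': "s k = k" "g k \<noteq> 1" "k < N"
        using k(1) by (auto simp: diag_support_def)
      \<comment> \<open>A fixed index has its scalar as eigenvalue, so eigenvalue 1 contradicts
        membership in \<open>diag_support\<close>.\<close>
      then have "i = k"
        using cyc_fixed[of k] cyc_eq[OF perm k(2)] cyc_self[OF perm, of i] by auto
      then have "M i i = M i i * g i"
        using row_step[OF i(1) i(1)] i(2) k'(1) by simp
      then show ?thesis
        using row_cyc_ne[OF i(1) cyc_self[OF perm]] k'(2) \<open>i = k\<close> by simp
    next
      case 3
      then show ?thesis
        using k by simp
    qed
  qed
qed

lemma card_sum_of_bool: "finite A \<Longrightarrow> real (card (A \<inter> Y)) = (\<Sum>i\<in>A. of_bool (i \<in> Y))"
  by (simp add: of_bool_def sum.If_cases Int_def)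

lemma wt_on_d_theta:
  assumes Y: "closed_under s Y"
  shows "wt_on Y \<alpha> (\<alpha> * real (card (moved \<inter> Y))) (d_theta N u)"
proof -
  let ?t = "\<lambda>i. of_bool (i \<in> Y) * (real (card (C i)) - of_bool (cycle_det u i = 1))"
  let ?D = "diag_support N u"
  \<comment> \<open>A nontrivial cycle is charged to its smallest index, and the diagonal part, as
    one block, to its own. The block is later spread over the fixed points: each is a cycle of
    length 1 whose determinant is its scalar.\<close>
  define k where "k i = (if s i \<noteq> i \<and> i = Min (C i) then ?t i else 0) +
    (if ?D \<noteq> {} \<and> i = Min ?D then real (card (?D \<inter> Y)) else 0)" for i
  have "wt_on Y \<alpha> (\<alpha> * k i) (d_factor N u i)" for i
  proof (cases rule: d_factor_cases[of i])
    case 1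
    have notD: "\<not> (?D \<noteq> {} \<and> i = Min ?D)"
    proof
      assume "?D \<noteq> {} \<and> i = Min ?D"
      then have "i \<in> ?D"
        using Min_in[OF finite_diag] by blast
      then show False
        using 1(1) by (simp add: diag_support_def)
    qed
    have "k i = ?t i + 0"
      unfolding k_def if_P[OF conjI[OF 1(1,2)]] if_not_P[OF notD] ..
    then show ?thesis
      using wt_on_d_cycle[OF Y, of \<alpha> i] 1(3) by (simp only: mult.assoc add_0_right)
  next
    case 2
    have "wt_on Y \<alpha> (\<Sum>j\<leftarrow>sorted_list_of_set ?D. \<alpha> * of_bool (j \<in> Y)) (d_factor N u i)"
      unfolding 2(4) by (rule wt_on_wedge_list) (rule wt_on_gen)
    moreover have "(\<Sum>j\<leftarrow>sorted_list_of_set ?D. \<alpha> * of_bool (j \<in> Y)) = (\<Sum>j\<in>?D. \<alpha> * of_bool (j \<in> Y))"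
      by (subst sum_list_distinct_conv_sum_set)
        (simp_all only: distinct_sorted_list_of_set set_sorted_list_of_set[OF finite_diag])
    moreover have "(\<Sum>j\<in>?D. \<alpha> * of_bool (j \<in> Y)) = \<alpha> * k i"
      unfolding sum_distrib_left[symmetric] card_sum_of_bool[OF finite_diag, symmetric]
      using 2 by (auto simp: k_def)
    ultimately show ?thesis
      by simp
  next
    case 3
    then show ?thesis
      using wt_on_one by (auto simp: k_def)
  qed
  then have "wt_on Y \<alpha> (\<Sum>i\<leftarrow>[0..<N]. \<alpha> * k i) (d_theta N u)"
    unfolding d_theta_def by (intro wt_on_wedge_list)
  moreover have "(\<Sum>i\<leftarrow>[0..<N]. \<alpha> * k i) = \<alpha> * (\<Sum>i<N. k i)"
    by (simp add: sum.distinct_set_conv_list[symmetric] sum_distrib_left atLeast0LessThan)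
  moreover have "(\<Sum>i<N. k i) = real (card (moved \<inter> Y))"
  proof -
    have 1: "(\<Sum>i<N. if ?D \<noteq> {} \<and> i = Min ?D then real (card (?D \<inter> Y)) else 0) = real (card (?D \<inter> Y))"
    proof (cases "?D = {}")
      case False
      then have "Min ?D < N"
        using Min_in[OF finite_diag False] by (auto simp: diag_support_def)
      then show ?thesis
        using False by simp
    qed simp
    have "real (card (?D \<inter> Y)) = (\<Sum>i<N. if s i = i then ?t i else 0)"
    proof -
      have "?D \<inter> Y = {i \<in> {..<N}. s i = i \<and> g i \<noteq> 1 \<and> i \<in> Y}"
        by (auto simp: diag_support_def)
      then have "real (card (?D \<inter> Y)) = (\<Sum>i<N. of_bool (s i = i \<and> g i \<noteq> 1 \<and> i \<in> Y))"
        by (simp add: of_bool_def sum.If_cases Int_def)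
      also have "\<dots> = (\<Sum>i<N. if s i = i then ?t i else 0)"
        using cyc_fixed by (intro sum.cong) (auto simp: cycle_det_def)
      finally show ?thesis .
    qed
    then have "(\<Sum>i<N. k i) = (\<Sum>i<N. (if s i \<noteq> i \<and> i = Min (C i) then ?t i else 0) + (if s i = i then ?t i else 0))"
      unfolding k_def sum.distrib 1 by simp
    also have "\<dots> = (\<Sum>i<N. if Min (C i) = i \<and> i \<in> Y then real (card (C i)) - of_bool (cycle_det u i = 1) else 0)"
      using cyc_fixed by (intro sum.cong) auto
    also have "\<dots> = (\<Sum>i\<in>cycle_reps s (Y \<inter> {..<N}). real (card (C i)) - of_bool (cycle_det u i = 1))"
      by (rule sum.mono_neutral_cong_right) (auto simp: cycle_reps_def)
    also have "\<dots> = real (card (moved \<inter> Y))"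
      by (rule card_moved_Int[OF Y, symmetric])
    finally show ?thesis .
  qed
  ultimately show ?thesis
    by simp
qed

lemma finite_moved: "finite moved"
  by (simp add: moved_def)

lemma row_closed:
  assumes "closed_under s Y" "i < N" "j < N" "M i j \<noteq> 0"
  shows "j \<in> Y \<longleftrightarrow> i \<in> Y"
  using cyc_closed[OF perm assms(1) row_support[OF assms(2,3,4)]] .

text \<open>Some coefficient is nonzero by nondegeneracy. Contraction by an index with eigenvalue 1
  kills \<open>d_theta\<close>, so the index set in question lies in \<open>moved\<close>, and the
  number of generators leaves only \<open>moved\<close> itself.\<close>

lemma coeff_t_d_theta:
  "\<exists>\<kappa>. \<kappa> \<noteq> 0 \<and> coeff_t N E (sorted_list_of_set moved) (d_theta N u) = Cst \<kappa>"
proof -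
  have UNIV: "closed_under s UNIV"
    by (simp add: closed_under_def)
  have support: "card S = card moved" if S: "finite S" "d_theta N u S \<noteq> 0" for S
  proof -
    have "hom_on UNIV (\<alpha> * real (card moved) - \<alpha> * real (card S)) (d_theta N u S)" for \<alpha>
      using wt_onD[OF wt_on_d_theta[OF UNIV, of \<alpha>] S(1)] by simp
    \<comment> \<open>Two values of \<alpha> again determine the number of generators.\<close>
    from hom_on_unique[OF this[of 1] this[of 2] S(2)] show ?thesis
      by simp
  qed
  obtain I where I: "I \<subseteq> {..<N}" "coeff_t N E (sorted_list_of_set I) (d_theta N u) \<noteq> 0"
    using coeff_t_nondegenerate[OF ext_in_d_theta] d_theta_nonzero by metis
  have fin: "finite I"
    using I(1) finite_subset by blast
  have "I \<subseteq> moved"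
  proof
    fix i assume i: "i \<in> I"
    show "i \<in> moved"
    proof (rule ccontr)
      assume "i \<notin> moved"
      then have "contract_t N E i (d_theta N u) = (\<lambda>S. 0)"
        using i I(1) by (intro contract_t_d_theta) (auto simp: moved_def)
      then have "fold (contract_t N E) (sorted_list_of_set I) (d_theta N u) = (\<lambda>S. 0)"
        using i fin by (intro fold_contract_t_killed) simp_all
      then show False
        using I(2) by (simp add: coeff_t_def)
    qed
  qed
  moreover have "card I = card moved"
  proof (rule ccontr)
    assume "card I \<noteq> card moved"
    then have "coeff_t N E (sorted_list_of_set I) (d_theta N u) = 0"
    proof (intro coeff_t_graded)
      fix S :: "nat set" assume "finite S" "card S = length (sorted_list_of_set I)"
      then show "d_theta N u S = 0"
        using support[of S] \<open>card I \<noteq> card moved\<close> by (cases "d_theta N u S = 0") simp_all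
    qed
    then show False
      using I(2) by simp
  qed
  ultimately have "I = moved"
    using finite_moved by (intro card_subset_eq)
  then have nz: "coeff_t N E (sorted_list_of_set moved) (d_theta N u) \<noteq> 0"
    using I(2) by simp
  \<comment> \<open>With \<alpha> = 0 the weight is the polynomial degree alone, so degree 0 makes
    the coefficient a constant.\<close>
  have "hom_on UNIV (0 * real (card (moved \<inter> UNIV)) - 0 * real (card (set (sorted_list_of_set moved) \<inter> UNIV)))
      (coeff_t N E (sorted_list_of_set moved) (d_theta N u))"
    by (rule hom_on_coeff_t[OF _ _ wt_on_d_theta[OF UNIV]]) simp_all
  then have "hom_on UNIV 0 (coeff_t N E (sorted_list_of_set moved) (d_theta N u))"
    by simp
  then obtain \<kappa> where \<kappa>: "coeff_t N E (sorted_list_of_set moved) (d_theta N u) = Cst \<kappa>"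
    using hom_on_zero_Cst by blast
  then show ?thesis
    using nz by (intro exI[of _ \<kappa>]) auto
qed

end

subsection \<open>Homogeneity of \<open>H_fu\<close> and \<open>xi_tilde\<close>\<close>

lemma hom_on_subst_polys:
  assumes "p \<in> polys N" "\<And>i. i < N \<Longrightarrow> hom_on Y (of_bool (i \<in> Y)) (s i)" "hom_on Y k p"
  shows "hom_on Y k (subst s p)"
proof -
  have "subst s p = subst (\<lambda>i. if i < N then s i else X i) p"
    unfolding insertion_def using assms(1)
    by (intro sum.cong prod.cong arg_cong2[where f = "(*)"] refl) (auto simp: polys_def)
  moreover have "hom_on Y k \<dots>"
    using assms(2) hom_on_X by (intro hom_on_subst assms(3)) simp
  ultimately show ?thesis
    by simp
qed

text \<open>The two substitutions differ only in coordinate i, so the denominator divides their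
  difference. The quotient is unique because polynomials form a domain, and its degree comes from
  \<open>hom_on_quotient\<close>.\<close>

lemma nabla_hom:
  assumes "i < N" "xt N E i - y i \<noteq> 0" "hom_on Y l (xt N E i - y i)"
    and "hom_on Y k (subst_xt N E (\<lambda>k. if k < i then y k else xt N E k) p -
        subst_xt N E (\<lambda>k. if k \<le> i then y k else xt N E k) p)"
  shows "hom_on Y (k - l) (nabla N E y i p)"
proof -
  let ?h = "xt N E i - y i"
  let ?y1 = "\<lambda>k. if k < i then y k else xt N E k" and ?y2 = "\<lambda>k. if k \<le> i then y k else xt N E k"
  let ?R = "subst_xt N E ?y1 p - subst_xt N E ?y2 p"
  have "?h dvd ?R"
    unfolding subst_xt_def
  proof (rule subst_dvd_diff)
    fix j
    have "(\<Sum>k<N. Cst (coord_inv E $$ (j, k)) * ?y1 k) - (\<Sum>k<N. Cst (coord_inv E $$ (j, k)) * ?y2 k) =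
      (\<Sum>k<N. if k = i then Cst (coord_inv E $$ (j, i)) * ?h else 0)"
      unfolding sum_subtractf[symmetric]
    proof (rule sum.cong[OF refl])
      fix k
      show "Cst (coord_inv E $$ (j, k)) * ?y1 k - Cst (coord_inv E $$ (j, k)) * ?y2 k =
          (if k = i then Cst (coord_inv E $$ (j, i)) * ?h else 0)"
        by (cases k i rule: linorder_cases) (simp_all add: right_diff_distrib)
    qed
    also have "\<dots> = Cst (coord_inv E $$ (j, i)) * ?h"
      using assms(1) by simp
    finally show "?h dvd (\<Sum>k<N. Cst (coord_inv E $$ (j, k)) * ?y1 k) - (\<Sum>k<N. Cst (coord_inv E $$ (j, k)) * ?y2 k)"
      by (simp only: dvd_triv_right)
  qed
  then obtain q where q: "?R = ?h * q"
    by (rule dvdE)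
  have "nabla N E y i p = q"
    unfolding nabla_def q
  proof (rule the_equality)
    fix q' assume "q' * ?h = ?h * q"
    then have "?h * q' = ?h * q"
      by (simp only: mult.commute)
    then show "q' = q"
      using mult_left_cancel[OF assms(2)] by blast
  qed (rule mult.commute)
  moreover have "hom_on Y (k - l) q"
    using assms(4) unfolding q by (intro hom_on_quotient[OF _ assms(3,2)]) (simp only: mult.commute)
  ultimately show ?thesis
    by simp
qed

context eigen_elt
begin

text \<open>Column k of the inverse, cut off outside the cycle of k, still solves M x = e_k because
  M has block form. The solution is unique, so nothing was cut off.\<close>

lemma inv_support:
  assumes j: "j < N" and k: "k < N" and nz: "L j k \<noteq> 0"
  shows "j \<in> C k"
proof (rule ccontr)
  assume notin: "j \<notin> C k"
  have entry: "(\<Sum>l<N. M i l * (if l \<in> C k then L l k else 0)) = of_bool (i = k)" if i: "i < N" for i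
  proof (cases "i \<in> C k")
    case True
    then have Ci: "C i = C k"
      by (rule cyc_eq[OF perm])
    have "(\<Sum>l<N. M i l * (if l \<in> C k then L l k else 0)) = (\<Sum>l<N. M i l * L l k)"
    proof (rule sum.cong[OF refl])
      fix l assume "l \<in> {..<N}"
      then have "M i l = 0" if "l \<notin> C k"
        using row_support[OF i, of l] that Ci by auto
      then show "M i l * (if l \<in> C k then L l k else 0) = M i l * L l k"
        by auto
    qed
    then show ?thesis
      using coord_mult[OF i k] by simp
  next
    case False
    have zero: "M i l * (if l \<in> C k then L l k else 0) = 0" if l: "l < N" for l
    proof (cases "l \<in> C k")
      case True
      then have "C l = C k"
        by (rule cyc_eq[OF perm])
      then have "l \<notin> C i"
        using False cyc_eq[OF perm, of l i] cyc_self[OF perm, of i] by auto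
      then have "M i l = 0"
        using row_support[OF i l] by blast
      then show ?thesis
        by simp
    qed simp
    have "(\<Sum>l<N. M i l * (if l \<in> C k then L l k else 0)) = 0"
      by (intro sum.neutral ballI zero) simp
    moreover have "i \<noteq> k"
      using False cyc_self[OF perm] by blast
    ultimately show ?thesis
      by simp
  qed
  have "(\<Sum>i<N. L j i * (\<Sum>l<N. M i l * (if l \<in> C k then L l k else 0))) =
      (\<Sum>l<N. (\<Sum>i<N. L j i * M i l) * (if l \<in> C k then L l k else 0))"
    unfolding sum_distrib_left sum_distrib_right by (subst sum.swap) (simp only: mult.assoc)
  also have "\<dots> = (\<Sum>l<N. of_bool (j = l) * (if l \<in> C k then L l k else 0))"
    using inv_mult[OF j] by (intro sum.cong) auto
  also have "\<dots> = 0"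
    using notin by (intro sum.neutral) auto
  finally have "(\<Sum>i<N. L j i * of_bool (i = k)) = 0"
    using entry by simp
  then show False
    using nz k by simp
qed

lemma xt_ne: "i < N \<Longrightarrow> xt N E i \<noteq> 0"
proof
  assume i: "i < N" and 0: "xt N E i = 0"
  have "Poly_Mapping.lookup (xt N E i) (Poly_Mapping.single i 1) = M i i"
    unfolding xt_def lookup_linear_form using i by simp
  then show False
    using row_cyc_ne[OF i cyc_self[OF perm]] 0 by simp
qed

context
  fixes Y :: "nat set"
  assumes Y: "closed_under s Y"
begin

lemma hom_on_xt:
  assumes i: "i < N"
  shows "hom_on Y (of_bool (i \<in> Y)) (xt N E i)"
  unfolding xt_def
proof (rule hom_on_sum)
  fix j assume "j \<in> {..<N}"
  then show "hom_on Y (of_bool (i \<in> Y)) (Cst (M i j) * X j)"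
    using row_closed[OF Y i, of j] hom_on_Cst_mult[OF hom_on_X[of Y j], of "M i j"]
    by (cases "M i j = 0") auto
qed

lemma hom_on_inverse_coordinate:
  assumes "j < N" "\<And>k. k < N \<Longrightarrow> hom_on Y (of_bool (k \<in> Y)) (y k)"
  shows "hom_on Y (of_bool (j \<in> Y)) (\<Sum>k<N. Cst (L j k) * y k)"
proof (rule hom_on_sum)
  fix k assume "k \<in> {..<N}"
  then have k: "k < N" by simp
  show "hom_on Y (of_bool (j \<in> Y)) (Cst (L j k) * y k)"
  proof (cases "L j k = 0")
    case False
    then have "j \<in> Y \<longleftrightarrow> k \<in> Y"
      by (intro cyc_closed[OF perm Y] inv_support assms(1) k)
    then show ?thesis
      using hom_on_Cst_mult[OF assms(2)[OF k], of "L j k"] by simp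
  qed simp
qed

lemma act_xt_eq: "i < N \<Longrightarrow> act u (xt N E i) = Cst (lam i) * xt N E i"
  using eig by (simp add: eigencoordinates_def)

text \<open>Although f is not homogeneous in the variables of Y, this quotient is. Changing
  coordinate i affects only the powers of variables in the cycle of i (\<open>inv_support\<close>),
  and these lie in Y all together or not at all.\<close>

lemma nabla_fermat:
  assumes i: "i < N" "lam i \<noteq> 1"
  shows "hom_on Y ((real n - 1) * of_bool (i \<in> Y)) (nabla N E (\<lambda>k. act u (xt N E k)) i (fermat N n))"
proof -
  let ?y = "\<lambda>k. act u (xt N E k)"
  have h: "xt N E i - ?y i = Cst (1 - lam i) * xt N E i"
    using i act_xt_eq by (simp add: Cst_diff left_diff_distrib)
  let ?y1 = "\<lambda>k. if k < i then ?y k else xt N E k" and ?y2 = "\<lambda>k. if k \<le> i then ?y k else xt N E k"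
  let ?A = "\<lambda>y j. \<Sum>k<N. Cst (L j k) * y k"
  have fermat: "subst_xt N E y (fermat N n) = (\<Sum>j<N. ?A y j ^ n)" for y
    by (simp add: subst_xt_def fermat_def subst.insertion_simps)
  have y: "hom_on Y (of_bool (k \<in> Y)) (?y k)" if "k < N" for k
    using that act_xt_eq[OF that] hom_on_Cst_mult[OF hom_on_xt[OF that]] by simp
  have A: "hom_on Y (of_bool (j \<in> Y)) (?A ?y1 j)" "hom_on Y (of_bool (j \<in> Y)) (?A ?y2 j)" if "j < N" for j
    by (rule hom_on_inverse_coordinate[OF that]; use y hom_on_xt in simp)+
  have "hom_on Y (real n * of_bool (i \<in> Y)) (?A ?y1 j ^ n - ?A ?y2 j ^ n)" if j: "j < N" for j
  proof (cases "L j i = 0")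
    case True
    have "?A ?y1 j = ?A ?y2 j"
    proof (rule sum.cong[OF refl])
      fix k
      show "Cst (L j k) * ?y1 k = Cst (L j k) * ?y2 k"
        using True by (cases "k = i") auto
    qed
    then show ?thesis
      by simp
  next
    case False
    then have "j \<in> Y \<longleftrightarrow> i \<in> Y"
      by (intro cyc_closed[OF perm Y] inv_support j i(1))
    then have eq: "real n * of_bool (i \<in> Y) = real n * (of_bool (j \<in> Y) :: real)"
      by simp
    show ?thesis
      unfolding eq by (intro hom_on_diff hom_on_power A j)
  qed
  then have R: "hom_on Y (real n * of_bool (i \<in> Y))
      (subst_xt N E ?y1 (fermat N n) - subst_xt N E ?y2 (fermat N n))"
    unfolding fermat sum_subtractf[symmetric] by (intro hom_on_sum) simp
  have "hom_on Y (real n * of_bool (i \<in> Y) - of_bool (i \<in> Y)) (nabla N E ?y i (fermat N n))"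
  proof (rule nabla_hom[OF i(1) _ _ R])
    show "xt N E i - ?y i \<noteq> 0"
      unfolding h using i xt_ne by simp
    show "hom_on Y (of_bool (i \<in> Y)) (xt N E i - ?y i)"
      unfolding h by (rule hom_on_Cst_mult[OF hom_on_xt[OF i(1)]])
  qed
  then show ?thesis
    by (simp add: left_diff_distrib)
qed

end

lemma nabla_nabla_fermat:
  assumes Y: "closed_under s Y" and i: "i < N" "lam i \<noteq> 1" and j: "j < N" "lam j \<noteq> 1"
  shows "hom_on Y ((real n - 1) * of_bool (i \<in> Y) - of_bool (j \<in> Y))
    (nabla N E (\<lambda>k. if lam k = 1 then xt N E k else 0) j (nabla N E (\<lambda>k. act u (xt N E k)) i (fermat N n)))"
proof -
  let ?y = "\<lambda>k. if lam k = 1 then xt N E k else 0"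
  let ?q = "nabla N E (\<lambda>k. act u (xt N E k)) i (fermat N n)"
  have y: "hom_on Y (of_bool (k \<in> Y)) (?y k)" if "k < N" for k
    using hom_on_xt[OF Y that] by simp
  \<comment> \<open>The preceding lemma, applied to this set, shows that the inner quotient involves
    only the first N variables. The outer substitution controls just these.\<close>
  have "closed_under s {N..}"
    using closed_under_Compl[OF closed_lessThan[OF perm]] by (simp add: Compl_lessThan)
  then have "?q \<in> polys N"
    using nabla_fermat[of "{N..}" i n] i by (simp add: polys_iff_hom_on)
  then have sub: "hom_on Y ((real n - 1) * of_bool (i \<in> Y)) (subst_xt N E z ?q)"
    if "\<And>k. k < N \<Longrightarrow> hom_on Y (of_bool (k \<in> Y)) (z k)" for z
    unfolding subst_xt_def using that
    by (intro hom_on_subst_polys[of _ N] hom_on_inverse_coordinate nabla_fermat Y i)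
  show ?thesis
  proof (rule nabla_hom[OF j(1)])
    show "xt N E j - ?y j \<noteq> 0"
      using j xt_ne by simp
    show "hom_on Y (of_bool (j \<in> Y)) (xt N E j - ?y j)"
      using j hom_on_xt[OF Y] by simp
    show "hom_on Y ((real n - 1) * of_bool (i \<in> Y))
      (subst_xt N E (\<lambda>k. if k < j then ?y k else xt N E k) ?q -
       subst_xt N E (\<lambda>k. if k \<le> j then ?y k else xt N E k) ?q)"
      using hom_on_xt[OF Y] y by (intro hom_on_diff sub) simp_all
  qed
qed

lemma wt_on_thetat:
  assumes Y: "closed_under s Y" and i: "i < N"
  shows "wt_on Y \<beta> (\<beta> * of_bool (i \<in> Y)) (thetat N E i)"
  unfolding thetat_def[abs_def]
proof (rule wt_on_sum)
  fix j assume "j \<in> {..<N}"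
  then show "wt_on Y \<beta> (\<beta> * of_bool (i \<in> Y)) (\<lambda>S. Cst (M i j) * ext_gen j S)"
    using row_closed[OF Y i, of j] wt_on_Cst_mult[OF wt_on_gen[of Y \<beta> j], of "M i j"]
    by (cases "M i j = 0") (auto simp: wt_on_def)
qed

lemma wt_on_H_fu:
  assumes Y: "closed_under s Y"
  shows "wt_on Y (- ((real n - 2) / 2)) 0 (H_fu N n E u)"
  unfolding H_fu_def[abs_def]
proof (intro wt_on_sum)
  fix i j assume "i \<in> {..<N}" "j \<in> {..<i}"
  then have less: "i < N" "j < N"
    by auto
  let ?\<beta> = "- ((real n - 2) / 2)"
  let ?p = "nabla N E (\<lambda>k. if lam k = 1 then xt N E k else 0) j (nabla N E (\<lambda>k. act u (xt N E k)) i (fermat N n))"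
  let ?w = "wedge (thetat N E j) (thetat N E i)"
  show "wt_on Y ?\<beta> 0 (\<lambda>S. if lam i \<noteq> 1 \<and> lam j \<noteq> 1 then Cst (1 / (1 - lam j)) * ?p * ?w S else 0)"
  proof (cases "lam i \<noteq> 1 \<and> lam j \<noteq> 1")
    case True
    have p: "hom_on Z ((real n - 1) * of_bool (i \<in> Z) - of_bool (j \<in> Z)) ?p" if "closed_under s Z" for Z
      using True less that by (intro nabla_nabla_fermat) auto
    have w: "wt_on Y ?\<beta> (?\<beta> * of_bool (j \<in> Y) + ?\<beta> * of_bool (i \<in> Y)) ?w"
      by (intro wt_on_wedge wt_on_thetat Y less)
    have "wt_on Y ?\<beta> 0 (\<lambda>S. Cst (1 / (1 - lam j)) * ?p * ?w S)"
    proof (cases "i \<in> Y \<longleftrightarrow> j \<in> Y")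
      case True
      have "wt_on Y ?\<beta> (((real n - 1) * of_bool (i \<in> Y) - of_bool (j \<in> Y)) +
          (?\<beta> * of_bool (j \<in> Y) + ?\<beta> * of_bool (i \<in> Y))) (\<lambda>S. (Cst (1 / (1 - lam j)) * ?p) * ?w S)"
        by (intro wt_on_mult w hom_on_Cst_mult p Y)
      moreover have "((real n - 1) * of_bool (i \<in> Y) - of_bool (j \<in> Y)) +
          (?\<beta> * of_bool (j \<in> Y) + ?\<beta> * of_bool (i \<in> Y)) = 0"
        using True by (cases "j \<in> Y") (simp_all add: field_simps)
      ultimately show ?thesis
        by simp
    next
      case False
      \<comment> \<open>The degree is -1 on Y if j lies in Y, and -1 on the complement
        otherwise.\<close>
      have "?p = 0"
      proof (cases "j \<in> Y")
        case True
        then show ?thesis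
          using False p[OF Y] hom_on_neg[of Y "-1" ?p] by simp
      next
        case jY: False
        then show ?thesis
          using False p[OF closed_under_Compl[OF Y]] hom_on_neg[of "- Y" "-1" ?p] by simp
      qed
      then show ?thesis
        by (simp add: wt_on_def)
    qed
    then show ?thesis
      using True by simp
  qed (auto simp: wt_on_def)
qed

lemma wt_on_xi_tilde:
  assumes Y: "closed_under s Y"
  shows "wt_on Y ((real n - 2) / 2) ((real n - 2) / 2 * real (card (moved \<inter> Y))) (xi_tilde N n E u)"
  using wt_on_theta_act[OF wt_on_ext_exp[OF wt_on_H_fu[OF Y]] wt_on_d_theta[OF Y]]
  unfolding xi_tilde_def by simp

lemma ext_in_xi_tilde: "ext_in N (xi_tilde N n E u)"
  unfolding xi_tilde_def by (rule ext_in_theta_act[OF ext_in_d_theta])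

lemma H_fu_empty: "H_fu N n E u {} = 0"
proof -
  have "wedge (thetat N E j) (thetat N E i) {} = 0" for i j
    by (simp add: wedge_def thetat_def ext_gen_def)
  then show ?thesis
    unfolding H_fu_def by (intro sum.neutral ballI) (simp only: mult_zero_right if_cancel)
qed

lemma ext_exp_empty: "p {} = 0 \<Longrightarrow> ext_exp N p {} = 1"
proof -
  assume p: "p {} = 0"
  have pow: "(wedge p ^^ k) ext_one {} = (if k = 0 then 1 else 0)" for k
    by (cases k) (simp_all add: ext_one_def wedge_def p)
  have "ext_exp N p {} = (\<Sum>k\<le>N. if k = 0 then 1 else 0)"
    unfolding ext_exp_def pow by (intro sum.cong) auto
  then show ?thesis
    by simp
qed

text \<open>The constant term of the exponential is 1, and every other term contracts at least once.
  So \<open>xi_tilde\<close> and \<open>d_theta\<close> agree in the components with as many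
  generators as \<open>moved\<close> has elements.\<close>

lemma coeff_t_xi_tilde:
  "\<exists>\<kappa>. \<kappa> \<noteq> 0 \<and> coeff_t N E (sorted_list_of_set moved) (xi_tilde N n E u) = Cst \<kappa>"
proof -
  let ?l = "sorted_list_of_set moved"
  have UNIV: "closed_under s UNIV"
    by (simp add: closed_under_def)
  have supp: "contract_set A (d_theta N u) S = 0"
    if "A \<noteq> {}" "A \<subseteq> {..<N}" "finite S" "card S = card moved" for A S
  proof (rule ccontr)
    assume nz: "contract_set A (d_theta N u) S \<noteq> 0"
    have finA: "finite A"
      using that(2) finite_subset by blast
    have "hom_on UNIV (\<alpha> * real (card moved) - \<alpha> * real (card A) - \<alpha> * real (card S))
        (contract_set A (d_theta N u) S)" for \<alpha>
      using wt_onD[OF wt_on_contract_set[OF wt_on_d_theta[OF UNIV, of \<alpha>] finA] that(3)] by simp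
    from hom_on_unique[OF this[of 1] this[of 2] nz] have "card A = 0"
      using that(4) by simp
    then show False
      using that(1) finA by simp
  qed
  have "xi_tilde N n E u S - d_theta N u S = 0" if S: "finite S" "card S = length ?l" for S
  proof -
    let ?f = "\<lambda>A. ext_exp N (H_fu N n E u) A * contract_set A (d_theta N u) S"
    have "xi_tilde N n E u S = ?f {} + (\<Sum>A\<in>Pow {..<N} - {{}}. ?f A)"
      unfolding xi_tilde_def theta_act_def by (intro sum.remove) auto
    also have "(\<Sum>A\<in>Pow {..<N} - {{}}. ?f A) = 0"
    proof (intro sum.neutral ballI)
      fix A assume "A \<in> Pow {..<N} - {{}}"
      then have "contract_set A (d_theta N u) S = 0"
        using S by (intro supp) simp_all
      then show "?f A = 0"
        by simp
    qed
    finally show ?thesis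
      by (simp add: ext_exp_empty H_fu_empty contract_set_def)
  qed
  then have "coeff_t N E ?l (\<lambda>S. xi_tilde N n E u S - d_theta N u S) = 0"
    by (intro coeff_t_graded)
  then have "coeff_t N E ?l (xi_tilde N n E u) = coeff_t N E ?l (d_theta N u)"
    unfolding coeff_t_diff by simp
  then show ?thesis
    using coeff_t_d_theta by simp
qed

lemma hom_on_xi_coeff:
  assumes Y: "closed_under s Y" and Z: "ext_in N Z" "wt_on Y ((real n - 2) / 2) k Z"
  shows "hom_on Y (k - (real n - 2) / 2 * real (card (moved \<inter> Y))) (xi_coeff N n E u Z)"
proof -
  obtain \<kappa> where \<kappa>: "\<kappa> \<noteq> 0" "coeff_t N E (sorted_list_of_set moved) (xi_tilde N n E u) = Cst \<kappa>"
    using coeff_t_xi_tilde by blast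
  have sub: "moved \<subseteq> {..<N}"
    by (auto simp: moved_def)
  have "xi_coeff N n E u Z = Cst (1 / \<kappa>) * coeff_t N E (sorted_list_of_set moved) Z"
    unfolding xi_coeff_def moved_def[symmetric]
    by (rule replaced_basis_coeff[OF sub ext_in_xi_tilde \<kappa>(2,1) Z(1)])
  moreover have "hom_on Y (k - (real n - 2) / 2 * real (card (set (sorted_list_of_set moved) \<inter> Y)))
      (coeff_t N E (sorted_list_of_set moved) Z)"
  proof (rule hom_on_coeff_t[OF _ _ Z(2)])
    fix i j assume "i \<in> set (sorted_list_of_set moved)" "j < N" "M i j \<noteq> 0"
    then show "j \<in> Y \<longleftrightarrow> i \<in> Y"
      using finite_moved sub by (intro row_closed[OF Y]) auto
  qed simp
  ultimately show ?thesis
    using finite_moved by (simp add: hom_on_Cst_mult)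
qed

end

unbundle no vec_syntax

subsection \<open>The symmetry group\<close>

lemma X_power: "X i ^ k = Poly_Mapping.single (Poly_Mapping.single i k) 1"
  by (induction k) (simp_all add: X_def mult_single single_add[symmetric])

lemma Gfd_iff:
  assumes "n \<ge> 1"
  shows "h \<in> Gfd N n \<longleftrightarrow> (\<forall>k\<ge>N. h k = 1) \<and> (\<forall>k<N. h k ^ n = 1)"
proof -
  have eq: "subst (\<lambda>k. Cst (h k) * X k) (fermat N n) = (\<Sum>i<N. Cst (h i ^ n) * X i ^ n)"
    by (simp add: fermat_def subst.insertion_simps power_mult_distrib Cst_power)
  have "h k ^ n = 1" if k: "k < N" and sub: "(\<Sum>i<N. Cst (h i ^ n) * X i ^ n) = fermat N n" for k
  proof -
    have inj: "Poly_Mapping.single i n = Poly_Mapping.single k n \<longleftrightarrow> i = k" for i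
    proof
      assume "Poly_Mapping.single i n = Poly_Mapping.single k n"
      then have "Poly_Mapping.lookup (Poly_Mapping.single i n) k = n"
        by simp
      then show "i = k"
        using assms by (simp add: lookup_single when_def split: if_splits)
    qed simp
    have "Poly_Mapping.lookup (\<Sum>i<N. Cst (a i) * X i ^ n) (Poly_Mapping.single k n) = a k" for a
      using k by (simp add: lookup_sum lookup_Cst_mult X_power lookup_single when_def inj
          if_distrib[of "(*) _"] cong: if_cong)
    from this[of "\<lambda>i. h i ^ n"] this[of "\<lambda>i. 1"] show ?thesis
      unfolding sub by (simp add: fermat_def)
  qed
  moreover have "(\<Sum>i<N. Cst (h i ^ n) * X i ^ n) = fermat N n" if "\<forall>k<N. h k ^ n = 1"
    using that by (simp add: fermat_def)
  ultimately show ?thesis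
    unfolding Gfd_def mem_Collect_eq eq by blast
qed

lemma group_Gf:
  assumes n: "n \<ge> 1"
  shows "group (Gf N n)"
proof (rule groupI)
  fix x y assume xy: "x \<in> carrier (Gf N n)" "y \<in> carrier (Gf N n)"
  obtain t h s g where eqs: "x = (t, h)" "y = (s, g)"
    by (metis surj_pair)
  have s: "s permutes {..<N}" and t: "t permutes {..<N}"
    using xy by (simp_all add: eqs Gf_def)
  have "s k < N \<longleftrightarrow> k < N" for k
    using permutes_in_image[OF s, of k] by simp
  then have "N \<le> s k \<longleftrightarrow> N \<le> k" for k
    by (simp flip: not_less)
  moreover note \<open>\<And>k. s k < N \<longleftrightarrow> k < N\<close>
  ultimately have "(\<lambda>k. h (s k) * g k) \<in> Gfd N n"
    using xy by (simp add: eqs Gf_def Gfd_iff[OF n] power_mult_distrib)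
  then show "x \<otimes>\<^bsub>Gf N n\<^esub> y \<in> carrier (Gf N n)"
    using permutes_compose[OF s t] by (simp add: eqs Gf_def)
next
  show "\<one>\<^bsub>Gf N n\<^esub> \<in> carrier (Gf N n)"
    by (simp add: Gf_def Gfd_iff[OF n] permutes_id)
next
  fix x assume "x \<in> carrier (Gf N n)"
  then obtain s g where x: "x = (s, g)" "s permutes {..<N}" "g \<in> Gfd N n"
    by (auto simp: Gf_def)
  let ?t = "inv_into UNIV s"
  have t: "?t permutes {..<N}"
    using x(2) by (rule permutes_inv)
  have ts: "?t (s k) = k" for k
    using permutes_inverses(2)[OF x(2)] .
  have g: "g k \<noteq> 0" for k
  proof (cases "k < N")
    case True
    then have "g k ^ n = 1"
      using x(3) by (simp add: Gfd_iff[OF n])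
    then show ?thesis
      using n by (auto simp: power_0_left)
  next
    case False
    then show ?thesis
      using x(3) by (simp add: Gfd_iff[OF n])
  qed
  have "(\<lambda>k. inverse (g (?t k))) \<in> Gfd N n"
    using x(3) t permutes_in_image[OF t] permutes_not_in[OF t]
    by (auto simp: Gfd_iff[OF n] power_inverse)
  then have "(?t, \<lambda>k. inverse (g (?t k))) \<in> carrier (Gf N n)"
    using t by (simp add: Gf_def)
  moreover have "(?t, \<lambda>k. inverse (g (?t k))) \<otimes>\<^bsub>Gf N n\<^esub> x = \<one>\<^bsub>Gf N n\<^esub>"
    using g by (simp add: Gf_def x(1) ts fun_eq_iff)
  ultimately show "\<exists>y\<in>carrier (Gf N n). y \<otimes>\<^bsub>Gf N n\<^esub> x = \<one>\<^bsub>Gf N n\<^esub>"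
    by blast
qed (auto simp: Gf_def fun_eq_iff)

lemma Gf_carrierD:
  assumes "u \<in> carrier (Gf N n)" "n \<ge> 1"
  shows "fst u permutes {..<N}" "k < N \<Longrightarrow> snd u k ^ n = 1" "k < N \<Longrightarrow> norm (snd u k) = 1"
proof -
  show "fst u permutes {..<N}"
    using assms(1) by (auto simp: Gf_def)
  show *: "snd u k ^ n = 1" if "k < N"
    using assms that by (auto simp: Gf_def Gfd_iff)
  show "norm (snd u k) = 1" if "k < N"
  proof -
    have "norm (snd u k) ^ n = 1"
      using *[OF that] by (simp flip: norm_power)
    then show ?thesis
      using power_eq_iff_eq_base[of n "norm (snd u k)" 1] assms(2) by simp
  qed
qed

lemma fst_Gf_mult: "fst (u \<otimes>\<^bsub>Gf N n\<^esub> v) = fst u \<circ> fst v"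
  and snd_Gf_mult: "snd (u \<otimes>\<^bsub>Gf N n\<^esub> v) k = snd u (fst v k) * snd v k"
  by (simp_all add: Gf_def split: prod.splits)

subsection \<open>Rings of polynomial functions\<close>

lemma polys_closed:
  "0 \<in> polys N" "1 \<in> polys N" "Cst c \<in> polys N" "p \<in> polys N \<Longrightarrow> q \<in> polys N \<Longrightarrow> p + q \<in> polys N"
  "p \<in> polys N \<Longrightarrow> - p \<in> polys N" "p \<in> polys N \<Longrightarrow> q \<in> polys N \<Longrightarrow> p - q \<in> polys N"
  "p \<in> polys N \<Longrightarrow> q \<in> polys N \<Longrightarrow> p * q \<in> polys N" "p \<in> polys N \<Longrightarrow> p ^ k \<in> polys N"
  "i < N \<Longrightarrow> X i \<in> polys N"
  unfolding polys_iff_hom_on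
  using hom_on_mult[of "{N..}" 0 p 0 q] hom_on_power[of "{N..}" 0 p k] hom_on_X[of "{N..}" i]
  by (auto intro: hom_on_zero hom_on_one hom_on_Cst hom_on_add hom_on_uminus hom_on_diff)

lemma polys_sum: "(\<And>a. a \<in> A \<Longrightarrow> f a \<in> polys N) \<Longrightarrow> sum f A \<in> polys N"
  by (induction A rule: infinite_finite_induct) (auto intro: polys_closed)

lemma polys_prod: "(\<And>a. a \<in> A \<Longrightarrow> f a \<in> polys N) \<Longrightarrow> prod f A \<in> polys N"
  by (induction A rule: infinite_finite_induct) (auto intro: polys_closed)

lemma evalp_simps:
  "evalp (p + q) x = evalp p x + evalp q x" "evalp (p * q) x = evalp p x * evalp q x"
  "evalp (p - q) x = evalp p x - evalp q x" "evalp (- p) x = - evalp p x"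
  "evalp 0 x = 0" "evalp 1 x = 1" "evalp (Cst c) x = c" "evalp (X i) x = x $ i"
  "evalp (p ^ k) x = evalp p x ^ k" "evalp (sum f A) x = (\<Sum>a\<in>A. evalp (f a) x)"
  by (simp_all add: evalp_def evalp.insertion_simps)

lemma evalp_prod: "evalp (prod f A) x = (\<Prod>a\<in>A. evalp (f a) x)"
  by (induction A rule: infinite_finite_induct) (simp_all add: evalp_simps)

lemma evalp_scale:
  assumes "p \<in> polys N" "x \<in> carrier_vec N"
  shows "evalp (scale_on UNIV t p) x = evalp p (t \<cdot>\<^sub>v x)"
proof -
  have 1: "scale_on UNIV t p = (\<Sum>m\<in>Poly_Mapping.keys p. Cst (Poly_Mapping.lookup p m) *
      (\<Prod>i\<in>Poly_Mapping.keys m. (Cst t * X i) ^ Poly_Mapping.lookup m i))"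
    by (simp add: scale_on_def insertion_def)
  have "evalp (scale_on UNIV t p) x = (\<Sum>m\<in>Poly_Mapping.keys p. Poly_Mapping.lookup p m *
      (\<Prod>i\<in>Poly_Mapping.keys m. (t * x $ i) ^ Poly_Mapping.lookup m i))"
    unfolding 1 by (simp add: evalp_simps evalp_prod)
  also have "\<dots> = evalp p (t \<cdot>\<^sub>v x)"
    unfolding evalp_def insertion_def
  proof (intro sum.cong arg_cong2[where f = "(*)"] prod.cong refl)
    fix m i assume "m \<in> Poly_Mapping.keys p" "i \<in> Poly_Mapping.keys m"
    then have "i < N"
      using assms(1) by (auto simp: polys_def)
    then show "(t * x $ i) ^ Poly_Mapping.lookup m i = ((t \<cdot>\<^sub>v x) $ i) ^ Poly_Mapping.lookup m i"
      using assms(2) by simp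
  qed
  finally show ?thesis .
qed

lemma poly_functions_ops:
  "restrict (evalp p) S \<oplus>\<^bsub>poly_functions N S\<^esub> restrict (evalp q) S = restrict (evalp (p + q)) S"
  "restrict (evalp p) S \<otimes>\<^bsub>poly_functions N S\<^esub> restrict (evalp q) S = restrict (evalp (p * q)) S"
  "\<zero>\<^bsub>poly_functions N S\<^esub> = restrict (evalp 0) S" "\<one>\<^bsub>poly_functions N S\<^esub> = restrict (evalp 1) S"
  "carrier (poly_functions N S) = (\<lambda>p. restrict (evalp p) S) ` polys N"
  by (auto simp: poly_functions_def evalp_simps fun_eq_iff)

lemma cring_poly_functions: "cring (poly_functions N S)"
proof -
  let ?R = "poly_functions N S" and ?r = "\<lambda>p. restrict (evalp p) S"
  show ?thesis
  proof (rule cringI)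
    show "abelian_group ?R"
    proof (rule abelian_groupI)
      fix x assume "x \<in> carrier ?R"
      then obtain p where p: "x = ?r p" "p \<in> polys N"
        unfolding poly_functions_ops by blast
      have "?r (- p) \<oplus>\<^bsub>?R\<^esub> x = \<zero>\<^bsub>?R\<^esub>"
        unfolding p(1) poly_functions_ops by simp
      moreover have "?r (- p) \<in> carrier ?R"
        unfolding poly_functions_ops using p(2) polys_closed by blast
      ultimately show "\<exists>y\<in>carrier ?R. y \<oplus>\<^bsub>?R\<^esub> x = \<zero>\<^bsub>?R\<^esub>"
        by blast
      show "\<zero>\<^bsub>?R\<^esub> \<oplus>\<^bsub>?R\<^esub> x = x"
        unfolding p(1) poly_functions_ops by simp
    next
      show "\<zero>\<^bsub>?R\<^esub> \<in> carrier ?R"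
        unfolding poly_functions_ops using polys_closed(1) by blast
    qed (auto simp: poly_functions_ops polys_closed ac_simps)
    show "comm_monoid ?R"
      by (rule comm_monoidI) (auto simp: poly_functions_ops polys_closed ac_simps)
  qed (auto simp: poly_functions_ops distrib_right)
qed

subsection \<open>The Jacobian ideal of a sector\<close>

locale fermat_elt = eigen_elt +
  fixes n :: nat
  assumes n2: "n \<ge> 2" and g_pow: "\<And>k. k < N \<Longrightarrow> snd u k ^ n = 1"
begin

abbreviation "S \<equiv> Fix N u"
abbreviation "R \<equiv> poly_functions N (Fix N u)"
abbreviation "pf p \<equiv> restrict (evalp p) (Fix N u)"
abbreviation "I \<equiv> jac_ideal N (Fix N u) (f_sector N n u)"

lemma Fix_carrier: "x \<in> S \<Longrightarrow> x \<in> carrier_vec N"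
  by (simp add: Fix_eq)

lemma Fix_step: "x \<in> S \<Longrightarrow> i < N \<Longrightarrow> g i * x $ s i = x $ i"
  by (simp add: Fix_eq)

lemma Fix_add_smult:
  assumes x: "x \<in> S" and w: "w \<in> S"
  shows "x + t \<cdot>\<^sub>v w \<in> S"
  unfolding Fix_eq
proof (intro CollectI conjI allI impI)
  fix i assume i: "i < N"
  have "(x + t \<cdot>\<^sub>v w) $ j = x $ j + t * w $ j" if "j < N" for j
    using that Fix_carrier[OF x] Fix_carrier[OF w] by simp
  then have "g i * (x + t \<cdot>\<^sub>v w) $ s i = g i * x $ s i + t * (g i * w $ s i)"
    using i s_less by (simp only: distrib_left mult.left_commute)
  also have "\<dots> = x $ i + t * w $ i"
    unfolding Fix_step[OF x i] Fix_step[OF w i] ..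
  finally show "g i * (x + t \<cdot>\<^sub>v w) $ s i = (x + t \<cdot>\<^sub>v w) $ i"
    using i Fix_carrier[OF x] Fix_carrier[OF w] by simp
qed (use Fix_carrier[OF x] Fix_carrier[OF w] in simp)

lemma Fix_smult:
  assumes x: "x \<in> S"
  shows "t \<cdot>\<^sub>v x \<in> S"
proof -
  have "0\<^sub>v N \<in> S"
    using s_less by (simp add: Fix_eq)
  from Fix_add_smult[OF this x, of t] show ?thesis
    using Fix_carrier[OF x] by simp
qed

lemma generator_eq:
  assumes w: "w \<in> S"
  shows "deriv_along S w (f_sector N n u) = pf (\<Sum>i<N. Cst (of_nat n * w $ i) * X i ^ (n - 1))"
proof
  fix x
  show "deriv_along S w (f_sector N n u) x = pf (\<Sum>i<N. Cst (of_nat n * w $ i) * X i ^ (n - 1)) x"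
  proof (cases "x \<in> S")
    case x: True
    have "f_sector N n u (x + t \<cdot>\<^sub>v w) = (\<Sum>i<N. (x $ i + t * w $ i) ^ n)" for t
      using Fix_add_smult[OF x w, of t] Fix_carrier[OF x] Fix_carrier[OF w]
      by (simp add: f_sector_def fermat_def evalp_simps)
    moreover have "((\<lambda>t. \<Sum>i<N. (x $ i + t * w $ i) ^ n) has_field_derivative
        (\<Sum>i<N. of_nat n * w $ i * x $ i ^ (n - 1))) (at 0)"
      by (auto intro!: derivative_eq_intros sum.cong)
    ultimately have "deriv (\<lambda>t. f_sector N n u (x + t \<cdot>\<^sub>v w)) 0 = (\<Sum>i<N. of_nat n * w $ i * x $ i ^ (n - 1))"
      by (simp add: DERIV_imp_deriv)
    then show ?thesis
      using x by (simp add: deriv_along_def evalp_simps)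
  qed (simp add: deriv_along_def)
qed

lemma pf_carrier: "p \<in> polys N \<Longrightarrow> pf p \<in> carrier R"
  unfolding poly_functions_ops by blast

lemma generators_carrier: "(\<lambda>w. deriv_along S w (f_sector N n u)) ` S \<subseteq> carrier R"
proof
  fix F assume "F \<in> (\<lambda>w. deriv_along S w (f_sector N n u)) ` S"
  then obtain w where "F = pf (\<Sum>i<N. Cst (of_nat n * w $ i) * X i ^ (n - 1))"
    using generator_eq by auto
  then show "F \<in> carrier R"
    by (auto intro!: pf_carrier polys_sum polys_closed)
qed

sublocale R: cring R
  by (rule cring_poly_functions)

sublocale I: ideal I R
  unfolding jac_ideal_def by (rule R.genideal_ideal[OF generators_carrier])

lemma pf_uminus: "p \<in> polys N \<Longrightarrow> \<ominus>\<^bsub>R\<^esub> pf p = pf (- p)"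
proof -
  assume p: "p \<in> polys N"
  have "pf (- p) \<oplus>\<^bsub>R\<^esub> pf p = \<zero>\<^bsub>R\<^esub>"
    unfolding poly_functions_ops by simp
  then show ?thesis
    using p by (intro R.minus_equality pf_carrier polys_closed)
qed

lemma I_zero: "pf 0 \<in> I"
  using I.zero_closed unfolding poly_functions_ops .

lemma I_add: "pf p \<in> I \<Longrightarrow> pf q \<in> I \<Longrightarrow> pf (p + q) \<in> I"
proof -
  assume "pf p \<in> I" "pf q \<in> I"
  then have "pf p \<oplus>\<^bsub>R\<^esub> pf q \<in> I"
    by (rule I.a_closed)
  then show ?thesis
    by (simp only: poly_functions_ops)
qed

lemma I_mult: "p \<in> polys N \<Longrightarrow> pf q \<in> I \<Longrightarrow> pf (p * q) \<in> I"
proof -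
  assume "p \<in> polys N" "pf q \<in> I"
  then have "pf p \<otimes>\<^bsub>R\<^esub> pf q \<in> I"
    by (intro I.I_l_closed pf_carrier)
  then show ?thesis
    by (simp only: poly_functions_ops)
qed

lemma I_diff: "pf p \<in> I \<Longrightarrow> pf q \<in> I \<Longrightarrow> pf (p - q) \<in> I"
  using I_add[of p "Cst (- 1) * q"] I_mult[OF polys_closed(3), of q "- 1"] by (simp add: Cst_uminus)

lemma I_sum: "(\<And>a. a \<in> A \<Longrightarrow> pf (f a) \<in> I) \<Longrightarrow> pf (sum f A) \<in> I"
  by (induction A rule: infinite_finite_induct) (simp_all add: I_zero I_add)

lemma I_generator: "w \<in> S \<Longrightarrow> pf (\<Sum>i<N. Cst (of_nat n * w $ i) * X i ^ (n - 1)) \<in> I"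
  using R.genideal_self[OF generators_carrier] generator_eq unfolding jac_ideal_def by auto

lemma Jac_zero: "\<zero>\<^bsub>Jac N n u\<^esub> = I"
  by (simp add: Jac_def FactRing_def)

lemma jclass_eq_zero_iff: "p \<in> polys N \<Longrightarrow> jclass N n u p = \<zero>\<^bsub>Jac N n u\<^esub> \<longleftrightarrow> pf p \<in> I"
  unfolding jclass_def Jac_zero
  using R.a_coset_join1[OF _ pf_carrier I.a_subgroup] R.a_coset_join2[OF pf_carrier I.a_subgroup] by blast

lemma jclass_in_carrier: "p \<in> polys N \<Longrightarrow> jclass N n u p \<in> carrier (Jac N n u)"
  unfolding jclass_def Jac_def FactRing_def
  using R.a_rcosetsI[OF I.a_subset pf_carrier] by simp

lemma jclass_eqD:
  assumes "p \<in> polys N" "q \<in> polys N" "jclass N n u p = jclass N n u q"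
  shows "pf (p - q) \<in> I"
proof -
  have "pf p \<in> I +>\<^bsub>R\<^esub> pf q"
    using I.a_rcos_self[OF pf_carrier[OF assms(1)]] assms(3) unfolding jclass_def by simp
  then have "pf p \<oplus>\<^bsub>R\<^esub> \<ominus>\<^bsub>R\<^esub> pf q \<in> I"
    by (rule I.a_rcos_module_imp[OF pf_carrier[OF assms(2)]])
  then show ?thesis
    unfolding pf_uminus[OF assms(2)] poly_functions_ops by simp
qed

section \<open>Dilation invariance of the Jacobian ideal\<close>

definition dilate :: "(complex vec \<Rightarrow> complex) \<Rightarrow> complex vec \<Rightarrow> complex" where
  "dilate F = (\<lambda>x\<in>S. F (2 \<cdot>\<^sub>v x))"

lemma dilate_pf: "p \<in> polys N \<Longrightarrow> dilate (pf p) = pf (scale_on UNIV 2 p)"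
  using Fix_smult[of _ 2] Fix_carrier by (auto simp: dilate_def evalp_scale fun_eq_iff)

lemma scale_polys: "p \<in> polys N \<Longrightarrow> scale_on Y t p \<in> polys N"
  unfolding polys_iff_hom_on hom_on_def by (auto simp: in_keys_iff lookup_scale_on)

lemma dilate_hom: "ring_hom_ring R R dilate"
proof (rule ring_hom_ringI)
  fix x assume "x \<in> carrier R"
  then show "dilate x \<in> carrier R"
    unfolding poly_functions_ops using dilate_pf scale_polys by auto
next
  fix x y assume "x \<in> carrier R" "y \<in> carrier R"
  then obtain p q where pq: "x = pf p" "p \<in> polys N" "y = pf q" "q \<in> polys N"
    unfolding poly_functions_ops by blast
  show "dilate (x \<otimes>\<^bsub>R\<^esub> y) = dilate x \<otimes>\<^bsub>R\<^esub> dilate y"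
    using pq by (simp add: poly_functions_ops dilate_pf polys_closed)
      (simp add: scale_on_def subst.insertion_simps)
  show "dilate (x \<oplus>\<^bsub>R\<^esub> y) = dilate x \<oplus>\<^bsub>R\<^esub> dilate y"
    using pq by (simp add: poly_functions_ops dilate_pf polys_closed)
      (simp add: scale_on_def subst.insertion_simps)
next
  show "dilate \<one>\<^bsub>R\<^esub> = \<one>\<^bsub>R\<^esub>"
    by (simp add: poly_functions_ops dilate_pf polys_closed)
      (simp add: scale_on_def subst.insertion_simps)
qed (rule R.ring_axioms)+

text \<open>The generators are homogeneous of degree n - 1, so they lie in the preimage of the ideal
  under dilation. This preimage is an ideal.\<close>

lemma I_dilate: "F \<in> I \<Longrightarrow> dilate F \<in> I"
proof -
  interpret h: ring_hom_ring R R dilate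
    by (rule dilate_hom)
  have "ideal {r \<in> carrier R. dilate r \<in> I} R"
    by (rule h.ideal_vimage[OF I.ideal_axioms])
  moreover have "(\<lambda>w. deriv_along S w (f_sector N n u)) ` S \<subseteq> {r \<in> carrier R. dilate r \<in> I}"
  proof
    fix F assume F: "F \<in> (\<lambda>w. deriv_along S w (f_sector N n u)) ` S"
    then obtain w where w: "w \<in> S" "F = pf (\<Sum>i<N. Cst (of_nat n * w $ i) * X i ^ (n - 1))"
      using generator_eq by auto
    let ?p = "\<Sum>i<N. Cst (of_nat n * w $ i) * X i ^ (n - 1)"
    have p: "?p \<in> polys N"
      by (auto intro!: polys_sum polys_closed)
    have "hom_on UNIV (real (n - 1)) ?p"
    proof (intro hom_on_sum hom_on_Cst_mult)
      show "hom_on UNIV (real (n - 1)) (X i ^ (n - 1))" for i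
        using hom_on_power[OF hom_on_X[of UNIV i], of "n - 1"] by simp
    qed
    then have "dilate F = pf (Cst (2 ^ (n - 1)) * ?p)"
      unfolding w(2) dilate_pf[OF p] by (simp only: scale_on_hom)
    then have "dilate F \<in> I"
      using I_mult[OF polys_closed(3) I_generator[OF w(1)]] by (simp only:)
    then show "F \<in> {r \<in> carrier R. dilate r \<in> I}"
      using F generators_carrier by blast
  qed
  ultimately have "I \<subseteq> {r \<in> carrier R. dilate r \<in> I}"
    unfolding jac_ideal_def[of N S "f_sector N n u"] by (rule R.genideal_minimal)
  then show "F \<in> I \<Longrightarrow> dilate F \<in> I"
    by blast
qed

text \<open>Dilation by 2 acts on degree \<open>a\<close> with eigenvalue \<open>2\<^sup>a\<close>, so it separates the two degrees.\<close>

lemma jclass_degree_unique: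
  assumes p: "p \<in> polys N" "hom_on UNIV (real a) p" and q: "q \<in> polys N" "hom_on UNIV (real b) q"
    and eq: "jclass N n u p = jclass N n u q" and nz: "pf p \<notin> I"
  shows "a = b"
proof (rule ccontr)
  assume ne: "a \<noteq> b"
  have d: "pf (p - q) \<in> I"
    by (rule jclass_eqD[OF p(1) q(1) eq])
  then have "pf (scale_on UNIV 2 (p - q)) \<in> I"
    using I_dilate dilate_pf[OF polys_closed(6)[OF p(1) q(1)]] by metis
  moreover have "scale_on UNIV 2 (p - q) = Cst (2 ^ a) * p - Cst (2 ^ b) * q"
    using scale_on_hom[OF p(2), of 2] scale_on_hom[OF q(2), of 2]
    by (simp add: scale_on_def subst.insertion_simps)
  ultimately have "pf (Cst (2 ^ a) * p - Cst (2 ^ b) * q) \<in> I"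
    by simp
  from I_diff[OF this I_mult[OF polys_closed(3) d]]
  have "pf (Cst (2 ^ a) * p - Cst (2 ^ b) * q - Cst (2 ^ b) * (p - q)) \<in> I" .
  moreover have "Cst (2 ^ a) * p - Cst (2 ^ b) * q - Cst (2 ^ b) * (p - q) = Cst (2 ^ a - 2 ^ b) * p"
    by (simp add: Cst_diff algebra_simps)
  ultimately have "pf (Cst (1 / (2 ^ a - 2 ^ b)) * (Cst (2 ^ a - 2 ^ b) * p)) \<in> I"
    using I_mult[OF polys_closed(3)] by simp
  moreover have "(2 :: complex) ^ a \<noteq> 2 ^ b"
  proof
    assume "(2 :: complex) ^ a = 2 ^ b"
    then have "norm ((2 :: complex) ^ a) = norm ((2 :: complex) ^ b)"
      by simp
    then have "(2 :: real) ^ a = 2 ^ b"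
      by (simp only: norm_power norm_numeral)
    then show False
      using ne by (subst (asm) power_inject_exp) simp_all
  qed
  ultimately show False
    using nz by (simp add: mult.assoc[symmetric] Cst_mult[symmetric])
qed

section \<open>Restriction of monomials to the fixed space\<close>

lemma Fix_funpow:
  assumes "x \<in> S" "i < N"
  shows "x $ ((s ^^ k) i) * (\<Prod>l<k. g ((s ^^ l) i)) = x $ i"
proof (induction k)
  case (Suc k)
  have "g ((s ^^ k) i) * x $ s ((s ^^ k) i) = x $ ((s ^^ k) i)"
    using assms by (intro Fix_step) (simp_all add: funpow_less)
  moreover have "x $ ((s ^^ Suc k) i) * (\<Prod>l<Suc k. g ((s ^^ l) i)) =
      (g ((s ^^ k) i) * x $ s ((s ^^ k) i)) * (\<Prod>l<k. g ((s ^^ l) i))"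
    by (simp add: mult_ac)
  ultimately show ?case
    using Suc by (simp only:)
qed simp

text \<open>One turn around the cycle multiplies the coordinate of a fixed point by the
  determinant.\<close>

lemma Fix_zero:
  assumes x: "x \<in> S" and i: "i < N" and D: "cycle_det u i \<noteq> 1"
  shows "x $ i = 0"
proof -
  have "x $ i * cycle_det u i = x $ i"
    using Fix_funpow[OF x i, of "card (C i)"]
    unfolding funpow_card_cyc[OF perm] prod_funpow_eq_cycle_det .
  then show ?thesis
    using D by simp
qed

lemma cycle_constant:
  assumes "\<And>j. j \<in> C i \<Longrightarrow> f (s j) = f j" "j \<in> C i"
  shows "f j = f i"
proof -
  obtain k where k: "j = (s ^^ k) i"
    using assms(2) unfolding cyc_range[OF perm] by blast
  have "f ((s ^^ k) i) = f i" for k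
  proof (induction k)
    case (Suc k)
    have "(s ^^ k) i \<in> C i"
      unfolding cyc_range[OF perm] by simp
    then show ?case
      using assms(1) Suc by simp
  qed simp
  then show ?thesis
    using k by simp
qed

text \<open>The numbers c are the row of the eigencoordinate with eigenvalue 1. On the fixed space
  the product of x_j and c_j is then constant along the cycle.\<close>

lemma special_row:
  assumes i: "i < N" and D: "cycle_det u i = 1"
  obtains c where "\<And>j. j \<in> C i \<Longrightarrow> c j \<noteq> 0" "\<And>j. j \<in> C i \<Longrightarrow> c (s j) = c j * g j"
proof -
  have "1 \<in> lam ` C i"
    unfolding lam_image[OF i] using D by simp
  then obtain e where e: "e \<in> C i" "lam e = 1"
    by auto
  have less: "e < N"
    by (rule cyc_less[OF perm i e(1)])
  have Ce: "C e = C i"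
    by (rule cyc_eq[OF perm e(1)])
  show ?thesis
  proof (rule that[of "\<lambda>j. M e j"])
    fix j assume j: "j \<in> C i"
    show "M e j \<noteq> 0"
      using row_cyc_ne[OF less] j Ce by simp
    show "M e (s j) = M e j * g j"
      using row_step[OF less cyc_less[OF perm i j]] e(2) by simp
  qed
qed

lemma Fix_proportional:
  assumes x: "x \<in> S" and i: "i < N"
    and c: "\<And>j. j \<in> C i \<Longrightarrow> c j \<noteq> 0" "\<And>j. j \<in> C i \<Longrightarrow> c (s j) = c j * g j"
    and j: "j \<in> C i"
  shows "x $ j * c j = x $ i * c i"
proof (rule cycle_constant[where f = "\<lambda>j. x $ j * c j", OF _ j])
  fix j assume j: "j \<in> C i"
  have "x $ s j * c (s j) = (g j * x $ s j) * c j"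
    unfolding c(2)[OF j] by (simp only: mult_ac)
  also have "g j * x $ s j = x $ j"
    by (rule Fix_step[OF x cyc_less[OF perm i j]])
  finally show "x $ s j * c (s j) = x $ j * c j" .
qed

text \<open>On a non-special cycle the variable vanishes on the fixed space. On a special one, the
  derivative along the fixed vector w with entries 1 / c_j on the cycle is a nonzero multiple of the
  power of x_i, because its terms coincide on the fixed space.\<close>

lemma I_X_power:
  assumes i: "i < N"
  shows "pf (X i ^ (n - 1)) \<in> I"
proof (cases "cycle_det u i = 1")
  case False
  have "pf (X i ^ (n - 1)) = pf 0"
    using Fix_zero[OF _ i False] n2 by (auto simp: evalp_simps)
  then show ?thesis
    using I_zero by simp
next
  case True
  obtain c where c: "\<And>j. j \<in> C i \<Longrightarrow> c j \<noteq> 0" "\<And>j. j \<in> C i \<Longrightarrow> c (s j) = c j * g j"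
    using special_row[OF i True] by blast
  define w where "w = vec N (\<lambda>j. if j \<in> C i then 1 / c j else 0)"
  have CN: "j < N" if "j \<in> C i" for j
    by (rule cyc_less[OF perm i that])
  have w: "w \<in> S"
    unfolding Fix_eq
  proof (intro CollectI conjI allI impI)
    fix j assume j: "j < N"
    have "s j \<in> C i \<longleftrightarrow> j \<in> C i"
      using closed_cyc[OF perm, of i] by (simp add: closed_under_def)
    then show "g j * w $ s j = w $ j"
      using j s_less g_ne[OF j] c by (simp add: w_def)
  qed (simp add: w_def)
  \<comment> \<open>Here it matters that the scalars are n-th roots of unity; it makes the terms of
    the derivative equal.\<close>
  have cn: "c j ^ n = c i ^ n" if "j \<in> C i" for j
  proof (rule cycle_constant[where f = "\<lambda>j. c j ^ n", OF _ that])
    fix j assume "j \<in> C i"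
    then show "c (s j) ^ n = c j ^ n"
      using c(2) g_pow[OF CN] by (simp add: power_mult_distrib)
  qed
  let ?a = "of_nat n * of_nat (card (C i)) / c i"
  have ci: "c i \<noteq> 0"
    by (rule c(1)[OF cyc_self[OF perm]])
  have a: "?a \<noteq> 0"
    using n2 card_cyc_pos[OF perm, of i] ci by simp
  have "(\<Sum>j<N. of_nat n * w $ j * x $ j ^ (n - 1)) = ?a * x $ i ^ (n - 1)" if x: "x \<in> S" for x
  proof -
    have "(\<Sum>j<N. of_nat n * w $ j * x $ j ^ (n - 1)) = (\<Sum>j\<in>C i. of_nat n * (1 / c j) * x $ j ^ (n - 1))"
      by (rule sum.mono_neutral_cong_right) (use CN in \<open>auto simp: w_def\<close>)
    also have "\<dots> = (\<Sum>j\<in>C i. of_nat n / c i * x $ i ^ (n - 1))"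
    proof (rule sum.cong[OF refl])
      fix j assume j: "j \<in> C i"
      have "x $ j ^ (n - 1) * c j ^ (n - 1) = x $ i ^ (n - 1) * c i ^ (n - 1)"
        using Fix_proportional[OF x i c j] by (simp flip: power_mult_distrib)
      then have "x $ j ^ (n - 1) = x $ i ^ (n - 1) * c i ^ (n - 1) / c j ^ (n - 1)"
        using c(1)[OF j] by (simp add: field_simps)
      then have "1 / c j * x $ j ^ (n - 1) = x $ i ^ (n - 1) * c i ^ (n - 1) / (c j * c j ^ (n - 1))"
        by simp
      also have "c j * c j ^ (n - 1) = c i * c i ^ (n - 1)"
        using cn[OF j] n2 by (simp flip: power_Suc)
      finally have "1 / c j * x $ j ^ (n - 1) = 1 / c i * x $ i ^ (n - 1)"
        using ci by simp
      then have "of_nat n * (1 / c j * x $ j ^ (n - 1)) = of_nat n * (1 / c i * x $ i ^ (n - 1))"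
        by (simp only:)
      then show "of_nat n * (1 / c j) * x $ j ^ (n - 1) = of_nat n / c i * x $ i ^ (n - 1)"
        by (simp only: divide_inverse mult_1_left mult.assoc)
    qed
    also have "\<dots> = ?a * x $ i ^ (n - 1)"
      by simp
    finally show ?thesis .
  qed
  then have "pf (\<Sum>j<N. Cst (of_nat n * w $ j) * X j ^ (n - 1)) = pf (Cst ?a * X i ^ (n - 1))"
    by (auto simp: evalp_simps fun_eq_iff)
  then have "pf (Cst ?a * X i ^ (n - 1)) \<in> I"
    using I_generator[OF w] by simp
  then have "pf (Cst (1 / ?a) * (Cst ?a * X i ^ (n - 1))) \<in> I"
    by (rule I_mult[OF polys_closed(3)])
  moreover have "Cst (1 / ?a) * (Cst ?a * X i ^ (n - 1)) = X i ^ (n - 1)"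
    using a by (simp only: mult.assoc[symmetric] Cst_mult[symmetric]) simp
  ultimately show ?thesis
    by (simp only:)
qed

text \<open>On the fixed space all variables of a special cycle are multiples of x_i, so the
  monomial restricts to a multiple of a power of x_i with exponent at least n - 1.\<close>

lemma I_monomial:
  assumes m: "Poly_Mapping.keys m \<subseteq> {..<N}" and i: "i < N" "cycle_det u i = 1"
    and deg: "deg_on (C i) m \<ge> n - 1"
  shows "pf (Poly_Mapping.single m 1) \<in> I"
proof -
  obtain c where c: "\<And>j. j \<in> C i \<Longrightarrow> c j \<noteq> 0" "\<And>j. j \<in> C i \<Longrightarrow> c (s j) = c j * g j"
    using special_row[OF i] by blast
  let ?l = "Poly_Mapping.lookup m" and ?K = "Poly_Mapping.keys m"
  let ?Q = "\<Prod>j\<in>?K - C i. X j ^ ?l j"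
  let ?b = "\<Prod>j\<in>?K \<inter> C i. (c i / c j) ^ ?l j"
  define r where "r = deg_on (C i) m"
  have "evalp (Poly_Mapping.single m 1) x = evalp ((Cst ?b * X i ^ (r - (n - 1)) * ?Q) * X i ^ (n - 1)) x"
    if x: "x \<in> S" for x
  proof -
    have xj: "x $ j = c i / c j * x $ i" if "j \<in> C i" for j
      using Fix_proportional[OF x i(1) c that] c(1)[OF that] by (simp add: field_simps)
    have "(\<Prod>j\<in>?K \<inter> C i. x $ j ^ ?l j) = (\<Prod>j\<in>?K \<inter> C i. (c i / c j) ^ ?l j * x $ i ^ ?l j)"
    proof (rule prod.cong[OF refl])
      fix j assume "j \<in> ?K \<inter> C i"
      then have "x $ j = c i / c j * x $ i"
        by (intro xj) simp
      then show "x $ j ^ ?l j = (c i / c j) ^ ?l j * x $ i ^ ?l j"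
        by (simp only: power_mult_distrib)
    qed
    also have "\<dots> = ?b * x $ i ^ r"
      by (simp add: prod.distrib r_def deg_on_def power_sum)
    finally have A: "(\<Prod>j\<in>?K \<inter> C i. x $ j ^ ?l j) = ?b * x $ i ^ r" .
    have "evalp (Poly_Mapping.single m 1) x = (\<Prod>j\<in>?K. x $ j ^ ?l j)"
      unfolding prod_X[symmetric] by (simp add: evalp_prod evalp_simps)
    also have "\<dots> = (\<Prod>j\<in>?K - C i. x $ j ^ ?l j) * (\<Prod>j\<in>?K \<inter> C i. x $ j ^ ?l j)"
      by (subst prod.union_disjoint[symmetric]) (auto intro!: prod.cong)
    also have "x $ i ^ r = x $ i ^ (r - (n - 1)) * x $ i ^ (n - 1)"
      using deg unfolding r_def by (simp flip: power_add)
    ultimately show ?thesis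
      unfolding A by (simp add: evalp_prod evalp_simps mult_ac)
  qed
  then have "pf (Poly_Mapping.single m 1) = pf ((Cst ?b * X i ^ (r - (n - 1)) * ?Q) * X i ^ (n - 1))"
    by (auto simp: fun_eq_iff)
  moreover have "Cst ?b * X i ^ (r - (n - 1)) * ?Q \<in> polys N"
    using m i by (intro polys_closed polys_prod) auto
  ultimately show ?thesis
    using I_mult I_X_power[OF i(1)] by simp
qed

definition special_reps :: "nat set \<Rightarrow> nat set" where
  "special_reps Y = {c \<in> cycle_reps s Y. cycle_det u c = 1}"

text \<open>The pigeonhole principle distributes the degree over the special cycles inside \<open>Y\<close>.\<close>

lemma I_large_degree:
  assumes p: "p \<in> polys N" "hom_on Y k p" and Y: "closed_under s Y" "Y \<subseteq> {..<N}"
    and k: "k > real (n - 2) * real (card (special_reps Y))"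
  shows "pf p \<in> I"
proof -
  have finY: "finite Y"
    using Y(2) finite_subset by blast
  have mono: "pf (Poly_Mapping.single m 1) \<in> I" if m: "m \<in> Poly_Mapping.keys p" for m
  proof (rule ccontr)
    assume nI: "pf (Poly_Mapping.single m 1) \<notin> I"
    have K: "Poly_Mapping.keys m \<subseteq> {..<N}"
      using p(1) m by (auto simp: polys_def)
    have zero: "Poly_Mapping.lookup m i = 0" if i: "i < N" "cycle_det u i \<noteq> 1" for i
    proof (rule ccontr)
      assume "Poly_Mapping.lookup m i \<noteq> 0"
      then have iK: "i \<in> Poly_Mapping.keys m"
        by (simp add: in_keys_iff)
      have "evalp (Poly_Mapping.single m 1) x = evalp 0 x" if "x \<in> S" for x
      proof -
        have "x $ i ^ Poly_Mapping.lookup m i = 0"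
          using Fix_zero[OF that i] \<open>Poly_Mapping.lookup m i \<noteq> 0\<close> by simp
        then show ?thesis
          unfolding prod_X[symmetric] using iK by (auto simp: evalp_prod evalp_simps)
      qed
      then have "pf (Poly_Mapping.single m 1) = pf 0"
        by (auto simp: fun_eq_iff)
      then show False
        using nI I_zero by simp
    qed
    have deg: "deg_on Z m = (\<Sum>i\<in>Z. Poly_Mapping.lookup m i)" if "finite Z" for Z
      unfolding deg_on_def using that by (intro sum.mono_neutral_left) (auto simp: in_keys_iff)
    have rN: "c < N" if "c \<in> cycle_reps s Y" for c
      using that Y(2) by (auto simp: cycle_reps_def)
    have "real (deg_on Y m) = k"
      using p(2) m by (simp add: hom_on_def)
    moreover have "deg_on Y m \<le> (n - 2) * card (special_reps Y)"
    proof -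
      have "deg_on Y m = (\<Sum>c\<in>cycle_reps s Y. deg_on (C c) m)"
        unfolding deg[OF finY] sum_cycle_reps[OF perm Y(1) finY] using deg[OF finite_cyc[OF perm]] by simp
      also have "\<dots> = (\<Sum>c\<in>special_reps Y. deg_on (C c) m)"
      proof (rule sum.mono_neutral_right)
        show "\<forall>c\<in>cycle_reps s Y - special_reps Y. deg_on (C c) m = 0"
        proof
          fix c assume c: "c \<in> cycle_reps s Y - special_reps Y"
          then have "Poly_Mapping.lookup m i = 0" if "i \<in> C c" for i
            using that rN cyc_less[OF perm] cycle_det_eq by (intro zero) (auto simp: special_reps_def)
          then show "deg_on (C c) m = 0"
            by (simp add: deg_on_def)
        qed
      qed (use finY in \<open>auto simp: special_reps_def cycle_reps_def\<close>)
      also have "\<dots> \<le> (\<Sum>c\<in>special_reps Y. n - 2)"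
      proof (rule sum_mono)
        fix c assume "c \<in> special_reps Y"
        then have c: "c < N" "cycle_det u c = 1"
          using rN by (auto simp: special_reps_def)
        show "deg_on (C c) m \<le> n - 2"
        proof (rule ccontr)
          assume "\<not> deg_on (C c) m \<le> n - 2"
          then have "deg_on (C c) m \<ge> n - 1"
            using n2 by linarith
          then show False
            using I_monomial[OF K c] nI by blast
        qed
      qed
      also have "\<dots> = (n - 2) * card (special_reps Y)"
        by simp
      finally show ?thesis .
    qed
    then have "real (deg_on Y m) \<le> real (n - 2) * real (card (special_reps Y))"
      by (metis of_nat_le_iff of_nat_mult)
    ultimately show False
      using k by simp
  qed
  have "p = (\<Sum>m\<in>Poly_Mapping.keys p. Cst (Poly_Mapping.lookup p m) * Poly_Mapping.single m 1)"
    by (subst (1) poly_mapping_eq_sum_single) (simp add: Cst_def mult_single)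
  moreover have "pf (\<Sum>m\<in>Poly_Mapping.keys p. Cst (Poly_Mapping.lookup p m) * Poly_Mapping.single m 1) \<in> I"
    by (intro I_sum I_mult polys_closed mono)
  ultimately show ?thesis
    by simp
qed

end

subsection \<open>Additivity of the age\<close>

text \<open>The function h of the overview. Its value at 1 is 0 and not -1 because a special cycle
  has one eigenvalue equal to 1, which lowers the codimension.\<close>

definition arg_defect :: "complex \<Rightarrow> real" where
  "arg_defect z = (if z = 1 then 0 else Arg2pi z / pi - 1)"

lemma arg_defect_inverse:
  assumes "norm z = 1"
  shows "arg_defect (inverse z) = - arg_defect z"
proof (cases "z = 1")
  case False
  have pos: "Arg2pi z \<noteq> 0"
    using cis_Arg2pi_eq[OF assms] False by auto
  have "cis (2 * pi - Arg2pi z) = inverse (cis (Arg2pi z))"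
    by (simp add: cis_divide[symmetric] divide_inverse)
  then have "inverse z = cis (2 * pi - Arg2pi z)"
    unfolding cis_Arg2pi_eq[OF assms] by simp
  then have "Arg2pi (inverse z) = 2 * pi - Arg2pi z"
    using pos Arg2pi_ge_0[of z] Arg2pi_lt_2pi[of z] by (simp add: Arg2pi_cis_eq)
  then have "Arg2pi (inverse z) / pi - 1 = - (Arg2pi z / pi - 1)"
    by (simp add: diff_divide_distrib)
  then show ?thesis
    using False by (simp add: arg_defect_def)
qed (simp add: arg_defect_def)

text \<open>A single factor different from 1 is impossible when the product is 1, and two such
  factors are inverse to each other.\<close>

lemma sum_arg_defect_zero:
  assumes "finite K" "\<And>k. k \<in> K \<Longrightarrow> norm (z k) = 1" "(\<Prod>k\<in>K. z k) = 1" "card {k \<in> K. z k \<noteq> 1} \<le> 2"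
  shows "(\<Sum>k\<in>K. arg_defect (z k)) = 0"
proof -
  let ?J = "{k \<in> K. z k \<noteq> 1}"
  have fin: "finite ?J"
    using assms(1) by simp
  have sum: "(\<Sum>k\<in>K. arg_defect (z k)) = (\<Sum>k\<in>?J. arg_defect (z k))"
    using assms(1) by (intro sum.mono_neutral_right) (auto simp: arg_defect_def)
  have prod: "(\<Prod>k\<in>?J. z k) = 1"
    using assms(1,3) by (subst prod.mono_neutral_left[of K]) auto
  consider "card ?J = 0" | "card ?J = 1" | "card ?J = 2"
    using assms(4) by linarith
  then show ?thesis
  proof cases
    case 1
    then have "?J = {}"
      using fin by simp
    then show ?thesis
      unfolding sum by (simp only: sum.empty)
  next
    case 2
    then obtain a where a: "?J = {a}"
      by (rule card_1_singletonE)
    then have "z a = 1"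
      using prod by simp
    then show ?thesis
      using a by blast
  next
    case 3
    then obtain a b where ab: "?J = {a, b}" "a \<noteq> b"
      by (meson card_2_iff)
    have "norm (z a) = 1" "z a * z b = 1"
      using ab prod assms(2)[of a] by auto
    then have "z b = inverse (z a)"
      by (metis inverse_unique)
    then show ?thesis
      unfolding sum ab(1) using ab(2) arg_defect_inverse[OF \<open>norm (z a) = 1\<close>] by simp
  qed
qed

lemma arg_defect_square: "z ^ 2 = 1 \<Longrightarrow> arg_defect z = 0"
proof -
  assume "z ^ 2 = 1"
  then consider "z = 1" | "z = - 1"
    by (auto simp: power2_eq_1_iff)
  then show ?thesis
  proof cases
    case 2
    have "Arg2pi (- 1) = pi"
      using Arg2pi_cis_eq[of pi] by simp
    then show ?thesis
      by (simp add: 2 arg_defect_def)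
  qed (simp add: arg_defect_def)
qed

context fermat_elt
begin

definition defect_on :: "nat set \<Rightarrow> real" where
  "defect_on Y = (\<Sum>c\<in>cycle_reps s Y. arg_defect (cycle_det u c))"

lemma age_defect: "2 * age N u - real (card moved) = defect_on {..<N}"
  unfolding defect_on_def arg_defect_def by (rule age_eq_dets)

lemma card_moved_special:
  assumes "closed_under s Y" "Y \<subseteq> {..<N}"
  shows "real (card (moved \<inter> Y)) = real (card Y) - real (card (special_reps Y))"
proof -
  have fin: "finite Y"
    using assms(2) finite_subset by blast
  have "Y \<inter> {..<N} = Y"
    using assms(2) by blast
  then have "real (card (moved \<inter> Y)) =
      (\<Sum>c\<in>cycle_reps s Y. real (card (C c))) - (\<Sum>c\<in>cycle_reps s Y. of_bool (cycle_det u c = 1))"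
    using card_moved_Int[OF assms(1)] by (simp add: sum_subtractf)
  moreover have "real (card Y) = (\<Sum>c\<in>cycle_reps s Y. real (card (C c)))"
    using sum_cycle_reps[OF perm assms(1) fin, of "\<lambda>_. 1 :: real"] by simp
  moreover have "finite (cycle_reps s Y)"
    using fin by (simp add: cycle_reps_def)
  then have "(\<Sum>c\<in>cycle_reps s Y. of_bool (cycle_det u c = 1)) = real (card (special_reps Y))"
    by (simp add: special_reps_def of_bool_def sum.If_cases Int_def)
  ultimately show ?thesis
    by simp
qed

text \<open>The ages of u and of its inverse have the codimension as sum and
  \<open>defect_on\<close> as difference.\<close>

lemma charges:
  assumes "u' \<in> carrier (Gf N n)" "u \<in> carrier (Gf N n)" "u' \<otimes>\<^bsub>Gf N n\<^esub> u = \<one>\<^bsub>Gf N n\<^esub>"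
    and "inv\<^bsub>Gf N n\<^esub> u = u'"
  shows "q_l N n d u = (real d - real (card moved)) / real n + (real (card moved) + defect_on {..<N}) / 2"
    and "q_r N n d u = (real d - real (card moved)) / real n + (real (card moved) - defect_on {..<N}) / 2"
proof -
  have "age N u + age N u' = real (card moved)"
  proof (rule age_inverse)
    have eq: "fst u' \<circ> s = id" "(\<lambda>k. snd u' (s k) * g k) = (\<lambda>_. 1)"
      using assms(3) by (auto simp: Gf_def split: prod.splits)
    show "fst u' (s l) = l" for l
      using fun_cong[OF eq(1), of l] by simp
    show "snd u' (s l) * g l = 1" for l
      using fun_cong[OF eq(2), of l] .
    have "fst u' permutes {..<N}"
      using assms(1) by (auto simp: Gf_def)
    from permutes_in_image[OF this] show "fst u' l < N \<longleftrightarrow> l < N" for l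
      by simp
  qed
  moreover have u: "age N u = (real (card moved) + defect_on {..<N}) / 2"
    using age_defect by simp
  ultimately have u': "age N u' = (real (card moved) - defect_on {..<N}) / 2"
    by (simp add: field_simps)
  show "q_l N n d u = (real d - real (card moved)) / real n + (real (card moved) + defect_on {..<N}) / 2"
    "q_r N n d u = (real d - real (card moved)) / real n + (real (card moved) - defect_on {..<N}) / 2"
    unfolding q_l_def q_r_def Fix_codim_eq assms(4) u u' by (rule refl)+
qed

end

subsection \<open>Homogeneity of the structure constants\<close>

lemma wt2_on_H_f:
  assumes "n \<ge> 2" "\<And>i. fst u i \<in> Y \<longleftrightarrow> i \<in> Y"
  shows "wt2_on Y ((real n - 2) / 2) (H_f N n u)"
  unfolding wt2_on_def H_f_def
proof (intro allI impI hom_on_sum)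
  fix A B :: "nat set" and i
  let ?\<alpha> = "(real n - 2) / 2"
  show "hom_on Y (?\<alpha> * real (card (A \<inter> Y)) + ?\<alpha> * real (card (B \<inter> Y)))
    (if A = {i} \<and> B = {i} then \<Sum>a\<le>n - 2. of_nat (a + 1) * X i ^ a * act u (X i) ^ (n - 2 - a) else 0)"
  proof (cases "A = {i} \<and> B = {i}")
    case True
    have "real (card ({i} \<inter> Y)) = of_bool (i \<in> Y)"
      by simp
    then have deg: "?\<alpha> * real (card (A \<inter> Y)) + ?\<alpha> * real (card (B \<inter> Y)) = real (n - 2) * of_bool (i \<in> Y)"
      using True assms(1) by (simp add: of_nat_diff)
    have act: "hom_on Y (of_bool (i \<in> Y)) (act u (X i))"
      by (rule hom_on_act[OF assms(2) hom_on_X])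
    have "hom_on Y (real (n - 2) * of_bool (i \<in> Y)) (of_nat (a + 1) * X i ^ a * act u (X i) ^ (n - 2 - a))"
      if a: "a \<le> n - 2" for a
    proof -
      have "hom_on Y ((0 + real a * of_bool (i \<in> Y)) + real (n - 2 - a) * of_bool (i \<in> Y))
          (of_nat (a + 1) * X i ^ a * act u (X i) ^ (n - 2 - a))"
        by (intro hom_on_mult hom_on_of_nat hom_on_power hom_on_X act)
      moreover have "(0 + real a * of_bool (i \<in> Y)) + real (n - 2 - a) * of_bool (i \<in> Y) =
          real (n - 2) * (of_bool (i \<in> Y) :: real)"
      proof -
        have "real (n - 2) = real (a + (n - 2 - a))"
          using a by simp
        then show ?thesis
          by (simp only: of_nat_add distrib_right add_0_left)
      qed
      ultimately show ?thesis
        by simp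
    qed
    then have "hom_on Y (real (n - 2) * of_bool (i \<in> Y))
        (\<Sum>a\<le>n - 2. of_nat (a + 1) * X i ^ a * act u (X i) ^ (n - 2 - a))"
      by (intro hom_on_sum) simp
    then show ?thesis
      unfolding deg using True by simp
  next
    case False
    show ?thesis
      unfolding if_not_P[OF False] by (rule hom_on_zero)
  qed
qed

locale fermat_pair =
  U: fermat_elt N u Eu n + V: fermat_elt N v Ev n + W: fermat_elt N "u \<otimes>\<^bsub>Gf N n\<^esub> v" Ew n
  for N n u v Eu Ev Ew
begin

abbreviation "w \<equiv> u \<otimes>\<^bsub>Gf N n\<^esub> v"

abbreviation "structure_const \<equiv> xi_coeff N n Ew w
  (Upsilon N (ext2_exp N (H_f N n u)) (xi_tilde N n Eu u) (\<lambda>S. act u (xi_tilde N n Ev v S)))"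

lemma closed_w: "closed_under (fst u) Y \<Longrightarrow> closed_under (fst v) Y \<Longrightarrow> closed_under (fst w) Y"
  by (simp add: closed_under_def fst_Gf_mult)

lemma hom_on_structure_const:
  assumes Y: "closed_under (fst u) Y" "closed_under (fst v) Y"
  shows "hom_on Y ((real n - 2) / 2 * (real (card (U.moved \<inter> Y)) + real (card (V.moved \<inter> Y)) -
    real (card (W.moved \<inter> Y)))) structure_const"
proof -
  let ?\<alpha> = "(real n - 2) / 2"
  let ?V = "\<lambda>S. act u (xi_tilde N n Ev v S)"
  let ?Z = "Upsilon N (ext2_exp N (H_f N n u)) (xi_tilde N n Eu u) ?V"
  have uY: "fst u i \<in> Y \<longleftrightarrow> i \<in> Y" for i
    using Y(1) by (simp add: closed_under_def)
  have "ext_in N ?V"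
    using V.ext_in_xi_tilde by (simp add: ext_in_def act_simps)
  then have Z_in: "ext_in N ?Z"
    by (intro ext_in_Upsilon U.ext_in_xi_tilde)
  have "wt_on Y ?\<alpha> (?\<alpha> * real (card (V.moved \<inter> Y))) ?V"
    unfolding wt_on_def by (intro allI impI hom_on_act uY wt_onD[OF V.wt_on_xi_tilde[OF Y(2)]])
  then have "wt_on Y ?\<alpha> (?\<alpha> * real (card (U.moved \<inter> Y)) + ?\<alpha> * real (card (V.moved \<inter> Y))) ?Z"
    by (intro wt_on_Upsilon wt2_on_ext2_exp wt2_on_H_f U.n2 uY U.wt_on_xi_tilde[OF Y(1)])
  from W.hom_on_xi_coeff[OF closed_w[OF Y] Z_in this] show ?thesis
    by (simp add: algebra_simps)
qed

text \<open>For the stable set \<open>{N..}\<close>, which contains no index of an eigencoordinate,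
  the degree formula gives 0.\<close>

lemma structure_const_polys: "structure_const \<in> polys N"
proof -
  have "closed_under (fst u) {N..}" "closed_under (fst v) {N..}"
    using closed_under_Compl[OF closed_lessThan[OF U.perm]]
      closed_under_Compl[OF closed_lessThan[OF V.perm]] by (simp_all add: Compl_lessThan)
  moreover have "U.moved \<inter> {N..} = {}" "V.moved \<inter> {N..} = {}" "W.moved \<inter> {N..} = {}"
    by (auto simp: U.moved_def V.moved_def W.moved_def)
  ultimately show ?thesis
    using hom_on_structure_const[of "{N..}"] by (simp add: polys_iff_hom_on)
qed

lemma structure_const_degree:
  "hom_on UNIV ((real n - 2) / 2 * (real (card U.moved) + real (card V.moved) - real (card W.moved))) structure_const"
proof (rule hom_on_UNIV)
  show "hom_on {N..} 0 structure_const"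
    using structure_const_polys by (simp add: polys_iff_hom_on)
  have "U.moved \<inter> {..<N} = U.moved" "V.moved \<inter> {..<N} = V.moved" "W.moved \<inter> {..<N} = W.moved"
    by (auto simp: U.moved_def V.moved_def W.moved_def)
  then show "hom_on {..<N} ((real n - 2) / 2 * (real (card U.moved) + real (card V.moved) - real (card W.moved))) structure_const"
    using hom_on_structure_const[OF closed_lessThan[OF U.perm] closed_lessThan[OF V.perm]] by simp
qed

section \<open>Joint orbits of the two permutations\<close>

definition orbit_of :: "nat \<Rightarrow> nat set" where
  "orbit_of x = conn (fun_graph {..<N} (fst u) \<union> fun_graph {..<N} (fst v)) `` {x}"

text \<open>The orbit is formed in the graph on all indices. Edges never leave it, so paths starting
  in it use only the restricted graphs, which therefore have a single component.\<close>

lemma orbit_of_props: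
  assumes x: "x < N"
  shows "closed_under (fst u) (orbit_of x)" "closed_under (fst v) (orbit_of x)" "orbit_of x \<subseteq> {..<N}"
    and "comps (orbit_of x) (fun_graph (orbit_of x) (fst u) \<union> fun_graph (orbit_of x) (fst v)) = 1"
proof -
  let ?R = "fun_graph {..<N} (fst u) \<union> fun_graph {..<N} (fst v)"
  let ?Y = "orbit_of x"
  have "conn ?R \<subseteq> {(a, b). a < N \<longleftrightarrow> b < N}"
    using U.s_less V.s_less by (intro conn_least reflI symI transI) (auto simp: fun_graph_def)
  then show sub: "?Y \<subseteq> {..<N}"
    using x by (auto simp: orbit_of_def)
  have closed: "closed_under h ?Y" if h: "\<And>i. i < N \<Longrightarrow> (i, h i) \<in> conn ?R" "\<And>i. h i < N \<longleftrightarrow> i < N" for h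
    unfolding closed_under_def
  proof (intro allI iffI)
    fix i assume hi: "h i \<in> ?Y"
    then have "i < N"
      using sub h(2) by auto
    then show "i \<in> ?Y"
      using hi conn_trans[OF _ conn_sym[OF h(1)]] unfolding orbit_of_def Image_singleton_iff by blast
  next
    fix i assume i: "i \<in> ?Y"
    then have "i < N"
      using sub by auto
    then show "h i \<in> ?Y"
      using i conn_trans[OF _ h(1)] unfolding orbit_of_def Image_singleton_iff by blast
  qed
  show cu: "closed_under (fst u) ?Y"
    by (rule closed) (auto simp: fun_graph_def U.s_less intro!: conn_edge)
  show cv: "closed_under (fst v) ?Y"
    by (rule closed) (auto simp: fun_graph_def V.s_less intro!: conn_edge)
  let ?T = "fun_graph ?Y (fst u) \<union> fun_graph ?Y (fst v)"
  have "conn ?R \<subseteq> {(a, b). (a \<in> ?Y \<longleftrightarrow> b \<in> ?Y) \<and> (a \<in> ?Y \<longrightarrow> (a, b) \<in> conn ?T)}"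
  proof (rule conn_least)
    fix a b assume "(a, b) \<in> ?R"
    then have "b = fst u a \<or> b = fst v a"
      by (auto simp: fun_graph_def)
    then show "(a, b) \<in> {(a, b). (a \<in> ?Y \<longleftrightarrow> b \<in> ?Y) \<and> (a \<in> ?Y \<longrightarrow> (a, b) \<in> conn ?T)}"
      using cu cv by (auto simp: closed_under_def fun_graph_def intro!: conn_edge)
  next
    show "refl {(a, b). (a \<in> ?Y \<longleftrightarrow> b \<in> ?Y) \<and> (a \<in> ?Y \<longrightarrow> (a, b) \<in> conn ?T)}"
      by (rule reflI) (simp add: conn_refl)
    show "sym {(a, b). (a \<in> ?Y \<longleftrightarrow> b \<in> ?Y) \<and> (a \<in> ?Y \<longrightarrow> (a, b) \<in> conn ?T)}"
      by (rule symI) (auto dest: conn_sym)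
    show "trans {(a, b). (a \<in> ?Y \<longleftrightarrow> b \<in> ?Y) \<and> (a \<in> ?Y \<longrightarrow> (a, b) \<in> conn ?T)}"
      by (rule transI) (auto dest: conn_trans)
  qed
  moreover have "x \<in> ?Y"
    by (simp add: orbit_of_def conn_refl)
  ultimately have joined: "(x, y) \<in> conn ?T" if "y \<in> ?Y" for y
    using that by (auto simp: orbit_of_def)
  have cls: "conn ?T `` {y} = conn ?T `` {x}" if "y \<in> ?Y" for y
    unfolding conn_class_eq by (rule conn_sym[OF joined[OF that]])
  have "(\<lambda>y. conn ?T `` {y}) ` ?Y = (\<lambda>y. conn ?T `` {x}) ` ?Y"
    by (rule image_cong[OF refl cls])
  also have "\<dots> = {conn ?T `` {x}}"
    using \<open>x \<in> ?Y\<close> by blast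
  finally show "comps ?Y ?T = 1"
    by (simp add: comps_def)
qed

lemma closed_bij_betw: "h permutes {..<N} \<Longrightarrow> closed_under h Y \<Longrightarrow> bij_betw h Y Y"
proof -
  assume h: "h permutes {..<N}" and Y: "closed_under h Y"
  have "h ` Y = Y"
  proof (intro equalityI subsetI)
    fix y assume y: "y \<in> Y"
    have "h (inv_into UNIV h y) = y"
      using permutes_inverses(1)[OF h] .
    then show "y \<in> h ` Y"
      using y Y unfolding closed_under_def by (metis imageI)
  qed (use Y in \<open>auto simp: closed_under_def\<close>)
  then show ?thesis
    using permutes_inj_on[OF h] by (simp add: bij_betw_def)
qed

text \<open>In the product of all scalars of w on Y, those of u appear permuted by v, which does not
  change their product.\<close>

lemma cycle_det_prod:
  assumes Y: "closed_under (fst u) Y" "closed_under (fst v) Y" "finite Y"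
  shows "(\<Prod>c\<in>cycle_reps (fst w) Y. cycle_det w c) =
    (\<Prod>c\<in>cycle_reps (fst u) Y. cycle_det u c) * (\<Prod>c\<in>cycle_reps (fst v) Y. cycle_det v c)"
proof -
  have "(\<Prod>i\<in>Y. snd w i) = (\<Prod>i\<in>Y. snd u (fst v i)) * (\<Prod>i\<in>Y. snd v i)"
    unfolding snd_Gf_mult by (rule prod.distrib)
  also have "(\<Prod>i\<in>Y. snd u (fst v i)) = (\<Prod>i\<in>Y. snd u i)"
    by (rule prod.reindex_bij_betw[OF closed_bij_betw[OF V.perm Y(2)]])
  finally show ?thesis
    unfolding cycle_det_def prod_cycle_reps[OF U.perm Y(1,3), symmetric]
      prod_cycle_reps[OF V.perm Y(2,3), symmetric]
      prod_cycle_reps[OF W.perm closed_w[OF Y(1,2)] Y(3), symmetric] .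
qed

text \<open>On an orbit the degree bound and the cycle count leave at most two non-special cycles.\<close>

lemma defect_orbit:
  assumes x: "x < N" and n: "n > 2" and nz: "W.pf structure_const \<notin> W.I"
  shows "W.defect_on (orbit_of x) = U.defect_on (orbit_of x) + V.defect_on (orbit_of x)"
proof -
  let ?Y = "orbit_of x"
  note Y = orbit_of_props[OF x]
  have fin: "finite ?Y"
    using Y(3) finite_subset by blast
  note Yw = closed_w[OF Y(1,2)]
  \<comment> \<open>Otherwise \<open>I_large_degree\<close> would put the structure constant into
    the ideal.\<close>
  have "(real n - 2) / 2 * (real (card (U.moved \<inter> ?Y)) + real (card (V.moved \<inter> ?Y)) -
      real (card (W.moved \<inter> ?Y))) \<le> real (n - 2) * real (card (W.special_reps ?Y))"
    using W.I_large_degree[OF structure_const_polys hom_on_structure_const[OF Y(1,2)] Yw Y(3)] nz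
    by (meson not_le)
  then have "(real n - 2) * (real (card (U.moved \<inter> ?Y)) + real (card (V.moved \<inter> ?Y)) -
      real (card (W.moved \<inter> ?Y))) \<le> (real n - 2) * (2 * real (card (W.special_reps ?Y)))"
    using n by (simp add: of_nat_diff)
  then have "real (card (U.moved \<inter> ?Y)) + real (card (V.moved \<inter> ?Y)) - real (card (W.moved \<inter> ?Y))
      \<le> 2 * real (card (W.special_reps ?Y))"
    using n by (simp add: mult_le_cancel_left_pos)
  then have special: "card ?Y \<le> card (U.special_reps ?Y) + card (V.special_reps ?Y) + card (W.special_reps ?Y)"
    unfolding U.card_moved_special[OF Y(1,3)] V.card_moved_special[OF Y(2,3)] W.card_moved_special[OF Yw Y(3)]
    by linarith
  have "fun_graph ?Y (fst w) = fun_graph ?Y (fst u \<circ> fst v)"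
    by (simp only: fst_Gf_mult)
  then have count: "card (cycle_reps (fst u) ?Y) + card (cycle_reps (fst v) ?Y) + card (cycle_reps (fst w) ?Y)
      \<le> card ?Y + 2"
    using cycle_count_inequality[OF fin closed_bij_betw[OF U.perm Y(1)] closed_bij_betw[OF V.perm Y(2)]]
      comps_fun_graph_eq[OF U.perm Y(1) fin] comps_fun_graph_eq[OF V.perm Y(2) fin]
      comps_fun_graph_eq[OF W.perm Yw fin] Y(4) by simp
  let ?A = "cycle_reps (fst u) ?Y" and ?B = "cycle_reps (fst v) ?Y" and ?D = "cycle_reps (fst w) ?Y"
  have fins: "finite ?A" "finite ?B" "finite ?D"
    using fin by (simp_all add: cycle_reps_def)
  have less: "c < N" if "c \<in> ?A \<or> c \<in> ?B \<or> c \<in> ?D" for c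
    using that Y(3) by (auto simp: cycle_reps_def)
  \<comment> \<open>The disjoint sum collects the cycles of all three permutations. The determinants
    of w enter inverted, so that the product over all cycles is 1.\<close>
  let ?K = "?A <+> (?B <+> ?D)"
  define z where "z = case_sum (cycle_det u) (case_sum (cycle_det v) (\<lambda>c. inverse (cycle_det w c)))"
  have det_ne: "cycle_det w c \<noteq> 0" if "c \<in> ?D" for c
    using W.norm_cycle_det[OF less] that by force
  have "(\<Sum>k\<in>?K. arg_defect (z k)) = 0"
  proof (rule sum_arg_defect_zero)
    show "finite ?K"
      using fins by simp
    show "norm (z k) = 1" if "k \<in> ?K" for k
      using that less U.norm_cycle_det V.norm_cycle_det W.norm_cycle_det
      by (auto simp: z_def norm_inverse)
    have "(\<Prod>k\<in>?K. z k) = (\<Prod>c\<in>?A. cycle_det u c) * ((\<Prod>c\<in>?B. cycle_det v c) * (\<Prod>c\<in>?D. inverse (cycle_det w c)))"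
      using fins by (simp add: prod.Plus z_def o_def)
    also have "(\<Prod>c\<in>?D. inverse (cycle_det w c)) = inverse (\<Prod>c\<in>?D. cycle_det w c)"
      using prod_inversef[of "cycle_det w" ?D] by (simp add: o_def)
    also have "(\<Prod>c\<in>?A. cycle_det u c) * ((\<Prod>c\<in>?B. cycle_det v c) * inverse (\<Prod>c\<in>?D. cycle_det w c)) =
        (\<Prod>c\<in>?D. cycle_det w c) * inverse (\<Prod>c\<in>?D. cycle_det w c)"
      unfolding cycle_det_prod[OF Y(1,2) fin] by (simp only: mult.assoc)
    also have "\<dots> = 1"
      using det_ne fins by (intro right_inverse) simp
    finally show "(\<Prod>k\<in>?K. z k) = 1" .
    have "{k \<in> ?K. z k \<noteq> 1} = (?A - U.special_reps ?Y) <+> ((?B - V.special_reps ?Y) <+> (?D - W.special_reps ?Y))"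
      by (auto simp: z_def U.special_reps_def V.special_reps_def W.special_reps_def)
    then have "card {k \<in> ?K. z k \<noteq> 1} =
        card (?A - U.special_reps ?Y) + (card (?B - V.special_reps ?Y) + card (?D - W.special_reps ?Y))"
      using fins by (simp add: card_Plus)
    moreover have sub: "U.special_reps ?Y \<subseteq> ?A" "V.special_reps ?Y \<subseteq> ?B" "W.special_reps ?Y \<subseteq> ?D"
      by (auto simp: U.special_reps_def V.special_reps_def W.special_reps_def)
    moreover have "card (U.special_reps ?Y) \<le> card ?A" "card (V.special_reps ?Y) \<le> card ?B"
        "card (W.special_reps ?Y) \<le> card ?D"
      using sub fins by (simp_all add: card_mono)
    moreover have "finite (U.special_reps ?Y)" "finite (V.special_reps ?Y)" "finite (W.special_reps ?Y)"
      using sub fins finite_subset by blast+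
    ultimately show "card {k \<in> ?K. z k \<noteq> 1} \<le> 2"
      using special count by (simp add: card_Diff_subset)
  qed
  moreover have "(\<Sum>k\<in>?K. arg_defect (z k)) =
      (\<Sum>c\<in>?A. arg_defect (cycle_det u c)) + ((\<Sum>c\<in>?B. arg_defect (cycle_det v c)) +
      (\<Sum>c\<in>?D. arg_defect (inverse (cycle_det w c))))"
    using fins by (simp add: sum.Plus z_def o_def)
  moreover have "(\<Sum>c\<in>?D. arg_defect (inverse (cycle_det w c))) = (\<Sum>c\<in>?D. - arg_defect (cycle_det w c))"
    using W.norm_cycle_det less by (intro sum.cong refl arg_defect_inverse) blast
  ultimately show ?thesis
    unfolding U.defect_on_def V.defect_on_def W.defect_on_def by (simp add: sum_negf)
qed

lemma sum_orbits:
  "(\<Sum>c\<in>cycle_reps h {..<N}. (f c :: real)) = (\<Sum>Y\<in>orbit_of ` {..<N}. \<Sum>c\<in>cycle_reps h Y. f c)"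
proof -
  have "(\<Sum>c\<in>cycle_reps h {..<N}. f c) =
      (\<Sum>Y\<in>orbit_of ` {..<N}. \<Sum>c\<in>{c \<in> cycle_reps h {..<N}. orbit_of c = Y}. f c)"
    by (rule sum.group[symmetric]) (auto simp: cycle_reps_def)
  also have "\<dots> = (\<Sum>Y\<in>orbit_of ` {..<N}. \<Sum>c\<in>cycle_reps h Y. f c)"
  proof (rule sum.cong[OF refl])
    fix Y assume "Y \<in> orbit_of ` {..<N}"
    then obtain x where x: "x < N" "Y = orbit_of x"
      by auto
    have "orbit_of c = Y \<longleftrightarrow> c \<in> Y" for c
      unfolding x(2) orbit_of_def conn_class_eq Image_singleton_iff
      by (intro iffI) (erule conn_sym)+
    then have "{c \<in> cycle_reps h {..<N}. orbit_of c = Y} = cycle_reps h Y"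
      using orbit_of_props(3)[OF x(1)] x(2) by (auto simp: cycle_reps_def)
    then show "(\<Sum>c\<in>{c \<in> cycle_reps h {..<N}. orbit_of c = Y}. f c) = (\<Sum>c\<in>cycle_reps h Y. f c)"
      by simp
  qed
  finally show ?thesis .
qed

lemma defect_additive:
  assumes nz: "W.pf structure_const \<notin> W.I"
  shows "W.defect_on {..<N} = U.defect_on {..<N} + V.defect_on {..<N}"
proof (cases "n = 2")
  \<comment> \<open>The degree bound carries no information here. Instead every determinant is a
    product of signs, and h vanishes at 1 and at -1.\<close>
  case True
  have zero: "arg_defect (cycle_det y c) = 0"
    if "fst y permutes {..<N}" "\<And>k. k < N \<Longrightarrow> snd y k ^ n = 1" "c < N" for y c
  proof (rule arg_defect_square)
    have "cycle_det y c ^ 2 = (\<Prod>j\<in>cyc (fst y) c. snd y j ^ 2)"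
      by (simp add: cycle_det_def prod_power_distrib)
    also have "\<dots> = (\<Prod>j\<in>cyc (fst y) c. 1)"
      using that(2) cyc_less[OF that(1,3)] True by (intro prod.cong) auto
    finally show "cycle_det y c ^ 2 = 1"
      by simp
  qed
  have "U.defect_on {..<N} = 0"
    unfolding U.defect_on_def by (intro sum.neutral ballI zero U.perm U.g_pow) (auto simp: cycle_reps_def)
  moreover have "V.defect_on {..<N} = 0"
    unfolding V.defect_on_def by (intro sum.neutral ballI zero V.perm V.g_pow) (auto simp: cycle_reps_def)
  moreover have "W.defect_on {..<N} = 0"
    unfolding W.defect_on_def by (intro sum.neutral ballI zero W.perm W.g_pow) (auto simp: cycle_reps_def)
  ultimately show ?thesis
    by simp
next
  case False
  then have n: "n > 2"
    using U.n2 by simp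
  have "W.defect_on {..<N} = (\<Sum>Y\<in>orbit_of ` {..<N}. W.defect_on Y)"
    unfolding W.defect_on_def by (rule sum_orbits)
  also have "\<dots> = (\<Sum>Y\<in>orbit_of ` {..<N}. U.defect_on Y + V.defect_on Y)"
    using defect_orbit[OF _ n nz] by (intro sum.cong) auto
  also have "\<dots> = U.defect_on {..<N} + V.defect_on {..<N}"
    unfolding sum.distrib U.defect_on_def V.defect_on_def
      sum_orbits[of _ "fst u"] sum_orbits[of _ "fst v"] ..
  finally show ?thesis .
qed

end

text \<open>A codimension x enters a charge as x / 2 - x / n, which is (n - 2) / 2 times x / n. The
  degree of the structure constant, divided by n, makes up exactly the difference of these
  terms.\<close>

lemma charge_identity:
  fixes m :: real
  assumes "m \<noteq> 0" "D = d + e + (m - 2) / 2 * (x + y - w)"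
  shows "(D - w) / m + w / 2 = (d - x) / m + x / 2 + ((e - y) / m + y / 2)"
proof -
  have "(m - 2) / 2 * (x + y - w) / m = (x + y - w) / 2 - (x + y - w) / m"
    using assms(1) by (simp add: field_simps)
  then show ?thesis
    unfolding assms(2) add_divide_distrib diff_divide_distrib by argo
qed

theorem proposition29:
  fixes N n d e :: nat and G :: "elt set" and E :: "elt \<Rightarrow> eigensystem"
    and \<phi> \<psi> :: mpoly and u v :: elt
  assumes "N \<ge> 1" and "n \<ge> 2"
    and "subgroup G (Gf N n)"
    and "\<And>w. w \<in> G \<Longrightarrow> eigencoordinates N w (E w)"
    and "\<phi> \<in> polys N" and "homogeneous d \<phi>"
    and "\<psi> \<in> polys N" and "homogeneous e \<psi>"
    and "u \<in> G" and "v \<in> G"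
    and "cup N n G E (\<phi>, u) (\<psi>, v) \<noteq> A_zero N n G"
  shows "cup N n G E (\<phi>, u) (\<psi>, v)
           \<in> bigraded_part N n G (q_l N n d u + q_l N n e v) (q_r N n d u + q_r N n e v) \<and>
         (\<forall>a b. cup N n G E (\<phi>, u) (\<psi>, v) \<in> bigraded_part N n G a b \<longrightarrow>
           a = q_l N n d u + q_l N n e v \<and> b = q_r N n d u + q_r N n e v)"
proof -
  let ?w = "u \<otimes>\<^bsub>Gf N n\<^esub> v"
  have n1: "n \<ge> 1"
    using assms(2) by simp
  interpret Gf: group "Gf N n"
    by (rule group_Gf[OF n1])
  have carr: "y \<in> carrier (Gf N n)" if "y \<in> G" for y
    using subgroup.mem_carrier[OF assms(3) that] .
  have wG: "?w \<in> G"
    using subgroup.m_closed[OF assms(3,9,10)] .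
  have elt: "fermat_elt N y (E y) n" if y: "y \<in> G" for y
    using Gf_carrierD[OF carr[OF y] n1] assms(2) assms(4)[OF y] by unfold_locales auto
  interpret fermat_pair N n u v "E u" "E v" "E ?w"
    unfolding fermat_pair_def using elt assms(9,10) wG by blast
  let ?p = "\<phi> * act u \<psi> * sigma_uv N n E u v"
  have sigma: "sigma_uv N n E u v = structure_const"
    by (simp add: sigma_uv_def Let_def)
  have cup: "cup N n G E (\<phi>, u) (\<psi>, v) = sector_elt N n G ?w ?p"
    by (simp add: cup_def)
  have act_polys: "act u \<psi> \<in> polys N"
    using assms(7) U.s_less unfolding polys_iff_hom_on by (intro hom_on_act) (simp_all flip: not_less)
  have p_polys: "?p \<in> polys N"
    unfolding sigma using assms(5) act_polys structure_const_polys by (intro polys_closed)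
  have zero: "jclass N n y 0 = \<zero>\<^bsub>Jac N n y\<^esub>" if "y \<in> G" for y
  proof -
    interpret Y: fermat_elt N y "E y" n
      by (rule elt[OF that])
    show ?thesis
      using Y.jclass_eq_zero_iff[OF polys_closed(1)] Y.I_zero by blast
  qed
  have p_nz: "W.pf ?p \<notin> W.I"
  proof
    assume "W.pf ?p \<in> W.I"
    then have "jclass N n ?w ?p = \<zero>\<^bsub>Jac N n ?w\<^esub>"
      using W.jclass_eq_zero_iff[OF p_polys] by blast
    then have "sector_elt N n G ?w ?p = A_zero N n G"
      by (simp add: sector_elt_def A_zero_def fun_eq_iff)
    then show False
      using assms(11) cup by simp
  qed
  \<comment> \<open>The class of the product is a multiple of that of the structure
    constant.\<close>
  then have nz: "W.pf structure_const \<notin> W.I"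
    using W.I_mult[OF polys_closed(7)[OF assms(5) act_polys]] unfolding sigma by blast
  have p_ne: "?p \<noteq> 0"
    using p_nz W.I_zero by auto
  let ?k = "(real n - 2) / 2 * (real (card U.moved) + real (card V.moved) - real (card W.moved))"
  have "hom_on UNIV (real d + real e + ?k) ?p"
    unfolding sigma using assms(6,8) homogeneous_iff_hom_on
    by (intro hom_on_mult structure_const_degree hom_on_act) auto
  \<comment> \<open>A priori the degree is only a real number; it is natural because the polynomial
    is nonzero.\<close>
  moreover obtain D where D: "real d + real e + ?k = real D"
    using hom_on_eq_nat[OF calculation p_ne] by blast
  ultimately have p_hom: "hom_on UNIV (real D) ?p"
    by simp
  have charge: "q_l N n c y = (real c - real (card (eigen_elt.moved N (E y)))) / real n +
        (real (card (eigen_elt.moved N (E y))) + fermat_elt.defect_on y {..<N}) / 2 \<and>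
      q_r N n c y = (real c - real (card (eigen_elt.moved N (E y)))) / real n +
        (real (card (eigen_elt.moved N (E y))) - fermat_elt.defect_on y {..<N}) / 2"
    if y: "y \<in> G" for y c
  proof -
    interpret Y: fermat_elt N y "E y" n
      by (rule elt[OF y])
    note Y.charges[OF Gf.inv_closed[OF carr[OF y]] carr[OF y] Gf.l_inv[OF carr[OF y]] refl]
    then show ?thesis
      by blast
  qed
  have n0: "real n \<noteq> 0"
    using assms(2) by simp
  have "real D = real d + real e + ?k"
    using D by simp
  then have arith: "(real D - real (card W.moved)) / real n + real (card W.moved) / 2 =
     (real d - real (card U.moved)) / real n + real (card U.moved) / 2 +
     ((real e - real (card V.moved)) / real n + real (card V.moved) / 2)"
    by (rule charge_identity[OF n0])
  \<comment> \<open>Both charges share the part covered by \<open>arith\<close>; half of the defect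
    is added in one and subtracted in the other.\<close>
  have total: "q_l N n D ?w = q_l N n d u + q_l N n e v" "q_r N n D ?w = q_r N n d u + q_r N n e v"
    using charge[OF wG] charge[OF assms(9)] charge[OF assms(10)] arith defect_additive[OF nz]
    by (simp_all add: add_divide_distrib diff_divide_distrib)
  have in_A: "sector_elt N n G ?w ?p \<in> A_space N n G"
  proof -
    have "jclass N n ?w ?p \<in> carrier (Jac N n ?w)"
      by (rule W.jclass_in_carrier[OF p_polys])
    moreover have "\<zero>\<^bsub>Jac N n y\<^esub> \<in> carrier (Jac N n y)" if "y \<in> G" for y
    proof -
      interpret Y: fermat_elt N y "E y" n
        by (rule elt[OF that])
      show ?thesis
        using Y.jclass_in_carrier[OF polys_closed(1)] zero[OF that] by simp
    qed
    ultimately show ?thesis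
      by (auto simp: A_space_def sector_elt_def)
  qed
  have val: "sector_elt N n G ?w ?p y = (if y = ?w then jclass N n ?w ?p else \<zero>\<^bsub>Jac N n y\<^esub>)" if "y \<in> G" for y
    using that by (simp add: sector_elt_def)
  show ?thesis
  proof (intro conjI allI impI)
    show "cup N n G E (\<phi>, u) (\<psi>, v)
       \<in> bigraded_part N n G (q_l N n d u + q_l N n e v) (q_r N n d u + q_r N n e v)"
      unfolding cup bigraded_part_def
    proof (intro CollectI conjI ballI in_A)
      fix y assume y: "y \<in> G"
      show "\<exists>da \<phi>'. \<phi>' \<in> polys N \<and> homogeneous da \<phi>' \<and> sector_elt N n G ?w ?p y = jclass N n y \<phi>' \<and>
        (\<phi>' = 0 \<or> q_l N n da y = q_l N n d u + q_l N n e v \<and> q_r N n da y = q_r N n d u + q_r N n e v)"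
      proof (cases "y = ?w")
        case True
        show ?thesis
        proof (rule exI[of _ D], rule exI[of _ ?p], intro conjI)
          show "homogeneous D ?p"
            unfolding homogeneous_iff_hom_on by (rule p_hom)
          show "sector_elt N n G ?w ?p y = jclass N n y ?p"
            using val[OF y] unfolding if_P[OF True] unfolding True .
          show "?p = 0 \<or> q_l N n D y = q_l N n d u + q_l N n e v \<and> q_r N n D y = q_r N n d u + q_r N n e v"
            unfolding True using total by simp
        qed (rule p_polys)
      next
        case False
        show ?thesis
        \<comment> \<open>All other sectors carry the zero class, represented by the zero
          polynomial, whose degree is free.\<close>
        proof (rule exI[of _ 0], rule exI[of _ 0], intro conjI)
          show "homogeneous 0 0"
            by (simp add: homogeneous_def)
          show "sector_elt N n G ?w ?p y = jclass N n y 0"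
            using val[OF y] unfolding if_not_P[OF False] unfolding zero[OF y] .
        qed (simp_all add: polys_closed)
      qed
    qed
  next
    fix a b assume "cup N n G E (\<phi>, u) (\<psi>, v) \<in> bigraded_part N n G a b"
    then have "\<exists>c \<chi>. \<chi> \<in> polys N \<and> homogeneous c \<chi> \<and> sector_elt N n G ?w ?p ?w = jclass N n ?w \<chi> \<and>
        (\<chi> = 0 \<or> q_l N n c ?w = a \<and> q_r N n c ?w = b)"
      unfolding cup bigraded_part_def using wG by blast
    then obtain c \<chi> where \<chi>: "\<chi> \<in> polys N" "homogeneous c \<chi>" "jclass N n ?w ?p = jclass N n ?w \<chi>"
        "\<chi> = 0 \<or> q_l N n c ?w = a \<and> q_r N n c ?w = b"
      unfolding val[OF wG] if_P[OF refl] by blast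
    \<comment> \<open>A zero representative would leave a and b unconstrained; it is excluded
      because the class is nonzero.\<close>
    have "\<chi> \<noteq> 0"
    proof
      assume "\<chi> = 0"
      then have "jclass N n ?w ?p = \<zero>\<^bsub>Jac N n ?w\<^esub>"
        using \<chi>(3) zero[OF wG] by (simp only:)
      then have "W.pf ?p \<in> W.I"
        using W.jclass_eq_zero_iff[OF p_polys] by blast
      with p_nz show False
        by (rule notE)
    qed
    moreover have "D = c"
      by (rule W.jclass_degree_unique[OF p_polys p_hom \<chi>(1) _ \<chi>(3) p_nz])
        (rule \<chi>(2)[unfolded homogeneous_iff_hom_on])
    ultimately show "a = q_l N n d u + q_l N n e v" "b = q_r N n d u + q_r N n e v"
      using \<chi>(4) total by auto
  qed
qed

end
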